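(* Let $\tau(m)$, $m\ge1$, be the Ramanujan numbers. For every $m\ge1$ the following are equivalent: (a) $\tau(m)=0$; (b) the shell $(W_8)_{2m}$ is a spherical $8$-design (and then also a spherical $11$-design); (c) for every even selfdual lattice $\Lambda$ of rank $16$, the shell $\Lambda_{2m}$ is a spherical $4$-design (and then also a spherical $7$-design).
   Context: The Ramanujan numbers are defined by $\sum_{m\ge1}\tau(m)q^{2m}=q^2\prod_{k\ge1}(1-q^{2k})^{24}$ (with $q=e^{i\pi z}$; equivalently $\Delta_{24}=\theta_3^8\Delta_8^2$ where $\Delta_8=\tfrac1{16}\theta_2^4\theta_4^4$). $W_8=\{x\in\mathbb R^8:2x_i\in\mathbb Z,\ x_i-x_1\in\mathbb Z,\ \sum x_i\in2\mathbb Z\}$ is the even selfdual lattice of rank 8. A selfdual lattice is an integral lattice equal to its dual; even means all norms even. Shell $\Lambda_m=\{x\in\Lambda:\langle x,x\rangle=m\}$. For antipodal sets $X$, $X$ is a spherical $t$-design iff $\sum_{x\in X}P(x)=0$ for every homogeneous harmonic polynomial $P$ of every even degree $2j$ with $2\le2j\le t$. *)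

theory Defs
  imports "HOL-Analysis.Analysis" "HOL-Computational_Algebra.Formal_Power_Series"
begin

text \<open>Ramanujan numbers: tau m is the coefficient of Q^m in Q * prod_{k>=1} (1 - Q^k)^24
  (Q = q^2). The coefficient of Q^(m-1) of the infinite product only involves the
  factors with k <= m - 1, so the finite product over {1..m} computes it exactly.\<close>
definition ramanujan_tau :: "nat \<Rightarrow> int" where
  "ramanujan_tau m =
     fps_nth ((\<Prod>k\<in>{1..m}. (1 - fps_X ^ k) ^ 24) :: int fps) (m - 1)"

definition W8 :: "(real^8) set" where
  "W8 = {x. (\<forall>i. 2 * x$i \<in> \<int>) \<and> (\<forall>i. x$i - x$1 \<in> \<int>) \<and>
            (\<exists>k::int. (\<Sum>i\<in>UNIV. x$i) = 2 * of_int k)}"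

definition shell :: "(real^'n) set \<Rightarrow> real \<Rightarrow> (real^'n) set" where
  "shell L m = {x \<in> L. x \<bullet> x = m}"

definition full_lattice :: "(real^'n) set \<Rightarrow> bool" where
  "full_lattice L \<longleftrightarrow> (\<exists>b::'n \<Rightarrow> real^'n. inj b \<and> independent (range b) \<and>
      L = {(\<Sum>i\<in>UNIV. of_int (a i) *\<^sub>R b i) | a :: 'n \<Rightarrow> int. True})"

definition dual_lattice :: "(real^'n) set \<Rightarrow> (real^'n) set" where
  "dual_lattice L = {y. \<forall>x\<in>L. x \<bullet> y \<in> \<int>}"

definition even_selfdual_lattice :: "(real^'n) set \<Rightarrow> bool" where
  "even_selfdual_lattice L \<longleftrightarrow> full_lattice L \<and>
     (\<forall>x\<in>L. \<forall>y\<in>L. x \<bullet> y \<in> \<int>) \<and> L = dual_lattice L \<and>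
     (\<forall>x\<in>L. \<exists>k::int. x \<bullet> x = 2 * of_int k)"

text \<open>Homogeneous polynomial of degree k on R^n, given by coefficients c on exponent
  vectors alpha with |alpha| = k, that is harmonic: its Laplacian, written out on
  coefficients, vanishes (coefficient of x^beta in Delta P, |beta| = k - 2, is
  sum_i (beta_i+2)(beta_i+1) c(beta + 2 e_i)).\<close>
definition hom_harmonic_poly :: "nat \<Rightarrow> (real^'n \<Rightarrow> real) \<Rightarrow> bool" where
  "hom_harmonic_poly k P \<longleftrightarrow>
     (\<exists>c :: ('n \<Rightarrow> nat) \<Rightarrow> real.
        P = (\<lambda>x. \<Sum>\<alpha>\<in>{\<alpha>. sum \<alpha> UNIV = k}. c \<alpha> * (\<Prod>i\<in>UNIV. (x$i) ^ (\<alpha> i))) \<and>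
        (\<forall>\<beta>::'n \<Rightarrow> nat. sum \<beta> UNIV + 2 = k \<longrightarrow>
           (\<Sum>i\<in>UNIV. real ((\<beta> i + 2) * (\<beta> i + 1)) * c (\<beta>(i := \<beta> i + 2))) = 0))"

text \<open>Spherical t-design (finite subset of a sphere centred at 0), Venkov's formulation:
  sum over X of every homogeneous harmonic polynomial of degree 1..t vanishes.\<close>
definition spherical_design :: "nat \<Rightarrow> (real^'n) set \<Rightarrow> bool" where
  "spherical_design t X \<longleftrightarrow> finite X \<and> (\<exists>r. \<forall>x\<in>X. x \<bullet> x = r) \<and>
     (\<forall>k P. 1 \<le> k \<and> k \<le> t \<and> hom_harmonic_poly k P \<longrightarrow> (\<Sum>x\<in>X. P x) = 0)"

end

theory Submission
  imports Defs "HOL-Probability.Probability" "HOL-Complex_Analysis.Complex_Analysis"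
begin

text \<open>
  For an even self-dual lattice \<open>\<Lambda>\<close> of rank \<open>n\<close> and a harmonic polynomial \<open>P\<close> of even degree
  \<open>k\<close>, the theta series with coefficients \<open>P\<close> is a modular form of weight \<open>n/2 + k\<close>, and a cusp
  form if \<open>k > 0\<close>. For \<open>n = 8\<close>, \<open>k \<le> 10\<close> and \<open>n = 16\<close>, \<open>k \<le> 6\<close> it vanishes, except in weight 12
  (\<open>k = 8\<close>, respectively \<open>k = 4\<close>), where it is a multiple of \<open>\<Delta> = \<Sum>\<tau>(m) q\<^sup>m\<close>; its coefficients are
  the sums of \<open>P\<close> over the shells. The multiple is non-zero for suitable \<open>P\<close> on \<open>W\<^sub>8 = D\<^sub>8\<^sup>+\<close> and
  on \<open>D\<^sub>1\<^sub>6\<^sup>+\<close>, as the vectors of norm 2 show.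

  Self-duality gives Poisson summation, by comparing the lattice with an orthogonal sublattice,
  where the sum is a product of one-dimensional Gaussian sums. The vanishing of cusp forms follows
  from the maximum principle applied to \<open>h\<^sup>1\<^sup>2/\<Delta>\<^sup>w\<close>; this needs the product for \<open>\<Delta>\<close> and its
  modularity, which come from Euler's pentagonal number theorem and the Poisson formula again.
  All transformation formulas are proved on the imaginary axis and extended by analytic
  continuation.
\<close>

subsection \<open>Poisson summation for the Gaussian on the integers\<close>

text \<open>The inversion formula with harmonic coefficients needs no Fourier transform of a
  polynomial: Poisson summation for the Gaussian shifted by \<open>s y\<close> is a generating
  function in \<open>s\<close>, and comparing the coefficients of \<open>s^k\<close> relates the
  k-th directional moments at \<open>t\<close> and \<open>1/t\<close> up to multiples of |y|^2.
  Harmonic polynomials are orthogonal to such multiples. The degrees are dictated by the weights.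
  Degree 8 in rank 8 and degree 4 in rank 16 have weight 12. Weight 14 (degrees 10 and 6) is beyond
  the maximum principle alone, since \<open>h^12 / Delta^14\<close> may have a pole at the cusp; the
  theta series of \<open>W8\<close>, a form of weight 4, settles it. Degrees 12 and 8 would have
  weight 16, where a nonzero cusp form exists, whence the bounds 11 and 7. Odd degrees vanish by
  antipodality. For the converse the two lattices differ: on the norm-2 vectors of \<open>W8\<close>
  a single test polynomial is nonnegative, whereas on those of \<open>D_16^+\<close> the polynomial
  of degree 4 changes sign and is summed over all pairs of coordinates.\<close>

lemma summable_exp_neg_abs_int: "(\<lambda>n::int. exp (- \<bar>real_of_int n\<bar>)) summable_on UNIV"
proof -
  have "summable (\<lambda>n. exp (- 1 :: real) ^ n)"
    by (rule summable_geometric) simp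
  hence "(\<lambda>n::nat. exp (- real n)) summable_on UNIV"
    by (intro norm_summable_imp_summable_on) (simp add: exp_of_nat_mult[symmetric])
  hence nat: "((\<lambda>n::int. exp (- \<bar>real_of_int n\<bar>)) \<circ> int) summable_on UNIV"
       "((\<lambda>n::int. exp (- \<bar>real_of_int n\<bar>)) \<circ> (\<lambda>n. - int n)) summable_on UNIV"
    by (simp_all add: o_def)
  have "(\<lambda>n::int. exp (- \<bar>real_of_int n\<bar>)) summable_on range int"
       "(\<lambda>n::int. exp (- \<bar>real_of_int n\<bar>)) summable_on range (\<lambda>n. - int n)"
    using nat by (subst summable_on_reindex; force simp: inj_on_def)+
  hence "(\<lambda>n::int. exp (- \<bar>real_of_int n\<bar>)) summable_on (range int \<union> range (\<lambda>n. - int n))"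
    by (rule summable_on_union)
  also have "range int \<union> range (\<lambda>n. - int n) = UNIV"
    by (auto intro: int_cases2)
  finally show ?thesis .
qed

text \<open>The linear term in |n| absorbs real and complex shifts of the Gaussian; completing the
  square leaves a multiple of exp(-|n|).\<close>

lemma summable_gaussian_int:
  assumes "c > 0"
  shows "(\<lambda>n::int. exp (d * \<bar>real_of_int n\<bar> - c * (real_of_int n)\<^sup>2)) summable_on UNIV"
proof (rule summable_on_comparison_test)
  \<comment> \<open>Maximum of (d + 1) x - c x^2 over real x.\<close>
  define A where "A = (d + 1)\<^sup>2 / (4 * c)"
  show "(\<lambda>n::int. exp A * exp (- \<bar>real_of_int n\<bar>)) summable_on UNIV"
    by (intro summable_on_cmult_right summable_exp_neg_abs_int)
  fix n :: int
  have "0 \<le> c * (\<bar>real_of_int n\<bar> - (d + 1) / (2 * c))\<^sup>2"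
    using assms by simp
  also have "\<dots> = c * (real_of_int n)\<^sup>2 - (d + 1) * \<bar>real_of_int n\<bar> + A"
    using assms by (simp add: A_def field_simps power2_eq_square)
  finally show "exp (d * \<bar>real_of_int n\<bar> - c * (real_of_int n)\<^sup>2) \<le> exp A * exp (- \<bar>real_of_int n\<bar>)"
    unfolding exp_add[symmetric] by (simp add: algebra_simps)
qed auto

text \<open>The shift \<open>z\<close> is complex so that the periodised Gaussian becomes an entire
  function; this supplies the differentiability at one point on which the convergence of its Fourier
  series rests.\<close>

definition gauss_sum :: "real \<Rightarrow> complex \<Rightarrow> complex" where
  "gauss_sum t z = (\<Sum>\<^sub>\<infinity>n::int. exp (- of_real (pi * t) * (of_int n + z)\<^sup>2))"

lemma gauss_term_bound:
  fixes z :: complex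
  assumes "t > 0" "norm z \<le> R"
  shows "norm (exp (- of_real (pi * t) * (of_int n + z)\<^sup>2)) \<le>
         exp (pi * t * R\<^sup>2) * exp (pi * t * (2 * R) * \<bar>real_of_int n\<bar> - pi * t * (real_of_int n)\<^sup>2)"
proof -
  have R: "R \<ge> 0" using assms(2) norm_ge_zero order_trans by blast
  have "(Im z)\<^sup>2 \<le> R\<^sup>2"
    using R abs_Im_le_cmod[of z] assms(2) by (intro power2_le_iff_abs_le[THEN iffD2]) auto
  moreover have "\<bar>of_int n * Re z\<bar> \<le> \<bar>of_int n\<bar> * R"
    using abs_Re_le_cmod[of z] assms(2) by (simp add: abs_mult mult_left_mono)
  hence "2 * (of_int n * Re z) \<ge> - (2 * R) * \<bar>of_int n\<bar>" by (simp add: algebra_simps abs_le_iff)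
  moreover have "(Re z)\<^sup>2 \<ge> 0" by simp
  moreover have "(of_int n + Re z)\<^sup>2 = (of_int n)\<^sup>2 + 2 * (of_int n * Re z) + (Re z)\<^sup>2"
    by (simp add: power2_sum)
  ultimately have "(Im z)\<^sup>2 - (of_int n + Re z)\<^sup>2 \<le> R\<^sup>2 + (2 * R) * \<bar>of_int n\<bar> - (of_int n)\<^sup>2"
    by linarith
  hence "pi * t * ((Im z)\<^sup>2 - (of_int n + Re z)\<^sup>2) \<le> pi * t * (R\<^sup>2 + (2 * R) * \<bar>of_int n\<bar> - (of_int n)\<^sup>2)"
    using assms(1) by (intro mult_left_mono) auto
  thus ?thesis
    by (simp add: exp_add[symmetric] algebra_simps power2_eq_square)
qed

lemma gauss_sum_uniform_limit:
  assumes "t > 0"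
  shows "uniform_limit (cball 0 R) (\<lambda>X z. \<Sum>n\<in>X. exp (- of_real (pi * t) * (of_int n + z)\<^sup>2))
           (gauss_sum t) (finite_subsets_at_top UNIV)"
  unfolding gauss_sum_def
proof (rule Weierstrass_m_test_general)
  show "(\<lambda>n::int. exp (pi * t * R\<^sup>2) * exp (pi * t * (2 * R) * \<bar>real_of_int n\<bar> - pi * t * (real_of_int n)\<^sup>2)) summable_on UNIV"
    using assms by (intro summable_on_cmult_right summable_gaussian_int) auto
qed (rule gauss_term_bound[OF assms], simp)

lemma gauss_sum_holomorphic:
  assumes "t > 0"
  shows "gauss_sum t holomorphic_on UNIV"
proof -
  have "gauss_sum t holomorphic_on ball 0 R" for R
    by (rule holomorphic_uniform_limit[OF _ gauss_sum_uniform_limit[OF assms]])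
       (auto intro!: always_eventually holomorphic_intros holomorphic_on_imp_continuous_on)
  hence "gauss_sum t field_differentiable at z" for z
    using holomorphic_on_imp_differentiable_at[of "gauss_sum t" "ball 0 (norm z + 1)" z] by auto
  thus ?thesis
    using holomorphic_on_def field_differentiable_at_within by blast
qed

section \<open>Fourier coefficients on the unit interval around 0\<close>

definition four_coeff :: "(real \<Rightarrow> complex) \<Rightarrow> int \<Rightarrow> complex" where
  "four_coeff g k = integral {- 1 / 2..1 / 2} (\<lambda>x. g x * cis (- 2 * pi * of_int k * x))"

lemma continuous_on_cis_real [continuous_intros]:
  "continuous_on A f \<Longrightarrow> continuous_on A (\<lambda>x. cis (f x))"
  unfolding cis_conv_exp by (intro continuous_intros)

lemma integral_cis:
  "integral {- 1 / 2..1 / 2} (\<lambda>x. cis (2 * pi * of_int k * x)) = (if k = 0 then 1 else 0)"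
proof (cases "k = 0")
  case False
  define F where "F = (\<lambda>x. cis (2 * pi * of_int k * x) / (2 * of_real pi * of_int k * \<i>))"
  have "((\<lambda>x. cis (2 * pi * of_int k * x)) has_integral (F (1 / 2) - F (- 1 / 2))) {- 1 / 2..1 / 2}"
  proof (rule fundamental_theorem_of_calculus)
    fix x :: real
    show "(F has_vector_derivative cis (2 * pi * of_int k * x)) (at x within {- 1 / 2..1 / 2})"
      unfolding F_def cis_conv_exp using False
      by (auto intro!: derivative_eq_intros has_vector_derivative_real_field simp: field_simps)
  qed auto
  moreover have "cis (pi * of_int k) = cis (- pi * of_int k)"
  proof -
    have "cis (pi * of_int k) = cis (- pi * of_int k) * cis (2 * pi * of_int k)"
      unfolding cis_mult by (rule arg_cong[of _ _ cis]) simp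
    also have "cis (2 * pi * of_int k) = 1"
      using cis_multiple_2pi[of "of_int k"] by simp
    finally show ?thesis unfolding mult_1_right .
  qed
  ultimately show ?thesis using False by (auto simp: F_def mult_ac dest: integral_unique)
qed simp

lemma four_coeff_diff:
  assumes "continuous_on {- 1 / 2..1 / 2} g" "continuous_on {- 1 / 2..1 / 2} h"
  shows "four_coeff (\<lambda>x. g x - h x) k = four_coeff g k - four_coeff h k"
  unfolding four_coeff_def ring_distribs
  by (intro integral_diff integrable_continuous_interval continuous_intros assms)

lemma four_coeff_cis:
  "four_coeff (\<lambda>x. c * cis (2 * pi * of_int l * x)) k = (if l = k then c else 0)"
proof -
  have "four_coeff (\<lambda>x. c * cis (2 * pi * of_int l * x)) k =
        c * integral {- 1 / 2..1 / 2} (\<lambda>x. cis (2 * pi * of_int (l - k) * x))"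
    unfolding four_coeff_def mult.assoc
    by (simp add: cis_mult algebra_simps)
  also have "\<dots> = (if l = k then c else 0)"
    unfolding integral_cis by simp
  finally show ?thesis .
qed

text \<open>Induction on K: subtracting the k-th component leaves the other coefficients unchanged
  and lowers the square integral by exactly |c|^2.\<close>

lemma bessel:
  assumes "finite K" "continuous_on {- 1 / 2..1 / 2} g"
  shows "(\<Sum>k\<in>K. (norm (four_coeff g k))\<^sup>2) \<le> integral {- 1 / 2..1 / 2} (\<lambda>x. (norm (g x))\<^sup>2)"
  using assms
proof (induction K arbitrary: g rule: finite_induct)
  case empty
  have "(\<lambda>x. (norm (g x))\<^sup>2) integrable_on {- 1 / 2..1 / 2}"
    by (intro integrable_continuous_interval continuous_intros empty)
  thus ?case using integral_nonneg[of "\<lambda>x. (norm (g x))\<^sup>2" "{- 1 / 2..1 / 2}"] by simp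
next
  case (insert k K)
  define c where "c = four_coeff g k"
  define h where "h = (\<lambda>x. g x - c * cis (2 * pi * of_int k * x))"
  have h: "continuous_on {- 1 / 2..1 / 2} h"
    unfolding h_def by (intro continuous_intros insert.prems)
  have "four_coeff h l = four_coeff g l" if "l \<in> K" for l
    unfolding h_def using insert.prems insert.hyps that
    by (subst four_coeff_diff) (auto intro!: continuous_intros simp: four_coeff_cis)
  hence "(\<Sum>l\<in>K. (norm (four_coeff g l))\<^sup>2) \<le> integral {- 1 / 2..1 / 2} (\<lambda>x. (norm (h x))\<^sup>2)"
    using insert.IH[OF h] by simp
  also have "integral {- 1 / 2..1 / 2} (\<lambda>x. (norm (h x))\<^sup>2) =
      integral {- 1 / 2..1 / 2} (\<lambda>x. (norm (g x))\<^sup>2 -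
        2 * Re (cnj c * (g x * cis (- 2 * pi * of_int k * x))) + (norm c)\<^sup>2)"
  proof (rule integral_cong)
    fix x :: real
    have "(norm (g x - c * e))\<^sup>2 = (norm (g x))\<^sup>2 - 2 * Re (cnj c * (g x * cnj e)) + (norm c)\<^sup>2"
      if "norm e = 1" for e
    proof -
      have "(norm (g x - c * e))\<^sup>2 = (norm (g x))\<^sup>2 - 2 * Re (cnj c * (g x * cnj e)) + (norm (c * e))\<^sup>2"
        by (simp only: cmod_power2) (simp add: power2_eq_square algebra_simps)
      thus ?thesis using that by (simp add: norm_mult)
    qed
    from this[of "cis (2 * pi * of_int k * x)"]
    show "(norm (h x))\<^sup>2 = (norm (g x))\<^sup>2 -
        2 * Re (cnj c * (g x * cis (- 2 * pi * of_int k * x))) + (norm c)\<^sup>2"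
      by (simp add: h_def cis_cnj)
  qed
  also have "\<dots> = integral {- 1 / 2..1 / 2} (\<lambda>x. (norm (g x))\<^sup>2) - 2 * Re (cnj c * c) + (norm c)\<^sup>2"
  proof (rule integral_unique, intro has_integral_add has_integral_diff has_integral_mult_right has_integral_Re)
    show "((\<lambda>x. (norm (g x))\<^sup>2) has_integral integral {- 1 / 2..1 / 2} (\<lambda>x. (norm (g x))\<^sup>2)) {- 1 / 2..1 / 2}"
      by (intro integrable_integral integrable_continuous_interval continuous_intros insert.prems)
    show "((\<lambda>x. g x * cis (- 2 * pi * of_int k * x)) has_integral c) {- 1 / 2..1 / 2}"
      unfolding c_def four_coeff_def
      by (intro integrable_integral integrable_continuous_interval continuous_intros insert.prems)
    show "((\<lambda>x. (norm c)\<^sup>2) has_integral (norm c)\<^sup>2) {- 1 / 2..1 / 2 :: real}"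
      using has_integral_const_real[of "(norm c)\<^sup>2" "- 1 / 2" "1 / 2"] by simp
  qed
  also have "Re (cnj c * c) = (norm c)\<^sup>2"
    unfolding cmod_power2 by (simp add: power2_eq_square)
  finally show ?case using insert.hyps by (simp add: c_def)
qed

text \<open>The Riemann-Lebesgue lemma, from the convergence of the sum of squares in Bessel's
  inequality. An arbitrary injective \<open>f\<close> covers frequencies going to plus and to minus
  infinity.\<close>

lemma four_coeff_tendsto_0:
  assumes "continuous_on {- 1 / 2..1 / 2} g" "inj f"
  shows "(\<lambda>n. four_coeff g (f n)) \<longlonglongrightarrow> 0"
proof -
  have "summable (\<lambda>n. (norm (four_coeff g (f n)))\<^sup>2)"
  proof (rule summableI_nonneg_bounded)
    fix n
    have "(\<Sum>k<n. (norm (four_coeff g (f k)))\<^sup>2) = (\<Sum>k\<in>f ` {..<n}. (norm (four_coeff g k))\<^sup>2)"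
      using assms(2) by (subst sum.reindex) (auto simp: inj_on_def)
    thus "(\<Sum>k<n. (norm (four_coeff g (f k)))\<^sup>2) \<le> integral {- 1 / 2..1 / 2} (\<lambda>x. (norm (g x))\<^sup>2)"
      using bessel[OF _ assms(1)] by simp
  qed auto
  hence "(\<lambda>n. sqrt ((norm (four_coeff g (f n)))\<^sup>2)) \<longlonglongrightarrow> sqrt 0"
    by (intro tendsto_real_sqrt summable_LIMSEQ_zero)
  thus ?thesis by (simp add: tendsto_norm_zero_iff)
qed

text \<open>Chernoff's argument: dividing \<open>u - u(0)\<close> by \<open>e\<^sup>2\<^sup>\<pi>\<^sup>i\<^sup>x - 1\<close> makes
  the Fourier coefficients of \<open>u\<close> telescope.\<close>
lemma fourier_series_at_0:
  fixes u :: "real \<Rightarrow> complex"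
  assumes U: "U holomorphic_on UNIV" and u_def: "u = (\<lambda>x. U (of_real x))"
  shows "(\<lambda>N. \<Sum>k=-int N..int N. four_coeff u k) \<longlonglongrightarrow> u 0"
proof -
  define u' where "u' = deriv U 0"
  have U': "(U has_field_derivative u') (at 0)"
    unfolding u'_def using U by (simp add: holomorphic_derivI)
  \<comment> \<open>The value at 0 is the limit of the quotient, which makes \<open>g\<close>
    continuous, so that its Fourier coefficients tend to 0.\<close>
  define g where "g = (\<lambda>x. if x = 0 then u' / (2 * of_real pi * \<i>) else (u x - u 0) / (cis (2 * pi * x) - 1))"
  have ne: "cis (2 * pi * x) \<noteq> 1" if "x \<in> {- 1 / 2..1 / 2}" "x \<noteq> 0" for x
  proof
    assume "cis (2 * pi * x) = 1"
    then obtain n :: int where "2 * pi * x = 2 * pi * of_int n"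
      by (auto simp: cis_conv_exp exp_eq_1 mult_ac)
    hence "x = of_int n" by simp
    thus False using that by auto
  qed
  have "isCont g 0"
  proof -
    have "((\<lambda>z. (U z - U 0) / z) \<longlongrightarrow> u') (at 0)"
      using U' by (simp add: has_field_derivative_iff)
    moreover have "((\<lambda>z. exp (2 * of_real pi * \<i> * z)) has_field_derivative 2 * of_real pi * \<i>) (at 0)"
      by (auto intro!: derivative_eq_intros)
    hence "((\<lambda>z. (exp (2 * of_real pi * \<i> * z) - 1) / z) \<longlongrightarrow> 2 * of_real pi * \<i>) (at 0)"
      by (simp add: has_field_derivative_iff)
    ultimately have "((\<lambda>z. ((U z - U 0) / z) / ((exp (2 * of_real pi * \<i> * z) - 1) / z)) \<longlongrightarrow>
        u' / (2 * of_real pi * \<i>)) (at 0)"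
      by (intro tendsto_divide) auto
    moreover have "filterlim complex_of_real (at 0) (at 0)"
      by (auto simp: filterlim_at eventually_at_filter intro!: tendsto_eq_intros)
    ultimately have "((\<lambda>x. ((U (of_real x) - U 0) / of_real x) /
        ((exp (2 * of_real pi * \<i> * of_real x) - 1) / of_real x)) \<longlongrightarrow>
        u' / (2 * of_real pi * \<i>)) (at 0)"
      by (rule filterlim_compose)
    moreover have "\<forall>\<^sub>F x in at 0. ((U (of_real x) - U 0) / of_real x) /
        ((exp (2 * of_real pi * \<i> * of_real x) - 1) / of_real x) = g x"
      by (auto simp: eventually_at_filter g_def u_def cis_conv_exp mult_ac intro!: always_eventually)
    ultimately have "(g \<longlongrightarrow> u' / (2 * of_real pi * \<i>)) (at 0)"
      by (simp add: tendsto_cong)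
    thus ?thesis by (simp add: isCont_def g_def)
  qed
  have u: "continuous_on A u" for A
    unfolding u_def
    by (rule continuous_on_compose2[OF holomorphic_on_imp_continuous_on[OF U]])
       (auto intro!: continuous_intros)
  have g: "continuous_on {- 1 / 2..1 / 2} g"
  proof (rule continuous_at_imp_continuous_on, rule ballI)
    fix x :: real assume x: "x \<in> {- 1 / 2..1 / 2}"
    show "isCont g x"
    proof (cases "x = 0")
      case False
      have "isCont u x" using u[of UNIV] by (simp add: continuous_on_eq_continuous_at)
      moreover have "isCont (\<lambda>x. cis (2 * pi * x)) x"
        unfolding cis_conv_exp by (intro continuous_intros)
      ultimately have "isCont (\<lambda>x. (u x - u 0) / (cis (2 * pi * x) - 1)) x"
        using ne[OF x False] by (intro continuous_intros) auto
      moreover have "\<forall>\<^sub>F y in nhds x. y \<noteq> 0"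
        using False by (intro t1_space_nhds) auto
      hence "\<forall>\<^sub>F y in nhds x. g y = (u y - u 0) / (cis (2 * pi * y) - 1)"
        by eventually_elim (simp add: g_def)
      ultimately show ?thesis by (simp add: isCont_cong)
    qed (use \<open>isCont g 0\<close> in simp)
  qed
  have coeff: "four_coeff u k = four_coeff g (k - 1) - four_coeff g k + (if k = 0 then u 0 else 0)" for k
  proof -
    have "four_coeff u k = integral {- 1 / 2..1 / 2} (\<lambda>x. g x * cis (- 2 * pi * of_int (k - 1) * x) -
        g x * cis (- 2 * pi * of_int k * x) + u 0 * cis (2 * pi * of_int (- k) * x))"
      unfolding four_coeff_def
    proof (rule integral_cong)
      fix x :: real assume x: "x \<in> {- 1 / 2..1 / 2}"
      have eq1: "u x = u 0 + g x * (cis (2 * pi * x) - 1)"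
        using ne[OF x] by (auto simp: g_def)
      have eq2: "cis (- 2 * pi * of_int (k - 1) * x) = cis (2 * pi * x) * cis (- 2 * pi * of_int k * x)"
        by (simp add: cis_mult algebra_simps)
      show "u x * cis (- 2 * pi * of_int k * x) = g x * cis (- 2 * pi * of_int (k - 1) * x) -
        g x * cis (- 2 * pi * of_int k * x) + u 0 * cis (2 * pi * of_int (- k) * x)"
        unfolding eq2 unfolding eq1 by (simp add: ring_distribs)
    qed
    also have "\<dots> = four_coeff g (k - 1) - four_coeff g k + u 0 * integral {- 1 / 2..1 / 2} (\<lambda>x. cis (2 * pi * of_int (- k) * x))"
      unfolding four_coeff_def
      by (intro integral_unique has_integral_add has_integral_diff has_integral_mult_right
            integrable_integral integrable_continuous_interval continuous_intros g)
    finally show ?thesis unfolding integral_cis by simp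
  qed
  have "(\<Sum>k=-int N..int N. four_coeff u k) = four_coeff g (- int N - 1) - four_coeff g (int N) + u 0" for N
  proof (induction N)
    case (Suc N)
    have "{- int (Suc N)..int (Suc N)} = insert (- int (Suc N)) (insert (int (Suc N)) {- int N..int N})"
      by auto
    hence c0: "(\<Sum>k=-int (Suc N)..int (Suc N). four_coeff u k) =
        four_coeff u (- int (Suc N)) + (four_coeff u (int (Suc N)) + (\<Sum>k=-int N..int N. four_coeff u k))"
      by simp
    have c1: "four_coeff u (- int (Suc N)) = four_coeff g (- int (Suc N) - 1) - four_coeff g (- int (Suc N))"
      unfolding coeff by simp
    have e: "- int (Suc N) = - int N - 1" by simp
    have c2: "four_coeff u (int (Suc N)) = four_coeff g (int N) - four_coeff g (int (Suc N))"
      unfolding coeff by simp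
    show ?case unfolding c0 c1 c2 Suc.IH unfolding e by simp
  qed (simp add: coeff)
  moreover have "(\<lambda>N. four_coeff g (- int N - 1) - four_coeff g (int N) + u 0) \<longlonglongrightarrow> 0 - 0 + u 0"
    by (intro tendsto_intros four_coeff_tendsto_0 g) (auto simp: inj_on_def)
  ultimately show ?thesis by simp
qed

section \<open>The Fourier transform of the Gaussian and unfolding\<close>

lemma gaussian_fourier_transform:
  fixes t s :: real
  assumes "t > 0"
  shows "integrable lborel (\<lambda>x. of_real (exp (- pi * t * x\<^sup>2)) * cis (2 * pi * s * x))" (is ?int)
    and "(LINT x|lborel. of_real (exp (- pi * t * x\<^sup>2)) * cis (2 * pi * s * x)) =
           of_real (exp (- pi * s\<^sup>2 / t) / sqrt t)" (is ?eq)
proof -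
  \<comment> \<open>Scaling by \<open>c\<close> turns the Gaussian into the standard normal density,
    up to a constant factor, and the integral into its characteristic function at
    \<open>r\<close>.\<close>
  define c where "c = sqrt (2 * pi * t)"
  have c: "c > 0" "c\<^sup>2 = 2 * pi * t" using assms by (simp_all add: c_def)
  define r where "r = 2 * pi * s / c"
  define f where "f = (\<lambda>x. of_real (std_normal_density x) * cis (r * x))"
  have dens: "std_normal_density (0 + c * x) = exp (- pi * t * x\<^sup>2) / sqrt (2 * pi)" for x
    using c by (simp add: std_normal_density_def power_mult_distrib)
  have f: "integrable lborel f"
  proof (rule Bochner_Integration.integrable_bound)
    show "integrable lborel std_normal_density" by simp
    show "f \<in> borel_measurable lborel"
      unfolding f_def cis_conv_exp by measurable
    show "AE x in lborel. norm (f x) \<le> norm (std_normal_density x)"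
      by (simp add: f_def norm_mult)
  qed
  have fc: "f (0 + c * x) = of_real (1 / sqrt (2 * pi)) * (of_real (exp (- pi * t * x\<^sup>2)) * cis (2 * pi * s * x))" for x
    unfolding f_def dens using c(1) by (simp add: r_def mult.assoc)
  have "integrable lborel (\<lambda>x. f (0 + c * x))"
    using f c by (intro lborel_integrable_real_affine) auto
  hence "integrable lborel (\<lambda>x. of_real (sqrt (2 * pi)) * f (0 + c * x))"
    by (rule integrable_mult_right)
  thus ?int unfolding fc by simp
  have "of_real (exp (- (r\<^sup>2) / 2)) = (LINT x|lborel. f x)"
  proof -
    have "of_real (exp (- (r\<^sup>2) / 2)) = char std_normal_distribution r"
      by (simp add: char_std_normal_distribution)
    also have "\<dots> = (LINT x|lborel. f x)"
      unfolding char_def f_def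
      by (subst integral_density) (auto simp: cis_conv_exp scaleR_conv_of_real mult_ac)
    finally show ?thesis .
  qed
  also have "\<dots> = \<bar>c\<bar> *\<^sub>R (LINT x|lborel. f (0 + c * x))"
    using c by (intro lborel_integral_real_affine) auto
  also have "\<dots> = of_real (c / sqrt (2 * pi)) * (LINT x|lborel. of_real (exp (- pi * t * x\<^sup>2)) * cis (2 * pi * s * x))"
    unfolding fc using c by (simp add: scaleR_conv_of_real)
  also have "c / sqrt (2 * pi) = sqrt t"
    by (simp add: c_def real_sqrt_mult)
  also have "- (r\<^sup>2) / 2 = - pi * s\<^sup>2 / t"
    using c assms by (simp add: r_def power_divide power_mult_distrib power2_eq_square field_simps)
  finally show ?eq using assms by (simp add: field_simps)
qed

text \<open>Dominated convergence. The half-integral radii are those of 2 N + 1 consecutive unit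
  intervals, the middle one centred at y.\<close>

lemma integral_symmetric_tendsto:
  fixes f :: "real \<Rightarrow> complex"
  assumes f: "integrable lborel f" "continuous_on UNIV f"
  shows "(\<lambda>N. integral {y - (real N + 1 / 2)..y + (real N + 1 / 2)} f) \<longlonglongrightarrow> (LINT x|lborel. f x)"
proof -
  have "(\<lambda>N. LINT x|lborel. indicator {y - (real N + 1 / 2)..y + (real N + 1 / 2)} x *\<^sub>R f x) \<longlonglongrightarrow> (LINT x|lborel. f x)"
  proof (rule integral_dominated_convergence[where w = "\<lambda>x. norm (f x)"])
    show "AE x in lborel. (\<lambda>N. indicator {y - (real N + 1 / 2)..y + (real N + 1 / 2)} x *\<^sub>R f x) \<longlonglongrightarrow> f x"
    proof (rule AE_I2)
      fix x :: real
      obtain N0 :: nat where "\<bar>x - y\<bar> \<le> real N0" using real_arch_simple by blast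
      hence "indicator {y - (real N + 1 / 2)..y + (real N + 1 / 2)} x *\<^sub>R f x = f x" if "N \<ge> N0" for N
        using that by (auto simp: indicator_def abs_le_iff)
      thus "(\<lambda>N. indicator {y - (real N + 1 / 2)..y + (real N + 1 / 2)} x *\<^sub>R f x) \<longlonglongrightarrow> f x"
        by (intro tendsto_eventually eventually_sequentiallyI)
    qed
  qed (use f in \<open>auto simp: indicator_def\<close>)
  moreover have "(LINT x|lborel. indicator {y - (real N + 1 / 2)..y + (real N + 1 / 2)} x *\<^sub>R f x) =
      integral {y - (real N + 1 / 2)..y + (real N + 1 / 2)} f" for N
    using set_borel_integral_eq_integral(2)[of "{y - (real N + 1 / 2)..y + (real N + 1 / 2)}" f]
      set_integrable_subset[of lborel UNIV f "{y - (real N + 1 / 2)..y + (real N + 1 / 2)}"] f(1)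
    by (simp add: set_lebesgue_integral_def set_integrable_def)
  ultimately show ?thesis by simp
qed

lemma filterlim_symmetric_int_intervals:
  "filterlim (\<lambda>N. {- int N..int N}) (finite_subsets_at_top UNIV) sequentially"
  unfolding filterlim_finite_subsets_at_top
proof (intro allI impI)
  fix X :: "int set" assume X: "finite X \<and> X \<subseteq> UNIV"
  define M where "M = nat (\<Sum>x\<in>X. \<bar>x\<bar>)"
  have "\<bar>x\<bar> \<le> int M" if "x \<in> X" for x
    using X that member_le_sum[of x X "\<lambda>x. \<bar>x\<bar>"] by (simp add: M_def)
  hence "X \<subseteq> {- int N..int N}" if "N \<ge> M" for N
    using that by (force simp: abs_le_iff)
  thus "\<forall>\<^sub>F N in sequentially. finite {- int N..int N} \<and> X \<subseteq> {- int N..int N} \<and> {- int N..int N} \<subseteq> UNIV"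
    by (auto intro!: eventually_sequentiallyI)
qed

lemma has_sum_int_imp_tendsto:
  assumes "(f has_sum S) (UNIV :: int set)"
  shows "(\<lambda>N. \<Sum>k=-int N..int N. f k) \<longlonglongrightarrow> S"
  using assms filterlim_compose[OF _ filterlim_symmetric_int_intervals]
  unfolding has_sum_def by blast

text \<open>Unfolding: the character has period 1, so integrating the n-th term over the unit
  interval integrates a fixed function over the translate by \<open>n + y\<close>. Uniform
  convergence allows termwise integration, and the symmetric partial sums exhaust the real
  line.\<close>

lemma four_coeff_gauss_sum:
  assumes t: "t > 0"
  shows "four_coeff (\<lambda>x. gauss_sum t (of_real (y + x))) k =
           of_real (1 / sqrt t) * (of_real (exp (- pi * (of_int k)\<^sup>2 / t)) * cis (2 * pi * of_int k * y))"
proof -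
  define I where "I = {- 1 / 2..1 / 2 :: real}"
  define f where "f = (\<lambda>w. of_real (exp (- pi * t * w\<^sup>2)) * cis (2 * pi * (- of_int k) * w))"
  define E where "E = (\<lambda>x. cis (- 2 * pi * of_int k * x))"
  define A where "A = (\<lambda>n x. exp (- of_real (pi * t) * (of_int n + of_real (y + x))\<^sup>2) * E x)"
  define C where "C = cis (2 * pi * of_int k * y)"
  have f_cont: "continuous_on S f" for S
    unfolding f_def by (intro continuous_intros)
  have A_eq: "A n x = C * f (x + (of_int n + y))" for n x
  proof -
    have "exp (- of_real (pi * t) * (of_int n + of_real (y + x))\<^sup>2) =
          complex_of_real (exp (- pi * t * (x + (of_int n + y))\<^sup>2))"
      by (simp add: exp_of_real[symmetric] algebra_simps)
    moreover have "C * cis (2 * pi * (- of_int k) * (x + (of_int n + y))) = E x"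
    proof -
      have "C * cis (2 * pi * (- of_int k) * (x + (of_int n + y))) = E x * cis (2 * pi * of_int (- k * n))"
        unfolding C_def E_def by (simp add: cis_mult algebra_simps)
      also have "cis (2 * pi * of_int (- k * n)) = 1"
        using cis_multiple_2pi[of "of_int (- k * n)"] by simp
      finally show ?thesis by simp
    qed
    ultimately show ?thesis by (simp add: A_def f_def)
  qed
  have lim: "uniform_limit I (\<lambda>X x. \<Sum>n\<in>X. A n x) (\<lambda>x. gauss_sum t (of_real (y + x)) * E x) (finite_subsets_at_top UNIV)"
  proof -
    have "uniform_limit I (\<lambda>X x. \<Sum>n\<in>X. exp (- of_real (pi * t) * (of_int n + of_real (y + x))\<^sup>2))
        (\<lambda>x. gauss_sum t (of_real (y + x))) (finite_subsets_at_top UNIV)"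
    proof (rule uniform_limit_compose'[OF gauss_sum_uniform_limit[OF t, of "\<bar>y\<bar> + 1 / 2"]])
      show "(\<lambda>x. complex_of_real (y + x)) \<in> I \<rightarrow> cball 0 (\<bar>y\<bar> + 1 / 2)"
        by (auto simp: I_def simp del: of_real_add)
    qed
    hence "uniform_limit I (\<lambda>X x. (\<Sum>n\<in>X. exp (- of_real (pi * t) * (of_int n + of_real (y + x))\<^sup>2)) * E x)
        (\<lambda>x. gauss_sum t (of_real (y + x)) * E x) (finite_subsets_at_top UNIV)"
      by (auto intro!: uniform_limitI simp: uniform_limit_iff dist_norm left_diff_distrib[symmetric] norm_mult E_def)
    thus ?thesis by (simp add: A_def sum_distrib_right)
  qed
  have A_cont: "continuous_on I (A n)" for n
    unfolding A_def E_def by (intro continuous_intros)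
  have "continuous_on {- 1 / 2..1 / 2} (\<lambda>x. \<Sum>n\<in>X. A n x)" for X
    using A_cont unfolding I_def by (intro continuous_on_sum)
  from uniform_limit_integral[OF lim[unfolded I_def] this finite_subsets_at_top_neq_bot]
  obtain J J' where J: "\<And>X. ((\<lambda>x. \<Sum>n\<in>X. A n x) has_integral J X) I"
    and J': "((\<lambda>x. gauss_sum t (of_real (y + x)) * E x) has_integral J') I"
    and "(J \<longlongrightarrow> J') (finite_subsets_at_top UNIV)"
    unfolding I_def by blast
  moreover have "J' = four_coeff (\<lambda>x. gauss_sum t (of_real (y + x))) k"
    using integral_unique[OF J'] by (simp add: four_coeff_def E_def I_def)
  ultimately have Jlim: "(J \<longlongrightarrow> four_coeff (\<lambda>x. gauss_sum t (of_real (y + x))) k) (finite_subsets_at_top UNIV)"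
    by simp
  have JN: "J {- int N..int N} = C * integral {y - (real N + 1 / 2)..y + (real N + 1 / 2)} f" for N
  proof -
    have int: "(A n has_integral C * integral {of_int n + y - 1 / 2..of_int n + y + 1 / 2} f) I" for n
    proof -
      have "(f has_integral integral {of_int n + y - 1 / 2..of_int n + y + 1 / 2} f) {of_int n + y - 1 / 2..of_int n + y + 1 / 2}"
        by (intro integrable_integral integrable_continuous_interval f_cont)
      from has_integral_affinity'[OF this[unfolded cbox_interval[symmetric]], of 1 "of_int n + y"]
      have "((\<lambda>x. f (x + (of_int n + y))) has_integral integral {of_int n + y - 1 / 2..of_int n + y + 1 / 2} f) I"
        by (simp add: I_def)
      thus ?thesis unfolding A_eq by (rule has_integral_mult_right)
    qed
    have "J {- int N..int N} = (\<Sum>n=-int N..int N. C * integral {of_int n + y - 1 / 2..of_int n + y + 1 / 2} f)"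
      by (intro has_integral_unique[OF J] has_integral_sum int) auto
    also have "\<dots> = C * (\<Sum>n=-int N..int N. integral {of_int n + y - 1 / 2..of_int n + y + 1 / 2} f)"
      by (simp add: sum_distrib_left)
    also have "(\<Sum>n=-int N..int N. integral {of_int n + y - 1 / 2..of_int n + y + 1 / 2} f) =
        integral {y - (real N + 1 / 2)..y + (real N + 1 / 2)} f"
    proof (induction N)
      case (Suc N)
      have comb: "integral {a..b} f + integral {b..c} f = integral {a..c} f" if "a \<le> b" "b \<le> c" for a b c
        using that by (intro Henstock_Kurzweil_Integration.integral_combine integrable_continuous_interval f_cont)
      have "{- int (Suc N)..int (Suc N)} = insert (- int (Suc N)) (insert (int (Suc N)) {- int N..int N})"
        by auto
      hence "(\<Sum>n=-int (Suc N)..int (Suc N). integral {of_int n + y - 1 / 2..of_int n + y + 1 / 2} f) =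
          integral {y - (real (Suc N) + 1 / 2)..y - (real N + 1 / 2)} f +
          (integral {y - (real N + 1 / 2)..y + (real N + 1 / 2)} f +
          integral {y + (real N + 1 / 2)..y + (real (Suc N) + 1 / 2)} f)"
        using Suc by (simp add: algebra_simps)
      also have "\<dots> = integral {y - (real (Suc N) + 1 / 2)..y + (real (Suc N) + 1 / 2)} f"
        by (subst comb, simp, simp)+ (rule refl)
      finally show ?case .
    qed (simp add: algebra_simps)
    finally show ?thesis .
  qed
  have "f = (\<lambda>x. of_real (exp (- pi * t * x\<^sup>2)) * cis (2 * pi * (- of_int k) * x))"
    by (simp add: f_def)
  note ft = gaussian_fourier_transform[OF t, of "- of_int k", folded this]
  have "(\<lambda>N. J {- int N..int N}) \<longlonglongrightarrow> C * (LINT x|lborel. f x)"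
    unfolding JN by (intro tendsto_mult tendsto_const integral_symmetric_tendsto f_cont ft)
  moreover have "(\<lambda>N. J {- int N..int N}) \<longlonglongrightarrow> four_coeff (\<lambda>x. gauss_sum t (of_real (y + x))) k"
    by (rule filterlim_compose[OF Jlim filterlim_symmetric_int_intervals])
  ultimately have "four_coeff (\<lambda>x. gauss_sum t (of_real (y + x))) k = C * (LINT x|lborel. f x)"
    by (rule LIMSEQ_unique[rotated])
  thus ?thesis unfolding ft(2) C_def by simp
qed

text \<open>This is the Fourier series of \<open>gauss_sum t (y + x)\<close> at x = 0. It converges
  along symmetric partial sums; absolute summability of its terms identifies this limit with the
  unordered sum.\<close>

theorem poisson_summation_gaussian:
  assumes t: "t > 0"
  shows "(\<Sum>\<^sub>\<infinity>n::int. complex_of_real (exp (- pi * t * (of_int n + y)\<^sup>2))) =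
         of_real (1 / sqrt t) * (\<Sum>\<^sub>\<infinity>k::int. of_real (exp (- pi * (of_int k)\<^sup>2 / t)) * cis (2 * pi * of_int k * y))"
proof -
  define U where "U = (\<lambda>z. gauss_sum t (of_real y + z))"
  define a where "a = (\<lambda>k::int. of_real (exp (- pi * (of_int k)\<^sup>2 / t)) * cis (2 * pi * of_int k * y))"
  have "(gauss_sum t \<circ> (\<lambda>z. of_real y + z)) holomorphic_on UNIV"
    by (rule holomorphic_on_compose_gen[OF _ gauss_sum_holomorphic[OF t]]) (auto intro!: holomorphic_intros)
  hence "U holomorphic_on UNIV" by (simp add: U_def o_def)
  hence "(\<lambda>N. \<Sum>k=-int N..int N. four_coeff (\<lambda>x. U (of_real x)) k) \<longlonglongrightarrow> U (of_real 0)"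
    by (rule fourier_series_at_0) (rule refl)
  hence "(\<lambda>N. \<Sum>k=-int N..int N. of_real (1 / sqrt t) * a k) \<longlonglongrightarrow> gauss_sum t (of_real y)"
    using four_coeff_gauss_sum[OF t, of y] by (simp add: U_def a_def)
  moreover have "(\<lambda>k. norm (a k)) summable_on UNIV"
    using summable_gaussian_int[of "pi / t" 0] t by (simp add: a_def norm_mult)
  hence "((\<lambda>k. of_real (1 / sqrt t) * a k) has_sum of_real (1 / sqrt t) * infsum a UNIV) UNIV"
    by (intro has_sum_cmult_right has_sum_infsum) (rule abs_summable_summable)
  ultimately have "gauss_sum t (of_real y) = of_real (1 / sqrt t) * infsum a UNIV"
    using has_sum_int_imp_tendsto LIMSEQ_unique by blast
  moreover have "gauss_sum t (of_real y) = (\<Sum>\<^sub>\<infinity>n::int. complex_of_real (exp (- pi * t * (of_int n + y)\<^sup>2)))"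
    unfolding gauss_sum_def
    by (intro infsum_cong) (simp add: exp_of_real[symmetric] algebra_simps)
  ultimately show ?thesis by (simp add: a_def)
qed

subsection \<open>Poisson summation for self-dual lattices\<close>

text \<open>A finite set of functions is contained in the product of its coordinate projections,
  over which the sum of the products factors.\<close>

lemma summable_on_prod_fun:
  fixes f :: "'n::finite \<Rightarrow> 'b \<Rightarrow> real"
  assumes f: "\<And>i. f i summable_on UNIV" and nonneg: "\<And>i x. f i x \<ge> 0"
  shows "(\<lambda>g. \<Prod>i\<in>UNIV. f i (g i)) summable_on UNIV"
proof (rule nonneg_bdd_above_summable_on)
  show "bdd_above (sum (\<lambda>g. \<Prod>i\<in>UNIV. f i (g i)) ` {F. F \<subseteq> UNIV \<and> finite F})"
  proof (rule bdd_aboveI2)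
    fix F :: "('n \<Rightarrow> 'b) set" assume "F \<in> {F. F \<subseteq> UNIV \<and> finite F}"
    hence F: "finite F" by simp
    define A where "A = (\<lambda>i. (\<lambda>g. g i) ` F)"
    have "(\<Sum>g\<in>F. \<Prod>i\<in>UNIV. f i (g i)) \<le> (\<Sum>g\<in>Pi\<^sub>E UNIV A. \<Prod>i\<in>UNIV. f i (g i))"
      using F by (intro sum_mono2) (auto simp: A_def intro!: finite_PiE prod_nonneg nonneg)
    also have "\<dots> = (\<Prod>i\<in>UNIV. \<Sum>x\<in>A i. f i x)"
      using F by (subst prod_sum_PiE) (auto simp: A_def)
    also have "\<dots> \<le> (\<Prod>i\<in>UNIV. infsum (f i) UNIV)"
      using F by (intro prod_mono conjI sum_nonneg nonneg finite_sum_le_infsum f) (auto simp: A_def nonneg)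
    finally show "(\<Sum>g\<in>F. \<Prod>i\<in>UNIV. f i (g i)) \<le> (\<Prod>i\<in>UNIV. infsum (f i) UNIV)" .
  qed
qed (auto intro!: prod_nonneg nonneg)

lemma infsum_prod_fun:
  fixes f :: "'n::finite \<Rightarrow> 'b \<Rightarrow> complex"
  assumes "\<And>i. (\<lambda>x. norm (f i x)) summable_on UNIV"
  shows "(\<Sum>\<^sub>\<infinity>g. \<Prod>i\<in>UNIV. f i (g i)) = (\<Prod>i\<in>UNIV. infsum (f i) UNIV)"
  using infsum_prod_PiE_abs[of UNIV f "\<lambda>_. UNIV"] assms by (simp add: PiE_UNIV_domain)

lemma has_sum_finite_sum:
  fixes f :: "'a \<Rightarrow> 'b \<Rightarrow> 'c :: {topological_comm_monoid_add}"
  assumes "\<And>i. i \<in> I \<Longrightarrow> (f i has_sum s i) A"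
  shows "((\<lambda>x. \<Sum>i\<in>I. f i x) has_sum (\<Sum>i\<in>I. s i)) A"
  using assms by (induction I rule: infinite_finite_induct) (auto intro!: has_sum_add)

lemma infsum_complex_of_real:
  assumes "f summable_on A"
  shows "(\<Sum>\<^sub>\<infinity>x\<in>A. complex_of_real (f x)) = of_real (infsum f A)"
  using has_sum_of_real[OF has_sum_infsum[OF assms]] by (rule infsumI)

lemma cis_int: "a \<in> \<int> \<Longrightarrow> cis (2 * pi * a) = 1"
  using cis_multiple_2pi[of a] by simp

text \<open>Self-duality alone gives the group structure (a dual is closed under integral
  combinations), full rank and, through an orthogonal frame, discreteness.\<close>

locale selfdual_lattice =
  fixes L :: "(real^'n) set"
  assumes selfdual: "L = dual_lattice L"
begin

lemma inner_in_Ints: "x \<in> L \<Longrightarrow> y \<in> L \<Longrightarrow> x \<bullet> y \<in> \<int>"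
  using selfdual unfolding dual_lattice_def by auto

lemma memI: "(\<And>y. y \<in> L \<Longrightarrow> y \<bullet> x \<in> \<int>) \<Longrightarrow> x \<in> L"
  using selfdual unfolding dual_lattice_def by auto

lemma zero_mem: "0 \<in> L"
  by (rule memI) auto

lemma add_mem: "x \<in> L \<Longrightarrow> y \<in> L \<Longrightarrow> x + y \<in> L"
  by (rule memI) (auto simp: inner_add_right intro!: Ints_add inner_in_Ints)

lemma scale_mem: "x \<in> L \<Longrightarrow> a \<in> \<int> \<Longrightarrow> a *\<^sub>R x \<in> L"
  by (rule memI) (auto intro!: Ints_mult inner_in_Ints)

lemma uminus_mem: "x \<in> L \<Longrightarrow> - x \<in> L"
  using scale_mem[of x "-1"] by simp

lemma diff_mem: "x \<in> L \<Longrightarrow> y \<in> L \<Longrightarrow> x - y \<in> L"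
  using add_mem[of x "- y"] uminus_mem[of y] by simp

lemma sum_mem: "(\<And>i. i \<in> A \<Longrightarrow> f i \<in> L) \<Longrightarrow> (\<Sum>i\<in>A. f i) \<in> L"
  by (induction A rule: infinite_finite_induct) (auto intro: zero_mem add_mem)

text \<open>A vector orthogonal to all of L pairs integrally with L, hence lies in L by self-duality
  and is orthogonal to itself.\<close>

lemma not_subset_proper_subspace:
  assumes "span B \<noteq> UNIV"
  obtains x where "x \<in> L" "x \<notin> span B"
proof -
  have "span B \<subset> span UNIV" using assms by (simp add: psubset_eq)
  then obtain y where y: "y \<noteq> 0" "\<And>x. x \<in> span B \<Longrightarrow> orthogonal y x"
    using orthogonal_to_subspace_exists_gen by metis
  show ?thesis
  proof (rule ccontr)
    assume "\<not> thesis"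
    hence "x \<in> span B" if "x \<in> L" for x using that \<open>\<not> thesis\<close> \<open>\<And>x. x \<in> L \<Longrightarrow> x \<notin> span B \<Longrightarrow> thesis\<close> by blast
    hence orth: "x \<bullet> y = 0" if "x \<in> L" for x
      using y(2) that by (auto simp: orthogonal_def inner_commute)
    hence "y \<in> L" by (intro memI) auto
    from orth[OF this] y(1) show False by simp
  qed
qed

text \<open>Gram--Schmidt, with denominators cleared by the integrality of the inner products.\<close>
lemma orthogonal_set_exists:
  assumes "n \<le> CARD('n)"
  shows "\<exists>B. finite B \<and> card B = n \<and> B \<subseteq> L \<and> 0 \<notin> B \<and> pairwise orthogonal B"
  using assms
proof (induction n)
  case 0
  show ?case by (intro exI[of _ "{}"]) auto
next
  case (Suc n)
  then obtain B where B: "finite B" "card B = n" "B \<subseteq> L" "0 \<notin> B" "pairwise orthogonal B"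
    by auto
  have "dim (span B) \<le> n" using B dim_le_card' by fastforce
  hence "span B \<noteq> UNIV" using Suc.prems by (metis dim_UNIV DIM_cart DIM_real mult_1_right not_less_eq_eq order_trans)
  then obtain x where x: "x \<in> L" "x \<notin> span B" by (rule not_subset_proper_subspace)
  define N where "N = (\<Prod>b\<in>B. b \<bullet> b)"
  have N: "N \<noteq> 0" using B by (auto simp: N_def)
  define w where "w = N *\<^sub>R x - (\<Sum>b\<in>B. ((x \<bullet> b) * (\<Prod>b'\<in>B-{b}. b' \<bullet> b')) *\<^sub>R b)"
  have "w \<in> L"
    unfolding w_def N_def using B(3)
    by (intro diff_mem sum_mem scale_mem x Ints_mult Ints_prod inner_in_Ints) auto
  moreover have "orthogonal w b" if b: "b \<in> B" for b
  proof -
    have "(\<Sum>b'\<in>B. ((x \<bullet> b') * (\<Prod>b''\<in>B-{b'}. b'' \<bullet> b'')) *\<^sub>R b') \<bullet> b =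
          (\<Sum>b'\<in>B. if b' = b then (x \<bullet> b) * N else 0)"
      unfolding inner_sum_left
    proof (rule sum.cong)
      fix b' assume b': "b' \<in> B"
      show "((x \<bullet> b') * (\<Prod>b''\<in>B-{b'}. b'' \<bullet> b'')) *\<^sub>R b' \<bullet> b = (if b' = b then (x \<bullet> b) * N else 0)"
      proof (cases "b' = b")
        case True
        have "N = (b \<bullet> b) * (\<Prod>b''\<in>B-{b}. b'' \<bullet> b'')"
          unfolding N_def using B(1) b by (rule prod.remove)
        thus ?thesis using True by simp
      next
        case False
        hence "b' \<bullet> b = 0" using B(5) b b' by (auto simp: pairwise_def orthogonal_def)
        thus ?thesis using False by simp
      qed
    qed simp
    also have "\<dots> = (x \<bullet> b) * N" using B(1) b by simp
    finally show ?thesis by (simp add: w_def orthogonal_def inner_diff_left)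
  qed
  moreover have "w \<noteq> 0"
  proof
    assume "w = 0"
    hence eq: "N *\<^sub>R x = (\<Sum>b\<in>B. ((x \<bullet> b) * (\<Prod>b'\<in>B-{b}. b' \<bullet> b')) *\<^sub>R b)"
      by (simp add: w_def)
    have "x = (1 / N) *\<^sub>R (N *\<^sub>R x)" using N by simp
    also have "\<dots> = (1 / N) *\<^sub>R (\<Sum>b\<in>B. ((x \<bullet> b) * (\<Prod>b'\<in>B-{b}. b' \<bullet> b')) *\<^sub>R b)"
      by (simp only: eq)
    also have "\<dots> \<in> span B" by (intro span_scale span_sum span_base)
    finally show False using x by simp
  qed
  moreover from calculation have "w \<notin> B" by (metis orthogonal_self)
  ultimately show ?case
    using B by (intro exI[of _ "insert w B"])
      (auto simp: pairwise_insert orthogonal_commute)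
qed

lemma orthogonal_family_exists:
  obtains v :: "'n \<Rightarrow> real^'n" where
    "\<And>i. v i \<in> L" "\<And>i. v i \<noteq> 0" "\<And>i j. i \<noteq> j \<Longrightarrow> v i \<bullet> v j = 0"
proof -
  obtain B where B: "finite B" "card B = CARD('n)" "B \<subseteq> L" "0 \<notin> B" "pairwise orthogonal B"
    using orthogonal_set_exists[of "CARD('n)"] by auto
  then obtain v :: "'n \<Rightarrow> real^'n" where v: "bij_betw v UNIV B"
    using finite_same_card_bij[of "UNIV :: 'n set" B] by auto
  have vB: "v i \<in> B" for i using v by (auto simp: bij_betw_def)
  show ?thesis
  proof
    fix i j :: 'n
    show "v i \<in> L" "v i \<noteq> 0" using vB[of i] B by auto
    assume "i \<noteq> j"
    hence "v i \<noteq> v j" using v by (auto simp: bij_betw_def inj_def)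
    thus "v i \<bullet> v j = 0" using vB[of i] vB[of j] B(5) by (auto simp: pairwise_def orthogonal_def)
  qed
qed

end

section \<open>The sublattice spanned by an orthogonal frame, and its dual\<close>

locale selfdual_lattice_frame = selfdual_lattice +
  fixes v :: "'n \<Rightarrow> real^'n"
  assumes v_mem: "v i \<in> L" and v_nonzero: "v i \<noteq> 0" and v_orth: "i \<noteq> j \<Longrightarrow> v i \<bullet> v j = 0"
begin

definition N :: "'n \<Rightarrow> real" where "N i = v i \<bullet> v i"

definition coord :: "real^'n \<Rightarrow> 'n \<Rightarrow> real" where "coord x i = (x \<bullet> v i) / N i"

definition comb :: "('n \<Rightarrow> real) \<Rightarrow> real^'n" where "comb a = (\<Sum>i\<in>UNIV. a i *\<^sub>R v i)"

lemma N_pos: "N i > 0" using v_nonzero by (simp add: N_def)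

lemma comb_inner_v: "comb a \<bullet> v j = a j * N j"
proof -
  have "comb a \<bullet> v j = (\<Sum>i\<in>UNIV. if i = j then a j * N j else 0)"
    unfolding comb_def inner_sum_left by (intro sum.cong) (auto simp: v_orth N_def)
  thus ?thesis by simp
qed

lemma coord_comb: "coord (comb a) = a"
  using N_pos by (intro ext) (simp add: coord_def comb_inner_v less_imp_neq[symmetric])

lemma comb_coord: "comb (coord x) = x"
proof -
  define d where "d = x - comb (coord x)"
  have "d \<bullet> v j = 0" for j
    using N_pos[of j] by (simp add: d_def inner_diff_left comb_inner_v coord_def)
  moreover have "inj v"
    by (rule injI) (metis v_orth v_nonzero inner_eq_zero_iff)
  have "independent (range v)"
    by (rule pairwise_orthogonal_independent) (auto simp: pairwise_def orthogonal_def v_nonzero intro: v_orth)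
  hence "dim (range v) = CARD('n)"
    using \<open>inj v\<close> by (simp add: dim_eq_card_independent card_image)
  hence "span (range v) = UNIV"
    by (metis dim_eq_full dim_UNIV DIM_cart DIM_real mult_1_right card_cart_basis dimension_def)
  hence "d \<in> span (range v)" by simp
  ultimately have "d \<bullet> d = 0"
    using orthogonal_to_span[of d "range v" d] by (auto simp: orthogonal_def)
  thus ?thesis by (simp add: d_def)
qed

lemma inner_comb: "comb a \<bullet> comb b = (\<Sum>i\<in>UNIV. N i * (a i * b i))"
proof -
  have "comb a \<bullet> comb b = (\<Sum>i\<in>UNIV. b i * (comb a \<bullet> v i))"
    by (subst (2) comb_def) (simp add: inner_sum_right)
  thus ?thesis by (simp add: comb_inner_v mult_ac)
qed

lemma comb_add: "comb a + comb b = comb (\<lambda>i. a i + b i)"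
  by (simp add: comb_def sum.distrib scaleR_add_left)

lemma comb_int_mem: "comb (\<lambda>i. of_int (k i)) \<in> L"
  unfolding comb_def by (intro sum_mem scale_mem v_mem) auto

text \<open>The points of the lattice dual to the one spanned by \<open>v\<close>. It contains L,
  because lattice vectors have integral inner products with each \<open>v i\<close>, and so provides
  integral coordinates on L without a basis.\<close>

definition dual_comb :: "('n \<Rightarrow> int) \<Rightarrow> real^'n" where
  "dual_comb k = comb (\<lambda>i. of_int (k i) / N i)"

lemma inj_dual_comb: "inj dual_comb"
proof (rule injI)
  fix k l assume "dual_comb k = dual_comb l"
  hence "coord (dual_comb k) = coord (dual_comb l)" by simp
  hence "of_int (k i) / N i = of_int (l i) / N i" for i
    unfolding dual_comb_def coord_comb by metis
  thus "k = l" using N_pos by (intro ext) (metis divide_cancel_right less_irrefl of_int_eq_iff)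
qed

lemma lattice_subset_range_dual_comb: "L \<subseteq> range dual_comb"
proof
  fix x assume x: "x \<in> L"
  have "x \<bullet> v i \<in> \<int>" for i using x by (intro inner_in_Ints v_mem)
  hence "\<exists>k. x \<bullet> v i = of_int k" for i by (auto simp: Ints_def)
  then obtain k where "\<And>i. x \<bullet> v i = of_int (k i)" by metis
  hence "coord x = (\<lambda>i. of_int (k i) / N i)" by (auto simp: coord_def)
  hence "x = dual_comb k" unfolding dual_comb_def using comb_coord[of x] by simp
  thus "x \<in> range dual_comb" by simp
qed

lemma dual_comb_inner: "dual_comb k \<bullet> x = (\<Sum>i\<in>UNIV. of_int (k i) * coord x i)"
proof -
  have "dual_comb k \<bullet> comb (coord x) = (\<Sum>i\<in>UNIV. of_int (k i) * coord x i)"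
    unfolding dual_comb_def inner_comb using N_pos by (intro sum.cong) (auto simp: less_imp_neq[symmetric])
  thus ?thesis by (simp add: comb_coord)
qed

lemma norm_dual_comb: "dual_comb k \<bullet> dual_comb k = (\<Sum>i\<in>UNIV. (of_int (k i))\<^sup>2 / N i)"
  unfolding dual_comb_inner unfolding dual_comb_def coord_comb by (simp add: power2_eq_square)

lemma summable_gaussian_dual_comb:
  assumes "c > 0"
  shows "(\<lambda>k. exp (- c * (dual_comb k \<bullet> dual_comb k))) summable_on UNIV"
proof -
  have "(\<lambda>k. \<Prod>i\<in>UNIV. exp (0 * \<bar>real_of_int (k i)\<bar> - (c / N i) * (of_int (k i))\<^sup>2)) summable_on UNIV"
    using assms N_pos by (intro summable_on_prod_fun summable_gaussian_int) auto
  thus ?thesis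
    by (simp add: norm_dual_comb exp_sum[symmetric] sum_distrib_left sum_negf)
qed

lemma summable_gaussian:
  assumes "c > 0"
  shows "(\<lambda>x. exp (- c * (x \<bullet> x))) summable_on L"
proof -
  have "((\<lambda>x. exp (- c * (x \<bullet> x))) \<circ> dual_comb) summable_on UNIV"
    using summable_gaussian_dual_comb[OF assms] by (simp add: o_def)
  hence "(\<lambda>x. exp (- c * (x \<bullet> x))) summable_on range dual_comb"
    using summable_on_reindex[OF inj_dual_comb] by blast
  thus ?thesis using lattice_subset_range_dual_comb summable_on_subset_banach by blast
qed

text \<open>In the integral coordinates k the norm is the sum of the k_i^2 / N_i, and |k_i| <= k_i^2
  for integers.\<close>

lemma finite_bounded: "finite {x \<in> L. x \<bullet> x \<le> R}"
proof -
  define K where "K = Pi\<^sub>E UNIV (\<lambda>i. {- \<lfloor>R * N i\<rfloor>..\<lfloor>R * N i\<rfloor>})"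
  have "{x \<in> L. x \<bullet> x \<le> R} \<subseteq> dual_comb ` K"
  proof
    fix x assume "x \<in> {x \<in> L. x \<bullet> x \<le> R}"
    then obtain k where k: "x = dual_comb k" "x \<bullet> x \<le> R"
      using lattice_subset_range_dual_comb by auto
    have "\<bar>k i\<bar> \<le> \<lfloor>R * N i\<rfloor>" for i
    proof -
      have "(of_int (k i))\<^sup>2 / N i \<le> (\<Sum>i\<in>UNIV. (of_int (k i))\<^sup>2 / N i)"
        using N_pos by (intro member_le_sum) (auto simp: less_imp_le)
      also have "\<dots> \<le> R" using k norm_dual_comb by simp
      finally have "(of_int (k i))\<^sup>2 \<le> R * N i" using N_pos[of i] by (simp add: field_simps)
      moreover have "\<bar>k i\<bar> \<le> (k i)\<^sup>2"
        by (metis abs_ge_zero abs_mult_self_eq mult_le_cancel_left1 power2_eq_square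
            zero_less_one_class.zero_le_one abs_0_eq int_one_le_iff_zero_less less_le not_le mult_zero_left)
      hence "of_int \<bar>k i\<bar> \<le> (of_int (k i) :: real)\<^sup>2" by (metis of_int_le_iff of_int_power)
      ultimately show ?thesis by (simp only: le_floor_iff)
    qed
    hence "k i \<in> {- \<lfloor>R * N i\<rfloor>..\<lfloor>R * N i\<rfloor>}" for i by (simp add: abs_le_iff minus_le_iff)
    thus "x \<in> dual_comb ` K" using k by (auto simp: K_def PiE_UNIV_domain)
  qed
  moreover have "finite K" unfolding K_def by (intro finite_PiE) auto
  ultimately show ?thesis by (meson finite_imageI finite_subset)
qed

text \<open>Representatives of L modulo the sublattice spanned by \<open>v\<close>: the lattice
  points in the half-open fundamental box.\<close>

definition cells :: "(real^'n) set" where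
  "cells = {x \<in> L. \<forall>i. 0 \<le> coord x i \<and> coord x i < 1}"

definition rep :: "real^'n \<Rightarrow> real^'n" where
  "rep x = comb (\<lambda>i. frac (coord x i))"

lemma coord_add: "coord (x + y) i = coord x i + coord y i"
  by (simp add: coord_def inner_add_left add_divide_distrib)

lemma rep_plus_floor: "rep x + comb (\<lambda>i. of_int \<lfloor>coord x i\<rfloor>) = x"
  unfolding rep_def comb_add using comb_coord[of x] by (simp add: frac_def)

lemma rep_in_cells: "x \<in> L \<Longrightarrow> rep x \<in> cells"
  using diff_mem[OF _ comb_int_mem[of "\<lambda>i. \<lfloor>coord x i\<rfloor>"], of x] rep_plus_floor[of x]
  by (auto simp: cells_def frac_lt_1 rep_def coord_comb algebra_simps)
     (metis add_diff_cancel_right')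

lemma rep_cells: "x \<in> cells \<Longrightarrow> rep x = x"
  unfolding rep_def using comb_coord[of x] by (simp add: cells_def frac_eq[THEN iffD2])

lemma rep_rep_add: "rep (rep x + y) = rep (x + y)"
proof -
  have "frac (frac a + b) = frac (a + b)" for a b :: real
  proof -
    have "frac a + b = (a + b) - of_int \<lfloor>a\<rfloor>" by (simp add: frac_def)
    thus ?thesis by (simp only: frac_def floor_diff_of_int of_int_diff)
  qed
  thus ?thesis unfolding rep_def by (simp add: coord_add coord_comb)
qed

lemma finite_cells: "finite cells"
proof (rule finite_subset[OF _ finite_bounded[of "\<Sum>i\<in>UNIV. N i"]])
  show "cells \<subseteq> {x \<in> L. x \<bullet> x \<le> (\<Sum>i\<in>UNIV. N i)}"
  proof
    fix x assume x: "x \<in> cells"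
    have "x \<bullet> x = (\<Sum>i\<in>UNIV. N i * (coord x i * coord x i))"
      using inner_comb[of "coord x" "coord x"] by (simp add: comb_coord)
    also have "\<dots> \<le> (\<Sum>i\<in>UNIV. N i)"
    proof (rule sum_mono)
      fix i
      have "coord x i * coord x i \<le> 1" using x by (intro mult_le_one) (auto simp: cells_def less_imp_le)
      thus "N i * (coord x i * coord x i) \<le> N i" using N_pos[of i] by simp
    qed
    finally show "x \<in> {x \<in> L. x \<bullet> x \<le> (\<Sum>i\<in>UNIV. N i)}" using x by (simp add: cells_def)
  qed
qed

lemma bij_betw_cells: "bij_betw (\<lambda>(c, k). c + comb (\<lambda>i. of_int (k i))) (cells \<times> UNIV) L"
proof (rule bij_betw_byWitness[where f' = "\<lambda>x. (rep x, \<lambda>i. \<lfloor>coord x i\<rfloor>)"])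
  have coord: "coord (c + comb (\<lambda>i. of_int (k i))) i = coord c i + of_int (k i)" for c k i
    by (simp add: coord_add coord_comb)
  show "\<forall>p\<in>cells \<times> UNIV. (rep (case p of (c, k) \<Rightarrow> c + comb (\<lambda>i. of_int (k i))),
      \<lambda>i. \<lfloor>coord (case p of (c, k) \<Rightarrow> c + comb (\<lambda>i. of_int (k i))) i\<rfloor>) = p"
  proof
    fix p assume "p \<in> cells \<times> (UNIV :: ('n \<Rightarrow> int) set)"
    then obtain c k where p: "p = (c, k)" and c: "c \<in> cells" by auto
    from c have fl: "\<lfloor>coord c i\<rfloor> = 0" for i by (auto simp: cells_def floor_eq_iff)
    have "rep (c + comb (\<lambda>i. of_int (k i))) = rep c"
      unfolding rep_def coord by (simp add: frac_def)
    thus "(rep (case p of (c, k) \<Rightarrow> c + comb (\<lambda>i. of_int (k i))),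
      \<lambda>i. \<lfloor>coord (case p of (c, k) \<Rightarrow> c + comb (\<lambda>i. of_int (k i))) i\<rfloor>) = p"
      unfolding p using rep_cells[OF c] fl by (simp add: coord)
  qed
  show "\<forall>x\<in>L. (case (rep x, \<lambda>i. \<lfloor>coord x i\<rfloor>) of (c, k) \<Rightarrow> c + comb (\<lambda>i. of_int (k i))) = x"
    by (simp add: rep_plus_floor)
  show "(\<lambda>(c, k). c + comb (\<lambda>i. of_int (k i))) ` (cells \<times> UNIV) \<subseteq> L"
    by (auto simp: cells_def intro!: add_mem comb_int_mem)
  show "(\<lambda>x. (rep x, \<lambda>i. \<lfloor>coord x i\<rfloor>)) ` L \<subseteq> cells \<times> UNIV"
    by (auto intro: rep_in_cells)
qed

lemma cis_dual_comb_rep: "cis (2 * pi * (dual_comb k \<bullet> rep x)) = cis (2 * pi * (dual_comb k \<bullet> x))"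
proof -
  have "dual_comb k \<bullet> x = dual_comb k \<bullet> rep x + dual_comb k \<bullet> comb (\<lambda>i. of_int \<lfloor>coord x i\<rfloor>)"
    by (metis inner_add_right rep_plus_floor)
  moreover have "dual_comb k \<bullet> comb (\<lambda>i. of_int \<lfloor>coord x i\<rfloor>) \<in> \<int>"
    unfolding dual_comb_inner coord_comb by (intro Ints_sum Ints_mult) auto
  ultimately show ?thesis
    by (simp add: distrib_left cis_mult[symmetric] cis_int)
qed

text \<open>Orthogonality of characters of the finite quotient. If \<open>dual_comb k\<close> is
  outside L, self-duality provides a lattice vector \<open>x\<close> pairing non-integrally with it,
  and translating the representatives by \<open>x\<close> multiplies the sum by a number other than
  1.\<close>

lemma character_sum:
  "(\<Sum>c\<in>cells. cis (2 * pi * (dual_comb k \<bullet> c))) = (if dual_comb k \<in> L then of_nat (card cells) else 0)"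
proof (cases "dual_comb k \<in> L")
  case True
  hence "cis (2 * pi * (dual_comb k \<bullet> c)) = 1" if "c \<in> cells" for c
    using that by (intro cis_int inner_in_Ints) (auto simp: cells_def)
  thus ?thesis using True by simp
next
  case False
  then obtain x where x: "x \<in> L" "x \<bullet> dual_comb k \<notin> \<int>"
    using memI by blast
  define S where "S = (\<Sum>c\<in>cells. cis (2 * pi * (dual_comb k \<bullet> c)))"
  have "S = (\<Sum>c\<in>cells. cis (2 * pi * (dual_comb k \<bullet> rep (c + x))))"
    unfolding S_def
  proof (rule sum.reindex_bij_witness[of _ "\<lambda>c. rep (c + x)" "\<lambda>c. rep (c - x)"])
    fix c assume c: "c \<in> cells"
    show "rep (rep (c - x) + x) = c" using rep_rep_add[of "c - x" x] rep_cells[OF c] by simp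
    show "rep (rep (c + x) - x) = c" using rep_rep_add[of "c + x" "- x"] rep_cells[OF c] by simp
    show "rep (c - x) \<in> cells" "rep (c + x) \<in> cells"
      using c x by (auto simp: cells_def intro!: rep_in_cells[unfolded cells_def, simplified] diff_mem add_mem)
    show "cis (2 * pi * (dual_comb k \<bullet> rep (rep (c - x) + x))) = cis (2 * pi * (dual_comb k \<bullet> c))"
      using rep_rep_add[of "c - x" x] rep_cells[OF c] by simp
  qed
  also have "\<dots> = cis (2 * pi * (dual_comb k \<bullet> x)) * S"
    unfolding S_def cis_dual_comb_rep sum_distrib_left
    by (intro sum.cong) (auto simp: inner_add_right distrib_left cis_mult add_ac)
  finally have "S = 0 \<or> cis (2 * pi * (dual_comb k \<bullet> x)) = 1" by auto
  moreover have "cis (2 * pi * (dual_comb k \<bullet> x)) \<noteq> 1"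
  proof
    assume "cis (2 * pi * (dual_comb k \<bullet> x)) = 1"
    then obtain n :: int where "2 * pi * (dual_comb k \<bullet> x) = 2 * pi * of_int n"
      by (auto simp: cis_conv_exp exp_eq_1 mult_ac)
    hence "dual_comb k \<bullet> x = of_int n" by simp
    thus False using x(2) by (metis Ints_of_int inner_commute)
  qed
  ultimately show ?thesis using False by (simp add: S_def)
qed

section \<open>Poisson summation by cosets of the frame sublattice\<close>

lemma summable_gaussian_shift:
  assumes "t > 0"
  shows "(\<lambda>x. exp (- pi * t * ((x + y) \<bullet> (x + y)))) summable_on L"
proof (rule summable_on_comparison_test)
  show "(\<lambda>x. exp (pi * t * (y \<bullet> y)) * exp (- (pi * t / 2) * (x \<bullet> x))) summable_on L"
    using assms by (intro summable_on_cmult_right summable_gaussian) auto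
  fix x :: "real^'n"
  have "0 \<le> (x + 2 *\<^sub>R y) \<bullet> (x + 2 *\<^sub>R y)" by simp
  hence "(x \<bullet> x) / 2 - y \<bullet> y \<le> (x + y) \<bullet> (x + y)"
    by (simp add: inner_add_left inner_add_right inner_commute)
  hence "pi * t * ((x \<bullet> x) / 2 - y \<bullet> y) \<le> pi * t * ((x + y) \<bullet> (x + y))"
    using assms by (intro mult_left_mono) auto
  thus "exp (- pi * t * ((x + y) \<bullet> (x + y))) \<le> exp (pi * t * (y \<bullet> y)) * exp (- (pi * t / 2) * (x \<bullet> x))"
    unfolding exp_add[symmetric] by (simp add: algebra_simps)
qed auto

text \<open>In frame coordinates the norm is a weighted sum of squares, so the Gaussian sum over the
  sublattice is a product of one-dimensional sums with parameters \<open>t * N i\<close>.\<close>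

lemma poisson_coset:
  assumes t: "t > 0"
  shows "(\<Sum>\<^sub>\<infinity>k. complex_of_real (exp (- pi * t * ((comb (\<lambda>i. of_int (k i)) + y) \<bullet> (comb (\<lambda>i. of_int (k i)) + y))))) =
         of_real (\<Prod>i\<in>UNIV. 1 / sqrt (t * N i)) *
         (\<Sum>\<^sub>\<infinity>k. of_real (exp (- pi * (dual_comb k \<bullet> dual_comb k) / t)) * cis (2 * pi * (dual_comb k \<bullet> y)))"
proof -
  have pos: "t * N i > 0" for i using t N_pos by simp
  have eq: "(comb (\<lambda>i. of_int (k i)) + y) \<bullet> (comb (\<lambda>i. of_int (k i)) + y) =
        (\<Sum>i\<in>UNIV. N i * (of_int (k i) + coord y i)\<^sup>2)" for k
  proof -
    have "comb (\<lambda>i. of_int (k i)) + y = comb (\<lambda>i. of_int (k i) + coord y i)"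
      using comb_add[of "\<lambda>i. of_int (k i)" "coord y"] by (simp add: comb_coord)
    thus ?thesis by (simp add: inner_comb power2_eq_square)
  qed
  have "(\<Sum>\<^sub>\<infinity>k. complex_of_real (exp (- pi * t * ((comb (\<lambda>i. of_int (k i)) + y) \<bullet> (comb (\<lambda>i. of_int (k i)) + y))))) =
        (\<Sum>\<^sub>\<infinity>k. \<Prod>i\<in>UNIV. complex_of_real (exp (- pi * (t * N i) * (of_int (k i) + coord y i)\<^sup>2)))"
    unfolding eq of_real_prod[symmetric] exp_sum[OF finite, symmetric] sum_distrib_left
    by (simp add: mult_ac)
  also have "\<dots> = (\<Prod>i\<in>UNIV. \<Sum>\<^sub>\<infinity>n. complex_of_real (exp (- pi * (t * N i) * (of_int n + coord y i)\<^sup>2)))"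
  proof (rule infsum_prod_fun)
    fix i
    have "(\<lambda>n::int. exp (- pi * (t * N i) * (of_int n + coord y i)\<^sup>2)) summable_on UNIV"
    proof (rule summable_on_comparison_test)
      show "(\<lambda>n::int. exp (2 * pi * (t * N i) * \<bar>coord y i\<bar> * \<bar>real_of_int n\<bar> - pi * (t * N i) * (of_int n)\<^sup>2)) summable_on UNIV"
        using pos by (intro summable_gaussian_int) auto
      fix n :: int
      have "\<bar>of_int n * coord y i\<bar> = \<bar>coord y i\<bar> * \<bar>real_of_int n\<bar>" by (simp add: abs_mult)
      hence "- (2 * (of_int n * coord y i)) \<le> 2 * (\<bar>coord y i\<bar> * \<bar>real_of_int n\<bar>)" by linarith
      moreover have "(of_int n + coord y i)\<^sup>2 = (of_int n)\<^sup>2 + 2 * (of_int n * coord y i) + (coord y i)\<^sup>2"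
        by (simp add: power2_sum)
      ultimately have "- ((of_int n + coord y i)\<^sup>2) \<le> 2 * (\<bar>coord y i\<bar> * \<bar>real_of_int n\<bar>) - (of_int n)\<^sup>2"
        using zero_le_power2[of "coord y i"] by linarith
      hence "pi * (t * N i) * (- ((of_int n + coord y i)\<^sup>2)) \<le>
             pi * (t * N i) * (2 * (\<bar>coord y i\<bar> * \<bar>real_of_int n\<bar>) - (of_int n)\<^sup>2)"
        using pos[of i] by (intro mult_left_mono) auto
      thus "exp (- pi * (t * N i) * (of_int n + coord y i)\<^sup>2) \<le>
            exp (2 * pi * (t * N i) * \<bar>coord y i\<bar> * \<bar>real_of_int n\<bar> - pi * (t * N i) * (of_int n)\<^sup>2)"
        by (simp add: algebra_simps)
    qed auto
    thus "(\<lambda>n::int. norm (complex_of_real (exp (- pi * (t * N i) * (of_int n + coord y i)\<^sup>2)))) summable_on UNIV"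
      by simp
  qed
  also have "\<dots> = (\<Prod>i\<in>UNIV. of_real (1 / sqrt (t * N i)) *
      (\<Sum>\<^sub>\<infinity>k. of_real (exp (- pi * (of_int k)\<^sup>2 / (t * N i))) * cis (2 * pi * of_int k * coord y i)))"
    by (intro prod.cong refl poisson_summation_gaussian pos)
  also have "\<dots> = of_real (\<Prod>i\<in>UNIV. 1 / sqrt (t * N i)) *
      (\<Prod>i\<in>UNIV. \<Sum>\<^sub>\<infinity>k. of_real (exp (- pi * (of_int k)\<^sup>2 / (t * N i))) * cis (2 * pi * of_int k * coord y i))"
    unfolding prod.distrib by simp
  also have "(\<Prod>i\<in>UNIV. \<Sum>\<^sub>\<infinity>k. of_real (exp (- pi * (of_int k)\<^sup>2 / (t * N i))) * cis (2 * pi * of_int k * coord y i)) =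
      (\<Sum>\<^sub>\<infinity>k. \<Prod>i\<in>UNIV. of_real (exp (- pi * (of_int (k i))\<^sup>2 / (t * N i))) * cis (2 * pi * of_int (k i) * coord y i))"
  proof (rule infsum_prod_fun[symmetric])
    fix i
    show "(\<lambda>k::int. norm (of_real (exp (- pi * (of_int k)\<^sup>2 / (t * N i))) * cis (2 * pi * of_int k * coord y i))) summable_on UNIV"
      using summable_gaussian_int[of "pi / (t * N i)" 0] pos[of i] by (simp add: norm_mult)
  qed
  also have "\<dots> = (\<Sum>\<^sub>\<infinity>k. of_real (exp (- pi * (dual_comb k \<bullet> dual_comb k) / t)) * cis (2 * pi * (dual_comb k \<bullet> y)))"
  proof (rule infsum_cong)
    fix k :: "'n \<Rightarrow> int"
    have "(\<Prod>i\<in>UNIV. complex_of_real (exp (- pi * (of_int (k i))\<^sup>2 / (t * N i)))) =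
        of_real (exp (\<Sum>i\<in>UNIV. - pi * (of_int (k i))\<^sup>2 / (t * N i)))"
      by (simp add: exp_sum)
    also have "(\<Sum>i\<in>UNIV. - pi * (of_int (k i))\<^sup>2 / (t * N i)) = - pi * (dual_comb k \<bullet> dual_comb k) / t"
      unfolding norm_dual_comb sum_distrib_left sum_divide_distrib by (simp add: mult_ac)
    finally have 1: "(\<Prod>i\<in>UNIV. complex_of_real (exp (- pi * (of_int (k i))\<^sup>2 / (t * N i)))) =
        of_real (exp (- pi * (dual_comb k \<bullet> dual_comb k) / t))" .
    have "(\<Prod>i\<in>UNIV. cis (2 * pi * of_int (k i) * coord y i)) = cis (\<Sum>i\<in>UNIV. 2 * pi * of_int (k i) * coord y i)"
      by (simp add: cis_conv_exp exp_sum sum_distrib_left)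
    also have "(\<Sum>i\<in>UNIV. 2 * pi * of_int (k i) * coord y i) = 2 * pi * (dual_comb k \<bullet> y)"
      unfolding dual_comb_inner sum_distrib_left by (simp add: mult_ac)
    finally show "(\<Prod>i\<in>UNIV. of_real (exp (- pi * (of_int (k i))\<^sup>2 / (t * N i))) * cis (2 * pi * of_int (k i) * coord y i)) =
      of_real (exp (- pi * (dual_comb k \<bullet> dual_comb k) / t)) * cis (2 * pi * (dual_comb k \<bullet> y))"
      unfolding prod.distrib 1 by simp
  qed
  finally show ?thesis .
qed

text \<open>When the cosets are summed, the character sum keeps exactly those points of the dual of
  the sublattice that lie in L. The constant is the index of the sublattice divided by its covolume,
  times \<open>t\<close> to the power -n/2.\<close>

lemma poisson_up_to_constant:
  assumes t: "t > 0"
  shows "(\<Sum>\<^sub>\<infinity>x\<in>L. complex_of_real (exp (- pi * t * ((x + y) \<bullet> (x + y))))) =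
         of_real (real (card cells) * (\<Prod>i\<in>UNIV. 1 / sqrt (t * N i))) *
         (\<Sum>\<^sub>\<infinity>x\<in>L. of_real (exp (- pi * (x \<bullet> x) / t)) * cis (2 * pi * (x \<bullet> y)))"
proof -
  define E where "E = (\<lambda>x. complex_of_real (exp (- pi * t * ((x + y) \<bullet> (x + y)))))"
  define F where "F = (\<lambda>k. of_real (exp (- pi * (dual_comb k \<bullet> dual_comb k) / t)) * cis (2 * pi * (dual_comb k \<bullet> y)))"
  define \<kappa> where "\<kappa> = complex_of_real (\<Prod>i\<in>UNIV. 1 / sqrt (t * N i))"
  define b where "b = (\<lambda>(c, k). c + comb (\<lambda>i. of_int (k i)))"
  have E: "E summable_on L"
    unfolding E_def using summable_gaussian_shift[OF t] by (rule summable_on_of_real)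
  have "(\<lambda>p. E (b p)) summable_on (cells \<times> UNIV)"
    using summable_on_reindex_bij_betw[OF bij_betw_cells, of E] E by (simp add: b_def)
  hence "infsum E L = (\<Sum>\<^sub>\<infinity>c\<in>cells. \<Sum>\<^sub>\<infinity>k. E (b (c, k)))"
    using infsum_reindex_bij_betw[OF bij_betw_cells, of E]
      infsum_Sigma_banach[of "\<lambda>p. E (b p)" cells "\<lambda>_. UNIV"] by (simp add: b_def)
  also have "\<dots> = (\<Sum>c\<in>cells. \<Sum>\<^sub>\<infinity>k. E (b (c, k)))"
    using finite_cells by simp
  also have "\<dots> = (\<Sum>c\<in>cells. \<kappa> * (\<Sum>\<^sub>\<infinity>k. F k * cis (2 * pi * (dual_comb k \<bullet> c))))"
  proof (rule sum.cong)
    fix c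
    have "(\<Sum>\<^sub>\<infinity>k. E (b (c, k))) = \<kappa> * (\<Sum>\<^sub>\<infinity>k. of_real (exp (- pi * (dual_comb k \<bullet> dual_comb k) / t)) * cis (2 * pi * (dual_comb k \<bullet> (c + y))))"
      unfolding E_def b_def \<kappa>_def using poisson_coset[OF t, of "c + y"] by (simp add: add_ac)
    thus "(\<Sum>\<^sub>\<infinity>k. E (b (c, k))) = \<kappa> * (\<Sum>\<^sub>\<infinity>k. F k * cis (2 * pi * (dual_comb k \<bullet> c)))"
      by (simp add: F_def inner_add_right distrib_left cis_mult mult.assoc add_ac)
  qed simp
  also have "\<dots> = \<kappa> * (\<Sum>\<^sub>\<infinity>k. \<Sum>c\<in>cells. F k * cis (2 * pi * (dual_comb k \<bullet> c)))"
  proof -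
    have "(\<lambda>k. norm (F k * cis (2 * pi * (dual_comb k \<bullet> c)))) summable_on UNIV" for c
      using summable_gaussian_dual_comb[of "pi / t"] t by (simp add: F_def norm_mult)
    hence "(\<lambda>k. F k * cis (2 * pi * (dual_comb k \<bullet> c))) summable_on UNIV" for c
      by (rule abs_summable_summable)
    hence "((\<lambda>k. \<Sum>c\<in>cells. F k * cis (2 * pi * (dual_comb k \<bullet> c))) has_sum
      (\<Sum>c\<in>cells. \<Sum>\<^sub>\<infinity>k. F k * cis (2 * pi * (dual_comb k \<bullet> c)))) UNIV"
      by (intro has_sum_finite_sum has_sum_infsum)
    thus ?thesis by (simp add: infsumI sum_distrib_left)
  qed
  also have "(\<Sum>\<^sub>\<infinity>k. \<Sum>c\<in>cells. F k * cis (2 * pi * (dual_comb k \<bullet> c))) =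
      (\<Sum>\<^sub>\<infinity>k\<in>dual_comb -` L. of_nat (card cells) * F k)"
    unfolding sum_distrib_left[symmetric] character_sum by (rule infsum_cong_neutral) auto
  also have "\<dots> = of_nat (card cells) * (\<Sum>\<^sub>\<infinity>k\<in>dual_comb -` L. F k)"
    by (rule infsum_cmult_right')
  also have "(\<Sum>\<^sub>\<infinity>k\<in>dual_comb -` L. F k) = (\<Sum>\<^sub>\<infinity>x\<in>L. of_real (exp (- pi * (x \<bullet> x) / t)) * cis (2 * pi * (x \<bullet> y)))"
  proof -
    have "bij_betw dual_comb (dual_comb -` L) L"
      using inj_dual_comb lattice_subset_range_dual_comb
      by (auto simp: bij_betw_def inj_on_def)
    thus ?thesis unfolding F_def by (rule infsum_reindex_bij_betw)
  qed
  finally show ?thesis by (simp add: E_def \<kappa>_def mult_ac)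
qed

text \<open>Evaluating at \<open>t = 1\<close>, \<open>y = 0\<close> shows that the covolume is 1.\<close>
lemma poisson_frame:
  assumes t: "t > 0"
  shows "(\<Sum>\<^sub>\<infinity>x\<in>L. complex_of_real (exp (- pi * t * ((x + y) \<bullet> (x + y))))) =
         of_real (1 / sqrt t ^ CARD('n)) *
         (\<Sum>\<^sub>\<infinity>x\<in>L. of_real (exp (- pi * (x \<bullet> x) / t)) * cis (2 * pi * (x \<bullet> y)))"
proof -
  define \<kappa> where "\<kappa> = real (card cells) * (\<Prod>i\<in>UNIV. 1 / sqrt (N i))"
  define S where "S = (\<Sum>\<^sub>\<infinity>x\<in>L. exp (- pi * (x \<bullet> x)))"
  have sum: "(\<lambda>x. exp (- pi * (x \<bullet> x))) summable_on L" by (rule summable_gaussian) simp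
  have "exp (- pi * (0 \<bullet> (0 :: real^'n))) \<le> S"
    unfolding S_def using finite_sum_le_infsum[OF sum, of "{0}"] zero_mem by simp
  hence "S > 0" by simp
  have "complex_of_real S = of_real (\<kappa> * S)"
    using poisson_up_to_constant[of 1 0] by (simp add: S_def \<kappa>_def infsum_complex_of_real[OF sum, simplified])
  hence "\<kappa> = 1" using \<open>S > 0\<close> by (simp only: of_real_eq_iff) simp
  moreover have "(\<Prod>i\<in>UNIV. 1 / sqrt (t * N i)) = (1 / sqrt t ^ CARD('n)) * (\<Prod>i\<in>UNIV. 1 / sqrt (N i))"
    by (simp add: real_sqrt_mult prod_dividef prod.distrib)
  ultimately show ?thesis using poisson_up_to_constant[OF t, of y] by (simp add: \<kappa>_def)
qed

end

context selfdual_lattice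
begin

lemma frame_exists: "\<exists>v. selfdual_lattice_frame L v"
  using orthogonal_family_exists selfdual_lattice_axioms
  by (metis selfdual_lattice_frame.intro selfdual_lattice_frame_axioms.intro)

lemma finite_shell: "finite (shell L m)"
proof -
  obtain v where "selfdual_lattice_frame L v" using frame_exists by blast
  from selfdual_lattice_frame.finite_bounded[OF this, of m] show ?thesis
    by (rule finite_subset[rotated]) (auto simp: shell_def)
qed

lemma summable_gaussian: "c > 0 \<Longrightarrow> (\<lambda>x. exp (- c * (x \<bullet> x))) summable_on L"
  using frame_exists selfdual_lattice_frame.summable_gaussian by blast

lemma poisson_summation:
  "t > 0 \<Longrightarrow> (\<Sum>\<^sub>\<infinity>x\<in>L. complex_of_real (exp (- pi * t * ((x + y) \<bullet> (x + y))))) =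
    of_real (1 / sqrt t ^ CARD('n)) *
    (\<Sum>\<^sub>\<infinity>x\<in>L. of_real (exp (- pi * (x \<bullet> x) / t)) * cis (2 * pi * (x \<bullet> y)))"
  using frame_exists selfdual_lattice_frame.poisson_frame by blast

end

subsection \<open>Homogeneous and harmonic polynomials\<close>

definition expo :: "nat \<Rightarrow> ('n::finite \<Rightarrow> nat) set" where
  "expo k = {\<alpha>. sum \<alpha> UNIV = k}"

definition monomial :: "('n::finite \<Rightarrow> nat) \<Rightarrow> real^'n \<Rightarrow> real" where
  "monomial \<alpha> x = (\<Prod>i\<in>UNIV. (x$i) ^ \<alpha> i)"

definition mfact :: "('n::finite \<Rightarrow> nat) \<Rightarrow> real" where
  "mfact \<alpha> = (\<Prod>i\<in>UNIV. fact (\<alpha> i))"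

lemma mfact_nonzero [simp]: "mfact \<alpha> \<noteq> 0"
  by (simp add: mfact_def)

lemma expo_le: "\<alpha> \<in> expo k \<Longrightarrow> \<alpha> i \<le> k"
  unfolding expo_def using member_le_sum[of i UNIV \<alpha>] by auto

lemma finite_expo: "finite (expo k)"
proof (rule finite_subset)
  show "expo k \<subseteq> Pi\<^sub>E UNIV (\<lambda>_. {..k})"
    using expo_le by (auto simp: PiE_UNIV_domain)
qed (auto intro!: finite_PiE)

text \<open>The multinomial theorem divided by k!, proved by splitting off one variable with the
  binomial theorem. Exponents vanish outside S so that each exponent vector is represented by one
  function on the whole index type.\<close>

lemma multinomial_aux:
  fixes z :: "'n::finite \<Rightarrow> real"
  shows "(\<Sum>i\<in>S. z i) ^ k / fact k =
    (\<Sum>\<alpha>\<in>{\<alpha>. (\<forall>i. i \<notin> S \<longrightarrow> \<alpha> i = 0) \<and> sum \<alpha> S = k}. \<Prod>i\<in>S. z i ^ \<alpha> i / fact (\<alpha> i))"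
  using finite[of S]
proof (induction S arbitrary: k rule: finite_induct)
  case empty
  have "{\<alpha>. \<forall>i::'n. \<alpha> i = (0::nat)} = {\<lambda>_. 0}" by auto
  thus ?case by (cases "k = 0") auto
next
  case (insert a S)
  define T where "T = (\<lambda>S k. {\<alpha> :: 'n \<Rightarrow> nat. (\<forall>i. i \<notin> S \<longrightarrow> \<alpha> i = 0) \<and> sum \<alpha> S = k})"
  have fin: "finite (T S k)" for k
  proof (rule finite_subset)
    have "\<alpha> i \<le> k" if "\<alpha> \<in> T S k" for \<alpha> i
      using that member_le_sum[of i S \<alpha>] by (cases "i \<in> S") (auto simp: T_def)
    thus "T S k \<subseteq> Pi\<^sub>E UNIV (\<lambda>_. {..k})" by (auto simp: PiE_UNIV_domain)
  qed (auto intro!: finite_PiE)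
  have "(\<Sum>i\<in>insert a S. z i) ^ k / fact k =
      (\<Sum>j\<le>k. z a ^ j / fact j * ((\<Sum>i\<in>S. z i) ^ (k - j) / fact (k - j)))"
  proof -
    have "(\<Sum>i\<in>insert a S. z i) ^ k = (\<Sum>j\<le>k. of_nat (k choose j) * z a ^ j * (\<Sum>i\<in>S. z i) ^ (k - j))"
      using insert.hyps by (simp add: binomial_ring)
    thus ?thesis
      by (simp add: sum_divide_distrib binomial_fact field_simps)
  qed
  also have "\<dots> = (\<Sum>j\<le>k. \<Sum>\<alpha>\<in>T S (k - j). z a ^ j / fact j * (\<Prod>i\<in>S. z i ^ \<alpha> i / fact (\<alpha> i)))"
    unfolding insert.IH sum_distrib_left T_def ..
  also have "\<dots> = (\<Sum>(j,\<alpha>)\<in>Sigma {..k} (\<lambda>j. T S (k - j)). z a ^ j / fact j * (\<Prod>i\<in>S. z i ^ \<alpha> i / fact (\<alpha> i)))"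
    using fin by (subst sum.Sigma) auto
  also have "\<dots> = (\<Sum>\<beta>\<in>T (insert a S) k. \<Prod>i\<in>insert a S. z i ^ \<beta> i / fact (\<beta> i))"
  proof (rule sum.reindex_bij_witness[of _ "\<lambda>\<beta>. (\<beta> a, \<beta>(a := 0))" "\<lambda>(j,\<alpha>). \<alpha>(a := j)"])
    fix p assume "p \<in> Sigma {..k} (\<lambda>j. T S (k - j))"
    then obtain j \<alpha> where p: "p = (j, \<alpha>)" "j \<le> k" "\<alpha> \<in> T S (k - j)" by auto
    have a0: "\<alpha> a = 0" using p insert.hyps by (auto simp: T_def)
    have sum_eq: "sum (\<alpha>(a := j)) S = sum \<alpha> S" using insert.hyps by (intro sum.cong) auto
    show "((case p of (j, \<alpha>) \<Rightarrow> \<alpha>(a := j)) a, (case p of (j, \<alpha>) \<Rightarrow> \<alpha>(a := j))(a := 0)) = p"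
      using p a0 by auto
    show "(case p of (j, \<alpha>) \<Rightarrow> \<alpha>(a := j)) \<in> T (insert a S) k"
      using p insert.hyps sum_eq by (auto simp: T_def)
    have "(\<Prod>i\<in>S. z i ^ (\<alpha>(a := j)) i / fact ((\<alpha>(a := j)) i)) = (\<Prod>i\<in>S. z i ^ \<alpha> i / fact (\<alpha> i))"
      using insert.hyps by (intro prod.cong) auto
    thus "(\<Prod>i\<in>insert a S. z i ^ (case p of (j, \<alpha>) \<Rightarrow> \<alpha>(a := j)) i / fact ((case p of (j, \<alpha>) \<Rightarrow> \<alpha>(a := j)) i)) =
        (case p of (j, \<alpha>) \<Rightarrow> z a ^ j / fact j * (\<Prod>i\<in>S. z i ^ \<alpha> i / fact (\<alpha> i)))"
      using insert.hyps p by simp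
  next
    fix \<beta> assume \<beta>: "\<beta> \<in> T (insert a S) k"
    have sum_eq: "sum (\<beta>(a := 0)) S = sum \<beta> S" using insert.hyps by (intro sum.cong) auto
    show "(case (\<beta> a, \<beta>(a := 0)) of (j, \<alpha>) \<Rightarrow> \<alpha>(a := j)) = \<beta>" by auto
    show "(\<beta> a, \<beta>(a := 0)) \<in> Sigma {..k} (\<lambda>j. T S (k - j))"
      using \<beta> insert.hyps sum_eq by (auto simp: T_def)
  qed
  finally show ?case by (simp add: T_def)
qed

text \<open>The reproducing kernel of the Fischer pairing: as a polynomial in \<open>y\<close> it
  carries all monomials of degree k in \<open>x\<close>, so that moments in all directions
  \<open>y\<close> encode all monomial moments.\<close>

lemma inner_power_expand:
  "(x \<bullet> y) ^ k / fact k = (\<Sum>\<alpha>\<in>expo k. monomial \<alpha> x * monomial \<alpha> y / mfact \<alpha>)"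
proof -
  have "(x \<bullet> y) ^ k / fact k = (\<Sum>\<alpha>\<in>expo k. \<Prod>i\<in>UNIV. (x$i * y$i) ^ \<alpha> i / fact (\<alpha> i))"
    using multinomial_aux[of "\<lambda>i. x$i * y$i" UNIV k] by (simp add: inner_vec_def expo_def)
  thus ?thesis
    by (simp add: monomial_def mfact_def power_mult_distrib prod_dividef prod.distrib)
qed

section \<open>Linear independence of the monomials of one degree\<close>

lemma digits_less:
  fixes a :: "nat \<Rightarrow> nat"
  assumes "\<And>j. j < n \<Longrightarrow> a j < B"
  shows "(\<Sum>j<n. a j * B ^ j) < B ^ n"
  using assms
proof (induction n)
  case (Suc n)
  have "(\<Sum>j<Suc n. a j * B ^ j) < B ^ n + a n * B ^ n" using Suc by auto
  also have "\<dots> = (a n + 1) * B ^ n" by simp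
  also have "\<dots> \<le> B * B ^ n" using Suc.prems[of n] by (intro mult_right_mono) auto
  finally show ?case by simp
qed auto

lemma digits_inj:
  fixes a b :: "nat \<Rightarrow> nat"
  assumes "\<And>j. j < n \<Longrightarrow> a j < B" "\<And>j. j < n \<Longrightarrow> b j < B"
    and "(\<Sum>j<n. a j * B ^ j) = (\<Sum>j<n. b j * B ^ j)" "j < n"
  shows "a j = b j"
  using assms
proof (induction n arbitrary: j)
  case (Suc n)
  have a: "(\<Sum>j<n. a j * B ^ j) < B ^ n" and b: "(\<Sum>j<n. b j * B ^ j) < B ^ n"
    using Suc.prems by (auto intro!: digits_less)
  have "((\<Sum>j<n. a j * B ^ j) + a n * B ^ n) div B ^ n = ((\<Sum>j<n. b j * B ^ j) + b n * B ^ n) div B ^ n"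
    using Suc.prems(3) by simp
  moreover have "B ^ n > 0" by (rule le_less_trans[OF le0 a])
  ultimately have n: "a n = b n" using a b by simp
  hence eq: "(\<Sum>j<n. a j * B ^ j) = (\<Sum>j<n. b j * B ^ j)" using Suc.prems(3) by simp
  show ?case
  proof (cases "j = n")
    case False
    hence "j < n" using Suc.prems(4) by simp
    thus ?thesis using Suc.prems(1,2) by (intro Suc.IH eq) auto
  qed (simp add: n)
qed auto

text \<open>Kronecker substitution \<open>y\<^sub>i = s\<^bsup>(k+1)\<^bsup>e(i)\<^esup>\<^esup>\<close> separates the monomials of degree \<open>k\<close>.\<close>
lemma hom_poly_coeff_unique:
  fixes d :: "('n::finite \<Rightarrow> nat) \<Rightarrow> complex"
  assumes zero: "\<And>y. (\<Sum>\<alpha>\<in>expo k. d \<alpha> * of_real (monomial \<alpha> y)) = 0" and \<alpha>: "\<alpha> \<in> expo k"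
  shows "d \<alpha> = 0"
proof -
  define n where "n = CARD('n)"
  obtain e :: "'n \<Rightarrow> nat" where e: "bij_betw e UNIV {..<n}"
    using ex_bij_betw_finite_nat[of "UNIV :: 'n set"] by (auto simp: n_def atLeast0LessThan)
  define B where "B = k + 1"
  define K where "K = (\<lambda>\<alpha> :: 'n \<Rightarrow> nat. \<Sum>i\<in>UNIV. \<alpha> i * B ^ e i)"
  have K: "K \<alpha> = (\<Sum>j<n. \<alpha> (inv_into UNIV e j) * B ^ j)" for \<alpha>
    unfolding K_def
    by (rule sum.reindex_bij_witness[of _ "inv_into UNIV e" e])
       (use e in \<open>auto simp: bij_betw_def f_inv_into_f\<close>)
  have inj: "inj_on K (expo k)"
  proof (rule inj_onI)
    fix \<alpha> \<beta> :: "'n \<Rightarrow> nat" assume \<alpha>: "\<alpha> \<in> expo k" and \<beta>: "\<beta> \<in> expo k" and eq: "K \<alpha> = K \<beta>"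
    have "\<alpha> (inv_into UNIV e j) = \<beta> (inv_into UNIV e j)" if "j < n" for j
    proof (rule digits_inj[of n "\<lambda>j. \<alpha> (inv_into UNIV e j)" B "\<lambda>j. \<beta> (inv_into UNIV e j)"])
      show "(\<Sum>j<n. \<alpha> (inv_into UNIV e j) * B ^ j) = (\<Sum>j<n. \<beta> (inv_into UNIV e j) * B ^ j)"
        using eq by (simp add: K)
    qed (use that expo_le[OF \<alpha>] expo_le[OF \<beta>] in \<open>auto simp: B_def less_Suc_eq_le\<close>)
    thus "\<alpha> = \<beta>" using e by (intro ext) (metis bij_betw_apply bij_betw_inv_into_left UNIV_I lessThan_iff)
  qed
  define p where "p = (\<Sum>\<alpha>\<in>expo k. monom (d \<alpha>) (K \<alpha>))"
  have "poly p (of_real s) = 0" for s :: real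
  proof -
    have "monomial \<alpha> (\<chi> i. s ^ (B ^ e i)) = s ^ K \<alpha>" for \<alpha>
      by (simp add: monomial_def K_def power_mult[symmetric] power_sum mult.commute)
    thus ?thesis using zero[of "\<chi> i. s ^ (B ^ e i)"] by (simp add: p_def poly_sum poly_monom)
  qed
  hence "range complex_of_real \<subseteq> {z. poly p z = 0}" by auto
  moreover have "infinite (range complex_of_real)"
    using infinite_UNIV_char_0 by (simp add: finite_image_iff inj_on_def)
  ultimately have "p = 0" using poly_roots_finite finite_subset by blast
  hence "coeff p (K \<alpha>) = 0" by simp
  moreover have "coeff p (K \<alpha>) = (\<Sum>\<beta>\<in>expo k. if \<beta> = \<alpha> then d \<alpha> else 0)"
    unfolding p_def coeff_sum using inj \<alpha> by (intro sum.cong) (auto simp: inj_on_def)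
  ultimately show ?thesis using \<alpha> by (simp add: finite_expo)
qed

section \<open>Complex homogeneous polynomials and multiplication by the squared norm\<close>

definition hompoly :: "nat \<Rightarrow> (real^'n \<Rightarrow> complex) \<Rightarrow> bool" where
  "hompoly k Q \<longleftrightarrow> (\<exists>d. \<forall>y. Q y = (\<Sum>\<alpha>\<in>expo k. d \<alpha> * of_real (monomial \<alpha> y)))"

lemma hompoly_0: "hompoly k (\<lambda>_. 0)"
  unfolding hompoly_def by (intro exI[of _ "\<lambda>_. 0"]) simp

lemma hompoly_add:
  assumes "hompoly k P" "hompoly k Q"
  shows "hompoly k (\<lambda>y. P y + Q y)"
proof -
  obtain d e where "\<And>y. P y = (\<Sum>\<alpha>\<in>expo k. d \<alpha> * of_real (monomial \<alpha> y))"
    "\<And>y. Q y = (\<Sum>\<alpha>\<in>expo k. e \<alpha> * of_real (monomial \<alpha> y))"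
    using assms unfolding hompoly_def by metis
  thus ?thesis unfolding hompoly_def
    by (intro exI[of _ "\<lambda>\<alpha>. d \<alpha> + e \<alpha>"]) (simp add: sum.distrib ring_distribs)
qed

lemma hompoly_cmult:
  assumes "hompoly k P"
  shows "hompoly k (\<lambda>y. c * P y)"
proof -
  obtain d where "\<And>y. P y = (\<Sum>\<alpha>\<in>expo k. d \<alpha> * of_real (monomial \<alpha> y))"
    using assms unfolding hompoly_def by metis
  thus ?thesis unfolding hompoly_def
    by (intro exI[of _ "\<lambda>\<alpha>. c * d \<alpha>"]) (simp add: sum_distrib_left mult_ac)
qed

lemma hompoly_sum: "(\<And>i. i \<in> I \<Longrightarrow> hompoly k (P i)) \<Longrightarrow> hompoly k (\<lambda>y. \<Sum>i\<in>I. P i y)"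
  by (induction I rule: infinite_finite_induct) (auto intro: hompoly_0 hompoly_add)

lemma sum_fun_upd:
  fixes \<gamma> :: "'n::finite \<Rightarrow> nat"
  shows "sum (\<gamma>(i := c)) UNIV + \<gamma> i = sum \<gamma> UNIV + c"
proof -
  have "sum (\<gamma>(i := c)) UNIV = c + sum \<gamma> (UNIV - {i})"
    by (subst sum.remove[of _ i]) auto
  moreover have "sum \<gamma> UNIV = \<gamma> i + sum \<gamma> (UNIV - {i})"
    by (subst sum.remove[of _ i]) auto
  ultimately show ?thesis by simp
qed

lemma sum_expo_shift:
  fixes f :: "('n::finite \<Rightarrow> nat) \<Rightarrow> 'b::comm_monoid_add"
  shows "(\<Sum>\<beta>\<in>expo k. f (\<beta>(i := \<beta> i + 2))) = (\<Sum>\<alpha>\<in>{\<alpha> \<in> expo (k + 2). \<alpha> i \<ge> 2}. f \<alpha>)"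
proof (rule sum.reindex_bij_witness[of _ "\<lambda>\<alpha>. \<alpha>(i := \<alpha> i - 2)" "\<lambda>\<beta>. \<beta>(i := \<beta> i + 2)"])
  fix \<beta> :: "'n \<Rightarrow> nat" assume "\<beta> \<in> expo k"
  thus "\<beta>(i := \<beta> i + 2) \<in> {\<alpha> \<in> expo (k + 2). \<alpha> i \<ge> 2}"
    using sum_fun_upd[of \<beta> i "\<beta> i + 2"] by (auto simp: expo_def)
next
  fix \<alpha> :: "'n \<Rightarrow> nat" assume "\<alpha> \<in> {\<alpha> \<in> expo (k + 2). \<alpha> i \<ge> 2}"
  thus "\<alpha>(i := \<alpha> i - 2) \<in> expo k" "(\<alpha>(i := \<alpha> i - 2))(i := (\<alpha>(i := \<alpha> i - 2)) i + 2) = \<alpha>"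
    using sum_fun_upd[of \<alpha> i "\<alpha> i - 2"] by (auto simp: expo_def fun_eq_iff)
qed auto

lemma monomial_upd2: "monomial (\<beta>(i := \<beta> i + 2)) y = (y$i)\<^sup>2 * monomial \<beta> y"
proof -
  have "monomial (\<beta>(i := \<beta> i + 2)) y = (y$i) ^ (\<beta> i + 2) * (\<Prod>j\<in>UNIV-{i}. (y$j) ^ \<beta> j)"
    unfolding monomial_def by (subst prod.remove[of _ i]) auto
  also have "\<dots> = (y$i)\<^sup>2 * ((y$i) ^ \<beta> i * (\<Prod>j\<in>UNIV-{i}. (y$j) ^ \<beta> j))"
    by (simp add: power_add power2_eq_square)
  also have "(y$i) ^ \<beta> i * (\<Prod>j\<in>UNIV-{i}. (y$j) ^ \<beta> j) = monomial \<beta> y"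
    unfolding monomial_def by (subst (2) prod.remove[of _ i]) auto
  finally show ?thesis .
qed

lemma mfact_upd2: "mfact (\<beta>(i := \<beta> i + 2)) = real ((\<beta> i + 2) * (\<beta> i + 1)) * mfact \<beta>"
proof -
  have "mfact (\<beta>(i := \<beta> i + 2)) = fact (\<beta> i + 2) * (\<Prod>j\<in>UNIV-{i}. fact (\<beta> j))"
    unfolding mfact_def by (subst prod.remove[of _ i]) auto
  also have "\<dots> = real ((\<beta> i + 2) * (\<beta> i + 1)) * (fact (\<beta> i) * (\<Prod>j\<in>UNIV-{i}. fact (\<beta> j)))"
    by (simp add: algebra_simps)
  also have "fact (\<beta> i) * (\<Prod>j\<in>UNIV-{i}. fact (\<beta> j)) = mfact \<beta>"
    unfolding mfact_def by (subst (2) prod.remove[of _ i]) auto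
  finally show ?thesis .
qed

text \<open>Coefficients of |y|^2 times the polynomial with coefficients \<open>d\<close>.\<close>

definition radial_coeff :: "(('n::finite \<Rightarrow> nat) \<Rightarrow> complex) \<Rightarrow> ('n \<Rightarrow> nat) \<Rightarrow> complex" where
  "radial_coeff d \<alpha> = (\<Sum>i\<in>UNIV. if \<alpha> i \<ge> 2 then d (\<alpha>(i := \<alpha> i - 2)) else 0)"

text \<open>Moves multiplication by |y|^2 onto the weights \<open>w\<close>. With the monomials as
  weights this is the product itself; with the weights \<open>c \<alpha> * mfact \<alpha>\<close> it
  yields the Laplacian of the polynomial with coefficients \<open>c\<close>.\<close>

lemma sum_radial_coeff:
  fixes w :: "('n::finite \<Rightarrow> nat) \<Rightarrow> complex"
  shows "(\<Sum>\<alpha>\<in>expo (k + 2). radial_coeff d \<alpha> * w \<alpha>) =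
         (\<Sum>\<beta>\<in>expo k. d \<beta> * (\<Sum>i\<in>UNIV. w (\<beta>(i := \<beta> i + 2))))"
proof -
  have "(\<Sum>\<alpha>\<in>expo (k + 2). radial_coeff d \<alpha> * w \<alpha>) =
        (\<Sum>i\<in>UNIV. \<Sum>\<alpha>\<in>expo (k + 2). if \<alpha> i \<ge> 2 then d (\<alpha>(i := \<alpha> i - 2)) * w \<alpha> else 0)"
    unfolding radial_coeff_def sum_distrib_right
    by (subst sum.swap) (intro sum.cong refl, auto)
  also have "\<dots> = (\<Sum>i\<in>UNIV. \<Sum>\<alpha>\<in>{\<alpha> \<in> expo (k + 2). \<alpha> i \<ge> 2}. d (\<alpha>(i := \<alpha> i - 2)) * w \<alpha>)"
    using finite_expo by (intro sum.cong refl sum.inter_filter[symmetric])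
  also have "\<dots> = (\<Sum>i\<in>UNIV. \<Sum>\<beta>\<in>expo k. d \<beta> * w (\<beta>(i := \<beta> i + 2)))"
  proof (rule sum.cong[OF refl])
    fix i :: 'n
    show "(\<Sum>\<alpha>\<in>{\<alpha> \<in> expo (k + 2). \<alpha> i \<ge> 2}. d (\<alpha>(i := \<alpha> i - 2)) * w \<alpha>) = (\<Sum>\<beta>\<in>expo k. d \<beta> * w (\<beta>(i := \<beta> i + 2)))"
      using sum_expo_shift[of "\<lambda>\<alpha>. d (\<alpha>(i := \<alpha> i - 2)) * w \<alpha>" i k] by simp
  qed
  also have "\<dots> = (\<Sum>\<beta>\<in>expo k. d \<beta> * (\<Sum>i\<in>UNIV. w (\<beta>(i := \<beta> i + 2))))"
    unfolding sum_distrib_left by (rule sum.swap)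
  finally show ?thesis .
qed

lemma norm_sq_times_hompoly:
  assumes "\<And>y. Q y = (\<Sum>\<alpha>\<in>expo k. d \<alpha> * of_real (monomial \<alpha> y))"
  shows "of_real (y \<bullet> y) * Q y = (\<Sum>\<alpha>\<in>expo (k + 2). radial_coeff d \<alpha> * of_real (monomial \<alpha> y))"
proof -
  have "of_real (y \<bullet> y) = (\<Sum>i\<in>UNIV. complex_of_real ((y$i)\<^sup>2))"
    by (simp add: inner_vec_def power2_eq_square)
  thus ?thesis
    unfolding sum_radial_coeff assms monomial_upd2
    by (simp add: sum_distrib_left sum_distrib_right mult_ac)
qed

lemma hompoly_norm_sq:
  assumes "hompoly k Q"
  shows "hompoly (k + 2) (\<lambda>y. of_real (y \<bullet> y) * Q y)"
proof -
  obtain d where d: "\<And>y. Q y = (\<Sum>\<alpha>\<in>expo k. d \<alpha> * of_real (monomial \<alpha> y))"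
    using assms unfolding hompoly_def by blast
  show ?thesis
    unfolding hompoly_def using norm_sq_times_hompoly[OF d] by (intro exI[of _ "radial_coeff d"]) blast
qed

lemma hompoly_norm_sq_power: "hompoly k Q \<Longrightarrow> hompoly (k + 2 * j) (\<lambda>y. of_real (y \<bullet> y) ^ j * Q y)"
proof (induction j)
  case (Suc j)
  hence "hompoly ((k + 2 * j) + 2) (\<lambda>y. of_real (y \<bullet> y) * (of_real (y \<bullet> y) ^ j * Q y))"
    by (intro hompoly_norm_sq)
  thus ?case by (simp add: mult_ac)
qed simp

text \<open>The Fischer pairing with a harmonic polynomial annihilates the multiples of \<open>|y|\<^sup>2\<close>.\<close>
lemma harmonic_pairing:
  fixes c :: "('n::finite \<Rightarrow> nat) \<Rightarrow> real"
  assumes harm: "\<And>\<beta>. sum \<beta> UNIV + 2 = k \<Longrightarrow>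
      (\<Sum>i\<in>UNIV. real ((\<beta> i + 2) * (\<beta> i + 1)) * c (\<beta>(i := \<beta> i + 2))) = 0"
    and R: "hompoly (k - 2) R" and small: "k < 2 \<Longrightarrow> R = (\<lambda>_. 0)"
    and eq: "\<And>y. (\<Sum>\<alpha>\<in>expo k. a \<alpha> / of_real (mfact \<alpha>) * of_real (monomial \<alpha> y)) = of_real (y \<bullet> y) * R y"
  shows "(\<Sum>\<alpha>\<in>expo k. of_real (c \<alpha>) * a \<alpha>) = 0"
proof (cases "k < 2")
  case True
  \<comment> \<open>For k < 2 truncated subtraction makes \<open>k - 2\<close> equal to 0, so
    \<open>R\<close> could be a nonzero constant; \<open>small\<close> rules this out.\<close>
  have "a \<alpha> / of_real (mfact \<alpha>) = 0" if "\<alpha> \<in> expo k" for \<alpha>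
    by (rule hom_poly_coeff_unique[OF _ that]) (use eq small[OF True] in auto)
  thus ?thesis by simp
next
  case False
  define m where "m = k - 2"
  have k: "k = m + 2" using False by (simp add: m_def)
  obtain d where d: "\<And>y. R y = (\<Sum>\<alpha>\<in>expo m. d \<alpha> * of_real (monomial \<alpha> y))"
    using R unfolding hompoly_def m_def by blast
  have "a \<alpha> / of_real (mfact \<alpha>) - radial_coeff d \<alpha> = 0" if "\<alpha> \<in> expo k" for \<alpha>
    by (rule hom_poly_coeff_unique[OF _ that])
       (use eq norm_sq_times_hompoly[OF d] in \<open>auto simp: ring_distribs sum_subtractf k\<close>)
  hence "a \<alpha> = radial_coeff d \<alpha> * of_real (mfact \<alpha>)" if "\<alpha> \<in> expo k" for \<alpha>
    using that by (simp add: field_simps)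
  hence "(\<Sum>\<alpha>\<in>expo k. of_real (c \<alpha>) * a \<alpha>) =
      (\<Sum>\<alpha>\<in>expo (m + 2). radial_coeff d \<alpha> * (of_real (c \<alpha>) * of_real (mfact \<alpha>)))"
    by (intro sum.cong) (auto simp: k)
  also have "\<dots> = (\<Sum>\<beta>\<in>expo m. d \<beta> * of_real (mfact \<beta> *
      (\<Sum>i\<in>UNIV. real ((\<beta> i + 2) * (\<beta> i + 1)) * c (\<beta>(i := \<beta> i + 2)))))"
    unfolding sum_radial_coeff mfact_upd2
    by (intro sum.cong refl) (simp add: sum_distrib_left mult_ac)
  also have "\<dots> = 0"
  proof (intro sum.neutral ballI)
    fix \<beta> :: "'n \<Rightarrow> nat" assume "\<beta> \<in> expo m"
    hence "sum \<beta> UNIV + 2 = k" by (simp add: expo_def k)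
    from harm[OF this] show "d \<beta> * of_real (mfact \<beta> *
      (\<Sum>i\<in>UNIV. real ((\<beta> i + 2) * (\<beta> i + 1)) * c (\<beta>(i := \<beta> i + 2)))) = 0" by simp
  qed
  finally show ?thesis .
qed

subsection \<open>Theta functions with harmonic coefficients\<close>

text \<open>Only real arguments are available, as the parameter scales a real shift vector.
  Convergence at all of them forces an infinite radius, and the zeros on the real line accumulate,
  so the entire sum vanishes.\<close>

lemma powser_real_unique:
  fixes d :: "nat \<Rightarrow> complex"
  assumes "\<And>s::real. (\<lambda>k. d k * of_real s ^ k) sums 0"
  shows "d k = 0"
proof -
  define F where "F = Abs_fps d"
  have "fps_conv_radius F \<ge> ereal r" for r
  proof -
    have "summable (\<lambda>k. fps_nth F k * of_real \<bar>r\<bar> ^ k)"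
      unfolding F_def using assms[of "\<bar>r\<bar>"] by (simp add: sums_iff)
    hence "fps_conv_radius F \<ge> ereal (norm (complex_of_real \<bar>r\<bar>))"
      unfolding fps_conv_radius_def by (intro conv_radius_geI)
    thus ?thesis by (rule order_trans[rotated]) simp
  qed
  hence rad: "fps_conv_radius F = \<infinity>"
    by (simp add: ereal_top top_unique)
  have zero: "eval_fps F (of_real s) = 0" for s :: real
    using assms[of s] by (simp add: eval_fps_def F_def sums_iff)
  have "eval_fps F z = 0" for z
  proof (rule analytic_continuation[of "eval_fps F" UNIV "range complex_of_real" 0])
    show "eval_fps F holomorphic_on UNIV"
      by (rule holomorphic_on_eval_fps) (simp add: rad)
    show "0 islimpt range complex_of_real"
      unfolding islimpt_approachable
    proof (intro allI impI)
      fix e :: real assume "e > 0"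
      hence "complex_of_real (e / 2) \<noteq> 0" "dist (complex_of_real (e / 2)) 0 < e" by auto
      thus "\<exists>x'\<in>range complex_of_real. x' \<noteq> 0 \<and> dist x' 0 < e" by blast
    qed
  qed (auto simp: zero)
  hence "eval_fps F = (\<lambda>_. 0)" by auto
  moreover have "eval_fps F has_fps_expansion F"
    by (rule eval_fps_has_fps_expansion) (simp add: rad)
  ultimately have "F = 0"
    using fps_expansion_unique_complex has_fps_expansion_0 by metis
  thus ?thesis by (simp add: F_def fps_eq_iff)
qed

text \<open>The exponential is expanded and the two sums are interchanged; \<open>summ\<close> is
  precisely the absolute summability of the resulting double family.\<close>

lemma exp_moment_sums:
  fixes w :: "'a \<Rightarrow> real" and z :: "'a \<Rightarrow> complex" and s :: real
  assumes w: "\<And>x. x \<in> X \<Longrightarrow> w x \<ge> 0"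
    and summ: "(\<lambda>x. w x * exp (\<bar>s\<bar> * norm (z x))) summable_on X"
  shows "(\<lambda>k. (\<Sum>\<^sub>\<infinity>x\<in>X. of_real (w x) * z x ^ k) / fact k * of_real s ^ k) sums
           (\<Sum>\<^sub>\<infinity>x\<in>X. of_real (w x) * exp (of_real s * z x))"
proof -
  define f where "f = (\<lambda>(x, k). of_real (w x) * ((of_real s * z x) ^ k / fact k))"
  have norm_f: "norm (f (x, k)) = w x * ((\<bar>s\<bar> * norm (z x)) ^ k / fact k)" if "x \<in> X" for x k
    using w[OF that] by (simp add: f_def norm_mult norm_divide norm_power power_mult_distrib)
  have expr: "(\<lambda>k. a ^ k / fact k) sums exp a" for a :: real
    using exp_converges[of a] by (simp add: field_simps)
  have norm_sum: "((\<lambda>k. norm (f (x, k))) has_sum (w x * exp (\<bar>s\<bar> * norm (z x)))) UNIV" if "x \<in> X" for x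
    unfolding norm_f[OF that]
    using expr[of "\<bar>s\<bar> * norm (z x)"] by (intro has_sum_cmult_right sums_nonneg_imp_has_sum) auto
  have f_sum: "((\<lambda>k. f (x, k)) has_sum (of_real (w x) * exp (of_real s * z x))) UNIV" if "x \<in> X" for x
  proof (rule norm_summable_imp_has_sum)
    show "summable (\<lambda>k. norm (f (x, k)))"
      using norm_sum[OF that] has_sum_imp_sums sums_summable by blast
    have "(\<lambda>k. (of_real s * z x) ^ k / fact k) sums exp (of_real s * z x)"
      using exp_converges[of "of_real s * z x"] by (simp add: scaleR_conv_of_real field_simps)
    thus "(\<lambda>k. f (x, k)) sums (of_real (w x) * exp (of_real s * z x))"
      unfolding f_def split by (rule sums_mult)
  qed
  have "(\<lambda>p. norm (f p)) summable_on (X \<times> UNIV)"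
  proof (rule summable_on_SigmaI)
    fix x assume "x \<in> X"
    thus "((\<lambda>k. norm (f (x, k))) has_sum (w x * exp (\<bar>s\<bar> * norm (z x)))) UNIV" by (rule norm_sum)
  qed (use summ in auto)
  hence "f summable_on (X \<times> UNIV)" by (rule abs_summable_summable)
  then obtain S where S: "(f has_sum S) (X \<times> UNIV)" by (auto simp: summable_on_def)
  have "((\<lambda>x. of_real (w x) * exp (of_real s * z x)) has_sum S) X"
    by (rule has_sum_SigmaD[OF S f_sum])
  hence S_eq: "S = (\<Sum>\<^sub>\<infinity>x\<in>X. of_real (w x) * exp (of_real s * z x))" by (simp add: infsumI)
  have S': "((\<lambda>(k, x). f (x, k)) has_sum S) (UNIV \<times> X)"
    using S by (subst (asm) has_sum_swap)
  have "((\<lambda>k. \<Sum>\<^sub>\<infinity>x\<in>X. f (x, k)) has_sum S) UNIV"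
  proof (rule has_sum_SigmaD[OF S'])
    fix k :: nat
    have "(\<lambda>x. f (x, k)) summable_on X"
      using summable_on_SigmaD1[of "\<lambda>k x. f (x, k)" UNIV "\<lambda>_. X" k] S' has_sum_imp_summable by auto
    thus "((\<lambda>x. (\<lambda>(k, x). f (x, k)) (k, x)) has_sum (\<Sum>\<^sub>\<infinity>x\<in>X. f (x, k))) X" by simp
  qed
  hence "(\<lambda>k. \<Sum>\<^sub>\<infinity>x\<in>X. f (x, k)) sums S" by (rule has_sum_imp_sums)
  also have "(\<lambda>k. \<Sum>\<^sub>\<infinity>x\<in>X. f (x, k)) = (\<lambda>k. (\<Sum>\<^sub>\<infinity>x\<in>X. of_real (w x) * z x ^ k) / fact k * of_real s ^ k)"
  proof
    fix k
    have "(\<Sum>\<^sub>\<infinity>x\<in>X. f (x, k)) = (\<Sum>\<^sub>\<infinity>x\<in>X. (of_real (w x) * z x ^ k) * (of_real s ^ k / fact k))"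
      unfolding f_def by (simp add: power_mult_distrib mult_ac)
    thus "(\<Sum>\<^sub>\<infinity>x\<in>X. f (x, k)) = (\<Sum>\<^sub>\<infinity>x\<in>X. of_real (w x) * z x ^ k) / fact k * of_real s ^ k"
      by (simp only: infsum_cmult_left') simp
  qed
  finally show ?thesis unfolding S_eq .
qed

lemma gaussian_series_even:
  fixes c s :: real
  shows "(\<lambda>k. (if even k then complex_of_real (c ^ (k div 2) / fact (k div 2)) else 0) * of_real s ^ k) sums
           of_real (exp (c * s\<^sup>2))"
proof -
  have "(\<lambda>k. (c * s\<^sup>2) ^ k / fact k) sums exp (c * s\<^sup>2)"
    using exp_converges[of "c * s\<^sup>2"] by (simp add: field_simps)
  hence "(\<lambda>k. complex_of_real ((c * s\<^sup>2) ^ k / fact k)) sums of_real (exp (c * s\<^sup>2))"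
    by (rule sums_of_real)
  also have "(\<lambda>k. complex_of_real ((c * s\<^sup>2) ^ k / fact k)) =
    (\<lambda>k. (\<lambda>k. (if even k then complex_of_real (c ^ (k div 2) / fact (k div 2)) else 0) * of_real s ^ k) (2 * k))"
    by (auto simp: power_mult_distrib power_mult)
  finally show ?thesis
    by (subst (asm) sums_mono_reindex) (auto simp: strict_mono_def elim!: evenE)
qed

lemma abs_power_le_exp_norm: "norm x ^ k \<le> exp (real k * norm x)"
proof -
  have "norm x \<le> exp (norm x)" using exp_ge_add_one_self[of "norm x"] by linarith
  hence "norm x ^ k \<le> exp (norm x) ^ k" by (intro power_mono) auto
  thus ?thesis by (simp add: exp_of_nat_mult)
qed

lemma abs_monomial_le:
  assumes "\<alpha> \<in> expo k"
  shows "\<bar>monomial \<alpha> x\<bar> \<le> norm x ^ k"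
proof -
  have "\<bar>monomial \<alpha> x\<bar> = (\<Prod>i\<in>UNIV. \<bar>x$i\<bar> ^ \<alpha> i)"
    by (simp add: monomial_def abs_prod power_abs)
  also have "\<dots> \<le> (\<Prod>i\<in>UNIV. norm x ^ \<alpha> i)"
    by (intro prod_mono conjI power_mono component_le_norm_cart) auto
  also have "\<dots> = norm x ^ k"
    using assms by (simp add: expo_def power_sum[symmetric])
  finally show ?thesis .
qed

section \<open>Moments of the Gaussian over the lattice\<close>

context selfdual_lattice
begin

text \<open>Half of the exponent -c |x|^2 absorbs the growth exp(D |x|), by completing the
  square.\<close>

lemma gaussian_tilt_summable:
  assumes c: "c > 0" and f: "\<And>x. x \<in> L \<Longrightarrow> \<bar>f x\<bar> \<le> exp (D * norm x)"
  shows "(\<lambda>x. exp (- c * (x \<bullet> x)) * f x) summable_on L"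
proof -
  have "(\<lambda>x. norm (exp (- c * (x \<bullet> x)) * f x)) summable_on L"
  proof (rule summable_on_comparison_test)
    show "(\<lambda>x. exp (D\<^sup>2 / (2 * c)) * exp (- (c / 2) * (x \<bullet> x))) summable_on L"
      using c by (intro summable_on_cmult_right summable_gaussian) auto
    fix x assume x: "x \<in> L"
    have "norm (exp (- c * (x \<bullet> x)) * f x) \<le> exp (- c * (x \<bullet> x)) * exp (D * norm x)"
      using f[OF x] by (simp add: abs_mult)
    also have "\<dots> \<le> exp (D\<^sup>2 / (2 * c)) * exp (- (c / 2) * (x \<bullet> x))"
    proof -
      have "0 \<le> (c / 2) * (norm x - D / c)\<^sup>2" using c by simp
      also have "\<dots> = c / 2 * (x \<bullet> x) - D * norm x + D\<^sup>2 / (2 * c)"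
        using c by (simp add: power2_eq_square field_simps dot_square_norm)
      finally show ?thesis unfolding exp_add[symmetric] by (simp add: algebra_simps)
    qed
    finally show "norm (exp (- c * (x \<bullet> x)) * f x) \<le> exp (D\<^sup>2 / (2 * c)) * exp (- (c / 2) * (x \<bullet> x))" .
  qed auto
  thus ?thesis by (rule abs_summable_summable)
qed

lemma summable_monomial:
  assumes "t > 0" "\<alpha> \<in> expo k"
  shows "(\<lambda>x. exp (- pi * t * (x \<bullet> x)) * monomial \<alpha> x) summable_on L"
proof -
  have "(\<lambda>x. exp (- (pi * t) * (x \<bullet> x)) * monomial \<alpha> x) summable_on L"
    using assms abs_monomial_le[OF assms(2)] abs_power_le_exp_norm
    by (intro gaussian_tilt_summable[where D = "real k"]) (auto intro: order_trans)
  thus ?thesis by simp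
qed

definition moment :: "nat \<Rightarrow> real \<Rightarrow> real^'n \<Rightarrow> complex" where
  "moment k t y = (\<Sum>\<^sub>\<infinity>x\<in>L. of_real (exp (- pi * t * (x \<bullet> x))) * of_real (x \<bullet> y) ^ k)"

definition mono_moment :: "('n \<Rightarrow> nat) \<Rightarrow> real \<Rightarrow> complex" where
  "mono_moment \<alpha> t = (\<Sum>\<^sub>\<infinity>x\<in>L. of_real (exp (- pi * t * (x \<bullet> x)) * monomial \<alpha> x))"

lemma moment_expand:
  assumes t: "t > 0"
  shows "moment k t y / fact k = (\<Sum>\<alpha>\<in>expo k. mono_moment \<alpha> t / of_real (mfact \<alpha>) * of_real (monomial \<alpha> y))"
proof -
  have "((\<lambda>x. \<Sum>\<alpha>\<in>expo k. of_real (exp (- pi * t * (x \<bullet> x)) * monomial \<alpha> x) * (of_real (monomial \<alpha> y) / of_real (mfact \<alpha>) * fact k))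
      has_sum (\<Sum>\<alpha>\<in>expo k. mono_moment \<alpha> t * (of_real (monomial \<alpha> y) / of_real (mfact \<alpha>) * fact k))) L"
    unfolding mono_moment_def using summable_monomial[OF t]
    by (intro has_sum_finite_sum has_sum_cmult_left has_sum_infsum summable_on_of_real)
  also have "(\<lambda>x. \<Sum>\<alpha>\<in>expo k. of_real (exp (- pi * t * (x \<bullet> x)) * monomial \<alpha> x) * (of_real (monomial \<alpha> y) / of_real (mfact \<alpha>) * fact k)) =
      (\<lambda>x. of_real (exp (- pi * t * (x \<bullet> x))) * complex_of_real (x \<bullet> y) ^ k)"
  proof
    fix x :: "real^'n"
    have "complex_of_real (x \<bullet> y) ^ k = complex_of_real (fact k * ((x \<bullet> y) ^ k / fact k))" by simp
    also have "\<dots> = (\<Sum>\<alpha>\<in>expo k. complex_of_real (monomial \<alpha> x) * (of_real (monomial \<alpha> y) / of_real (mfact \<alpha>) * fact k))"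
      unfolding inner_power_expand sum_distrib_left of_real_sum by (simp add: mult_ac)
    finally show "(\<Sum>\<alpha>\<in>expo k. of_real (exp (- pi * t * (x \<bullet> x)) * monomial \<alpha> x) * (of_real (monomial \<alpha> y) / of_real (mfact \<alpha>) * fact k)) =
      of_real (exp (- pi * t * (x \<bullet> x))) * complex_of_real (x \<bullet> y) ^ k"
      by (simp add: sum_distrib_left mult_ac)
  qed
  finally have "moment k t y = (\<Sum>\<alpha>\<in>expo k. mono_moment \<alpha> t * (of_real (monomial \<alpha> y) / of_real (mfact \<alpha>) * fact k))"
    unfolding moment_def by (rule infsumI)
  thus ?thesis by (simp add: sum_divide_distrib)
qed

lemma hompoly_moment: "t > 0 \<Longrightarrow> hompoly k (moment k t)"
proof -
  assume t: "t > 0"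
  have "hompoly k (\<lambda>y. moment k t y / fact k)"
    unfolding hompoly_def moment_expand[OF t]
    by (intro exI[of _ "\<lambda>\<alpha>. mono_moment \<alpha> t / of_real (mfact \<alpha>)"]) simp
  from hompoly_cmult[OF this, of "fact k"] show ?thesis by simp
qed

lemma moment_sums:
  fixes c :: complex
  assumes t: "t > 0"
  shows "(\<lambda>k. c ^ k * moment k t y / fact k * of_real s ^ k) sums
         (\<Sum>\<^sub>\<infinity>x\<in>L. of_real (exp (- pi * t * (x \<bullet> x))) * exp (of_real s * (c * of_real (x \<bullet> y))))"
proof -
  have "(\<lambda>x. exp (- (pi * t) * (x \<bullet> x)) * exp (\<bar>s\<bar> * norm (c * of_real (x \<bullet> y)))) summable_on L"
  proof (rule gaussian_tilt_summable[where D = "\<bar>s\<bar> * norm c * norm y"])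
    fix x :: "real^'n"
    have "\<bar>s\<bar> * norm c * \<bar>x \<bullet> y\<bar> \<le> \<bar>s\<bar> * norm c * (norm x * norm y)"
      by (intro mult_left_mono Cauchy_Schwarz_ineq2) auto
    thus "\<bar>exp (\<bar>s\<bar> * norm (c * of_real (x \<bullet> y)))\<bar> \<le> exp (\<bar>s\<bar> * norm c * norm y * norm x)"
      by (simp add: norm_mult mult_ac)
  qed (use t in simp)
  hence "(\<lambda>k. (\<Sum>\<^sub>\<infinity>x\<in>L. of_real (exp (- pi * t * (x \<bullet> x))) * (c * of_real (x \<bullet> y)) ^ k) / fact k * of_real s ^ k) sums
         (\<Sum>\<^sub>\<infinity>x\<in>L. of_real (exp (- pi * t * (x \<bullet> x))) * exp (of_real s * (c * of_real (x \<bullet> y))))"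
    by (intro exp_moment_sums) simp_all
  moreover have "(\<Sum>\<^sub>\<infinity>x\<in>L. of_real (exp (- pi * t * (x \<bullet> x))) * (c * of_real (x \<bullet> y)) ^ k) = c ^ k * moment k t y" for k
  proof -
    have "(\<Sum>\<^sub>\<infinity>x\<in>L. of_real (exp (- pi * t * (x \<bullet> x))) * (c * of_real (x \<bullet> y)) ^ k) =
        (\<Sum>\<^sub>\<infinity>x\<in>L. c ^ k * (of_real (exp (- pi * t * (x \<bullet> x))) * of_real (x \<bullet> y) ^ k))"
      by (intro infsum_cong) (simp add: power_mult_distrib)
    thus ?thesis unfolding moment_def by (simp only: infsum_cmult_right')
  qed
  ultimately show ?thesis by simp
qed

text \<open>Poisson summation for the shift \<open>s *\<^sub>R y\<close>. The norm of x + s y splits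
  into |x|^2, 2 s (x . y) and s^2 |y|^2; the factor from the last part is moved to the other side,
  where it becomes the even power series, and the coefficients of s^k are compared.\<close>

lemma moment_identity:
  assumes t: "t > 0"
  shows "(of_real (- 2 * pi * t)) ^ k * moment k t y / fact k =
    of_real (1 / sqrt t ^ CARD('n)) * (\<Sum>i\<le>k.
      (if even i then of_real ((pi * t * (y \<bullet> y)) ^ (i div 2) / fact (i div 2)) else 0) *
      ((2 * of_real pi * \<i>) ^ (k - i) * moment (k - i) (1 / t) y / fact (k - i)))"
proof -
  define \<kappa> where "\<kappa> = complex_of_real (1 / sqrt t ^ CARD('n))"
  define a where "a = (\<lambda>k. (complex_of_real (- 2 * pi * t)) ^ k * moment k t y / fact k)"
  define b where "b = (\<lambda>k. (2 * of_real pi * \<i>) ^ k * moment k (1 / t) y / fact k)"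
  define e where "e = (\<lambda>i. if even i then complex_of_real ((pi * t * (y \<bullet> y)) ^ (i div 2) / fact (i div 2)) else 0)"
  define A :: "real \<Rightarrow> complex" where "A = (\<lambda>s. \<Sum>\<^sub>\<infinity>x\<in>L. of_real (exp (- pi * t * (x \<bullet> x))) * exp (of_real s * (of_real (- 2 * pi * t) * of_real (x \<bullet> y))))"
  define B :: "real \<Rightarrow> complex" where "B = (\<lambda>s. \<Sum>\<^sub>\<infinity>x\<in>L. of_real (exp (- pi * (1 / t) * (x \<bullet> x))) * exp (of_real s * ((2 * of_real pi * \<i>) * of_real (x \<bullet> y))))"
  have a: "(\<lambda>k. a k * of_real s ^ k) sums A s" for s :: real
    unfolding a_def A_def by (rule moment_sums[OF t])
  have b: "(\<lambda>k. b k * of_real s ^ k) sums B s" for s :: real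
    unfolding b_def B_def using t by (intro moment_sums) simp
  have e: "(\<lambda>k. e k * of_real s ^ k) sums of_real (exp (pi * t * (y \<bullet> y) * s\<^sup>2))" for s :: real
    unfolding e_def by (rule gaussian_series_even)
  have rel: "A s = \<kappa> * (of_real (exp (pi * t * (y \<bullet> y) * s\<^sup>2)) * B s)" for s :: real
  proof -
    define u where "u = exp (- (pi * t * (y \<bullet> y) * s\<^sup>2))"
    have "(\<Sum>\<^sub>\<infinity>x\<in>L. complex_of_real (exp (- pi * t * ((x + s *\<^sub>R y) \<bullet> (x + s *\<^sub>R y))))) =
        (\<Sum>\<^sub>\<infinity>x\<in>L. of_real u * (of_real (exp (- pi * t * (x \<bullet> x))) * exp (of_real s * (of_real (- 2 * pi * t) * of_real (x \<bullet> y)))))"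
    proof (rule infsum_cong)
      fix x :: "real^'n"
      have "exp (- pi * t * ((x + s *\<^sub>R y) \<bullet> (x + s *\<^sub>R y))) = u * (exp (- pi * t * (x \<bullet> x)) * exp (s * (- 2 * pi * t * (x \<bullet> y))))"
        unfolding u_def exp_add[symmetric]
        by (simp add: inner_add_left inner_add_right inner_commute algebra_simps power2_eq_square)
      thus "complex_of_real (exp (- pi * t * ((x + s *\<^sub>R y) \<bullet> (x + s *\<^sub>R y)))) =
         of_real u * (of_real (exp (- pi * t * (x \<bullet> x))) * exp (of_real s * (of_real (- 2 * pi * t) * of_real (x \<bullet> y))))"
        by (simp only: of_real_mult exp_of_real[symmetric])
    qed
    also have "\<dots> = of_real u * A s" unfolding A_def by (rule infsum_cmult_right')
    finally have "of_real u * A s = \<kappa> * (\<Sum>\<^sub>\<infinity>x\<in>L. of_real (exp (- pi * (x \<bullet> x) / t)) * cis (2 * pi * (x \<bullet> (s *\<^sub>R y))))"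
      unfolding \<kappa>_def using poisson_summation[OF t, of "s *\<^sub>R y"] by simp
    also have "(\<Sum>\<^sub>\<infinity>x\<in>L. of_real (exp (- pi * (x \<bullet> x) / t)) * cis (2 * pi * (x \<bullet> (s *\<^sub>R y)))) = B s"
      unfolding B_def by (intro infsum_cong) (simp add: cis_conv_exp mult_ac)
    finally have *: "of_real (exp (pi * t * (y \<bullet> y) * s\<^sup>2) * u) * A s = of_real (exp (pi * t * (y \<bullet> y) * s\<^sup>2)) * (\<kappa> * B s)"
      by simp
    have "exp (pi * t * (y \<bullet> y) * s\<^sup>2) * u = 1"
      unfolding u_def exp_add[symmetric] by simp
    from *[unfolded this] show ?thesis by (simp only: of_real_1 mult_1 mult.left_commute)
  qed
  \<comment> \<open>Absolute convergence at s follows from convergence at the larger real point |s|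
    + 1.\<close>
  have abs_conv: "summable (\<lambda>k. norm (f k * of_real s ^ k))"
    if "\<And>s::real. (\<lambda>k. f k * of_real s ^ k) sums g s" for f :: "nat \<Rightarrow> complex" and g and s :: real
  proof (rule powser_insidea)
    show "summable (\<lambda>k. f k * complex_of_real (\<bar>s\<bar> + 1) ^ k)"
      using that[of "\<bar>s\<bar> + 1"] by (rule sums_summable)
    show "norm (complex_of_real s) < norm (complex_of_real (\<bar>s\<bar> + 1))" by (simp del: of_real_add)
  qed
  have "(\<lambda>k. (a k - \<kappa> * (\<Sum>i\<le>k. e i * b (k - i))) * of_real s ^ k) sums 0" for s :: real
  proof -
    have "(\<lambda>k. \<Sum>i\<le>k. (e i * of_real s ^ i) * (b (k - i) * of_real s ^ (k - i))) sums
        ((\<Sum>k. e k * of_real s ^ k) * (\<Sum>k. b k * of_real s ^ k))"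
      by (rule Cauchy_product_sums[OF abs_conv[OF e] abs_conv[OF b]])
    also have "(\<lambda>k. \<Sum>i\<le>k. (e i * of_real s ^ i) * (b (k - i) * of_real s ^ (k - i))) =
        (\<lambda>k. (\<Sum>i\<le>k. e i * b (k - i)) * of_real s ^ k)"
    proof
      fix k
      have shift: "(e i * of_real s ^ i) * (b (k - i) * of_real s ^ (k - i)) = e i * b (k - i) * of_real s ^ k" if "i \<le> k" for i
      proof -
        have "complex_of_real s ^ k = of_real s ^ i * of_real s ^ (k - i)"
          using that by (simp add: power_add[symmetric])
        thus ?thesis by simp
      qed
      show "(\<Sum>i\<le>k. (e i * of_real s ^ i) * (b (k - i) * of_real s ^ (k - i))) = (\<Sum>i\<le>k. e i * b (k - i)) * of_real s ^ k"
        unfolding sum_distrib_right by (rule sum.cong[OF refl shift]) simp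
    qed
    also have "(\<Sum>k. e k * of_real s ^ k) * (\<Sum>k. b k * of_real s ^ k) = of_real (exp (pi * t * (y \<bullet> y) * s\<^sup>2)) * B s"
      using e[of s] b[of s] by (simp add: sums_iff)
    finally have "(\<lambda>k. \<kappa> * ((\<Sum>i\<le>k. e i * b (k - i)) * of_real s ^ k)) sums A s"
      unfolding rel by (rule sums_mult)
    from sums_diff[OF a[of s] this] show ?thesis by (simp add: ring_distribs mult.assoc)
  qed
  hence "a k - \<kappa> * (\<Sum>i\<le>k. e i * b (k - i)) = 0" by (rule powser_real_unique)
  thus ?thesis by (simp add: a_def b_def e_def \<kappa>_def)
qed

section \<open>Theta functions of harmonic polynomials and their inversion\<close>

definition theta :: "(real^'n \<Rightarrow> real) \<Rightarrow> real \<Rightarrow> real" where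
  "theta P t = (\<Sum>\<^sub>\<infinity>x\<in>L. exp (- pi * t * (x \<bullet> x)) * P x)"

lemma hom_poly_theta:
  assumes t: "t > 0" and P: "P = (\<lambda>x. \<Sum>\<alpha>\<in>expo k. c \<alpha> * monomial \<alpha> x)"
  shows "((\<lambda>x. exp (- pi * t * (x \<bullet> x)) * P x) has_sum theta P t) L"
    and "(\<Sum>\<alpha>\<in>expo k. of_real (c \<alpha>) * mono_moment \<alpha> t) = of_real (theta P t)"
proof -
  define s where "s = (\<lambda>\<alpha>. \<Sum>\<^sub>\<infinity>x\<in>L. exp (- pi * t * (x \<bullet> x)) * monomial \<alpha> x)"
  have "((\<lambda>x. \<Sum>\<alpha>\<in>expo k. c \<alpha> * (exp (- pi * t * (x \<bullet> x)) * monomial \<alpha> x)) has_sum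
      (\<Sum>\<alpha>\<in>expo k. c \<alpha> * s \<alpha>)) L"
    unfolding s_def by (intro has_sum_finite_sum has_sum_cmult_right has_sum_infsum summable_monomial t)
  hence "((\<lambda>x. exp (- pi * t * (x \<bullet> x)) * P x) has_sum (\<Sum>\<alpha>\<in>expo k. c \<alpha> * s \<alpha>)) L"
    by (simp add: P sum_distrib_left mult_ac)
  moreover from infsumI[OF this] have eq: "theta P t = (\<Sum>\<alpha>\<in>expo k. c \<alpha> * s \<alpha>)"
    by (simp add: theta_def)
  ultimately show "((\<lambda>x. exp (- pi * t * (x \<bullet> x)) * P x) has_sum theta P t) L" by simp
  have "mono_moment \<alpha> t = of_real (s \<alpha>)" if "\<alpha> \<in> expo k" for \<alpha>
    unfolding mono_moment_def s_def by (intro infsum_complex_of_real summable_monomial[OF t that])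
  thus "(\<Sum>\<alpha>\<in>expo k. of_real (c \<alpha>) * mono_moment \<alpha> t) = of_real (theta P t)"
    by (simp add: eq)
qed

text \<open>In \<open>moment_identity\<close> the terms with i >= 2 are divisible by |y|^2; together
  they form |y|^2 \<open>R\<close> and are annihilated by the pairing with the coefficients of P.
  The remaining term i = 0 compares (-2 pi t)^k with (2 pi i)^k, whose quotient is (i t)^k.\<close>

theorem theta_transformation:
  assumes t: "t > 0" and P: "hom_harmonic_poly k P"
  shows "complex_of_real (theta P (1 / t)) = \<i> ^ k * of_real (t ^ k * sqrt t ^ CARD('n) * theta P t)"
proof -
  from P obtain c where c: "P = (\<lambda>x. \<Sum>\<alpha>\<in>expo k. c \<alpha> * monomial \<alpha> x)"
    and harm: "\<And>\<beta>::'n \<Rightarrow> nat. sum \<beta> UNIV + 2 = k \<Longrightarrow>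
      (\<Sum>i\<in>UNIV. real ((\<beta> i + 2) * (\<beta> i + 1)) * c (\<beta>(i := \<beta> i + 2))) = 0"
    unfolding hom_harmonic_poly_def expo_def monomial_def by blast
  define \<kappa> where "\<kappa> = complex_of_real (1 / sqrt t ^ CARD('n))"
  define b where "b = (\<lambda>k y. (2 * of_real pi * \<i>) ^ k * moment k (1 / t) y / fact k)"
  define a where "a = (\<lambda>\<alpha>. of_real (- 2 * pi * t) ^ k * mono_moment \<alpha> t -
      \<kappa> * (2 * of_real pi * \<i>) ^ k * mono_moment \<alpha> (1 / t))"
  define R where "R = (\<lambda>y. \<Sum>i=2..k. if even i then \<kappa> * of_real ((pi * t) ^ (i div 2) / fact (i div 2)) *
      (of_real (y \<bullet> y) ^ ((i - 2) div 2) * b (k - i) y) else 0)"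
  have t': "1 / t > 0" using t by simp
  have "(\<Sum>\<alpha>\<in>expo k. of_real (c \<alpha>) * a \<alpha>) = 0"
  proof (rule harmonic_pairing[OF harm])
    show "hompoly (k - 2) R"
      unfolding R_def
    proof (rule hompoly_sum)
      fix i assume i: "i \<in> {2..k}"
      show "hompoly (k - 2) (\<lambda>y. if even i then \<kappa> * of_real ((pi * t) ^ (i div 2) / fact (i div 2)) *
          (of_real (y \<bullet> y) ^ ((i - 2) div 2) * b (k - i) y) else 0)"
      proof (cases "even i")
        case True
        have deg: "k - i + 2 * ((i - 2) div 2) = k - 2" using i True by (auto elim!: evenE)
        have "hompoly (k - i) (\<lambda>y. (2 * of_real pi * \<i>) ^ (k - i) / fact (k - i) * moment (k - i) (1 / t) y)"
          by (intro hompoly_cmult hompoly_moment t')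
        hence "hompoly (k - i) (b (k - i))" by (simp add: b_def)
        from hompoly_norm_sq_power[OF this, of "(i - 2) div 2"] show ?thesis
          using True unfolding deg by (simp only: if_True hompoly_cmult)
      qed (simp add: hompoly_0)
    qed
    show "R = (\<lambda>_. 0)" if "k < 2" using that by (simp add: R_def)
    fix y :: "real^'n"
    have "(\<Sum>\<alpha>\<in>expo k. a \<alpha> / of_real (mfact \<alpha>) * of_real (monomial \<alpha> y)) =
        of_real (- 2 * pi * t) ^ k * (\<Sum>\<alpha>\<in>expo k. mono_moment \<alpha> t / of_real (mfact \<alpha>) * of_real (monomial \<alpha> y)) -
        \<kappa> * ((2 * of_real pi * \<i>) ^ k * (\<Sum>\<alpha>\<in>expo k. mono_moment \<alpha> (1 / t) / of_real (mfact \<alpha>) * of_real (monomial \<alpha> y)))"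
      by (simp add: a_def sum_distrib_left sum_subtractf ring_distribs diff_divide_distrib mult_ac)
    also have "\<dots> = of_real (- 2 * pi * t) ^ k * moment k t y / fact k - \<kappa> * b k y"
      unfolding moment_expand[OF t, symmetric] moment_expand[OF t', symmetric] b_def by simp
    also have "of_real (- 2 * pi * t) ^ k * moment k t y / fact k = \<kappa> * (\<Sum>i\<le>k.
      (if even i then of_real ((pi * t * (y \<bullet> y)) ^ (i div 2) / fact (i div 2)) else 0) * b (k - i) y)"
      unfolding moment_identity[OF t] \<kappa>_def b_def ..
    also have "(\<Sum>i\<le>k. (if even i then of_real ((pi * t * (y \<bullet> y)) ^ (i div 2) / fact (i div 2)) else 0) * b (k - i) y) =
        b k y + (\<Sum>i=2..k. (if even i then of_real ((pi * t * (y \<bullet> y)) ^ (i div 2) / fact (i div 2)) else 0) * b (k - i) y)"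
    proof -
      have "(\<Sum>i\<le>k. (if even i then of_real ((pi * t * (y \<bullet> y)) ^ (i div 2) / fact (i div 2)) else 0) * b (k - i) y) =
         (\<Sum>i\<in>insert 0 {2..k}. (if even i then of_real ((pi * t * (y \<bullet> y)) ^ (i div 2) / fact (i div 2)) else 0) * b (k - i) y)"
        by (rule sum.mono_neutral_right) (auto simp: not_le less_Suc_eq numeral_2_eq_2)
      thus ?thesis by simp
    qed
    finally have "(\<Sum>\<alpha>\<in>expo k. a \<alpha> / of_real (mfact \<alpha>) * of_real (monomial \<alpha> y)) =
      \<kappa> * (\<Sum>i=2..k. (if even i then of_real ((pi * t * (y \<bullet> y)) ^ (i div 2) / fact (i div 2)) else 0) * b (k - i) y)"
      by (simp add: ring_distribs)
    also have "\<dots> = of_real (y \<bullet> y) * R y"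
      unfolding R_def sum_distrib_left
    proof (rule sum.cong[OF refl])
      fix i assume i: "i \<in> {2..k}"
      show "\<kappa> * ((if even i then of_real ((pi * t * (y \<bullet> y)) ^ (i div 2) / fact (i div 2)) else 0) * b (k - i) y) =
        of_real (y \<bullet> y) * (if even i then \<kappa> * of_real ((pi * t) ^ (i div 2) / fact (i div 2)) *
          (of_real (y \<bullet> y) ^ ((i - 2) div 2) * b (k - i) y) else 0)"
      proof (cases "even i")
        case True
        then obtain j where j: "i = 2 * Suc j" using i by (cases "i div 2") (auto elim!: evenE)
        show ?thesis by (simp add: j power_mult_distrib)
      qed simp
    qed
    finally show "(\<Sum>\<alpha>\<in>expo k. a \<alpha> / of_real (mfact \<alpha>) * of_real (monomial \<alpha> y)) = of_real (y \<bullet> y) * R y" .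
  qed
  moreover have "(\<Sum>\<alpha>\<in>expo k. of_real (c \<alpha>) * a \<alpha>) =
      of_real (- 2 * pi * t) ^ k * (\<Sum>\<alpha>\<in>expo k. of_real (c \<alpha>) * mono_moment \<alpha> t) -
      \<kappa> * (2 * of_real pi * \<i>) ^ k * (\<Sum>\<alpha>\<in>expo k. of_real (c \<alpha>) * mono_moment \<alpha> (1 / t))"
    by (simp add: a_def sum_distrib_left sum_distrib_right sum_subtractf ring_distribs mult_ac)
  ultimately have "\<kappa> * (2 * of_real pi * \<i>) ^ k * of_real (theta P (1 / t)) = of_real (- 2 * pi * t) ^ k * of_real (theta P t)"
    unfolding hom_poly_theta(2)[OF t c] hom_poly_theta(2)[OF t' c] by simp
  also have "complex_of_real (- 2 * pi * t) = 2 * of_real pi * \<i> * (\<i> * of_real t)" by simp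
  finally have "\<kappa> * of_real (theta P (1 / t)) = (\<i> * of_real t) ^ k * of_real (theta P t)"
    unfolding power_mult_distrib by simp
  thus ?thesis using t by (simp add: \<kappa>_def power_mult_distrib field_simps)
qed

end

subsection \<open>The eta function on the imaginary axis\<close>

text \<open>Gaussian binomial coefficients through their Pascal rule, which avoids division by
  factors that could vanish.\<close>

fun gauss_binomial :: "real \<Rightarrow> nat \<Rightarrow> nat \<Rightarrow> real" where
  "gauss_binomial Q M 0 = 1"
| "gauss_binomial Q 0 (Suc j) = 0"
| "gauss_binomial Q (Suc M) (Suc j) = gauss_binomial Q M (Suc j) + Q ^ (M - j) * gauss_binomial Q M j"

lemma gauss_binomial_eq_0: "M < j \<Longrightarrow> gauss_binomial Q M j = 0"
  by (induction Q M j rule: gauss_binomial.induct) auto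

lemma gauss_binomial_self: "gauss_binomial Q M M = 1"
  by (induction M) (auto simp: gauss_binomial_eq_0)

lemma q_binomial_theorem:
  "(\<Prod>j<M. 1 - x * Q ^ j) = (\<Sum>j\<le>M. (- x) ^ j * Q ^ (j choose 2) * gauss_binomial Q M j)"
proof (induction M)
  case (Suc M)
  define a where "a = (\<lambda>M j. (- x) ^ j * Q ^ (j choose 2) * gauss_binomial Q M j)"
  have step: "a (Suc M) (Suc j) = a M (Suc j) - x * Q ^ M * a M j" if "j \<le> M" for j
  proof -
    have "Suc j choose 2 = (j choose 2) + j"
      by (simp add: numeral_2_eq_2)
    moreover have "Q ^ M = Q ^ (M - j) * Q ^ j" using that by (simp add: power_add[symmetric])
    ultimately show ?thesis by (simp add: a_def algebra_simps power_add)
  qed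
  have "(\<Sum>j\<le>Suc M. a (Suc M) j) = a (Suc M) 0 + (\<Sum>j\<le>M. a (Suc M) (Suc j))"
    by (rule sum.atMost_Suc_shift)
  also have "(\<Sum>j\<le>M. a (Suc M) (Suc j)) = (\<Sum>j\<le>M. a M (Suc j)) - x * Q ^ M * (\<Sum>j\<le>M. a M j)"
    by (simp add: step sum_subtractf sum_distrib_left)
  also have "a (Suc M) 0 = a M 0" by (simp add: a_def)
  also have "a M 0 + ((\<Sum>j\<le>M. a M (Suc j)) - x * Q ^ M * (\<Sum>j\<le>M. a M j)) =
      (\<Sum>j\<le>Suc M. a M j) - x * Q ^ M * (\<Sum>j\<le>M. a M j)"
    by (subst sum.atMost_Suc_shift) simp
  also have "(\<Sum>j\<le>Suc M. a M j) = (\<Sum>j\<le>M. a M j)"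
    by (simp add: a_def gauss_binomial_eq_0)
  also have "(\<Sum>j\<le>M. a M j) - x * Q ^ M * (\<Sum>j\<le>M. a M j) = (\<Prod>j<Suc M. 1 - x * Q ^ j)"
    using Suc by (simp add: a_def algebra_simps)
  finally show ?case by (simp add: a_def)
qed (simp add: numeral_2_eq_2)

text \<open>The Pochhammer symbol (Q;Q)_n, without the powers of 1 - Q of the usual q-factorial; its
  limit is Euler's product.\<close>

definition qfact :: "real \<Rightarrow> nat \<Rightarrow> real" where
  "qfact Q n = (\<Prod>k<n. 1 - Q ^ Suc k)"

lemma qfact_Suc: "qfact Q (Suc n) = qfact Q n * (1 - Q ^ Suc n)"
  by (simp add: qfact_def)

lemma gauss_binomial_closed_form:
  "j \<le> M \<Longrightarrow> gauss_binomial Q M j * (qfact Q j * qfact Q (M - j)) = qfact Q M"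
proof (induction Q M j rule: gauss_binomial.induct)
  case (3 Q M j)
  show ?case
  proof (cases "j = M")
    case True
    thus ?thesis unfolding True gauss_binomial_self by (simp add: qfact_def)
  next
    case False
    hence j: "Suc j \<le> M" using 3 by simp
    have M: "M - j = Suc (M - Suc j)" using j by simp
    have e: "Q ^ Suc M = Q ^ (M - j) * Q ^ Suc j" using j by (simp add: power_add[symmetric])
    have "gauss_binomial Q (Suc M) (Suc j) * (qfact Q (Suc j) * qfact Q (Suc M - Suc j)) =
        (gauss_binomial Q M (Suc j) * (qfact Q (Suc j) * qfact Q (M - Suc j))) * (1 - Q ^ (M - j)) +
        Q ^ (M - j) * (1 - Q ^ Suc j) * (gauss_binomial Q M j * (qfact Q j * qfact Q (M - j)))"
      unfolding diff_Suc_Suc gauss_binomial.simps M qfact_Suc by (simp add: algebra_simps)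
    also have "\<dots> = qfact Q M * (1 - Q ^ (M - j)) + Q ^ (M - j) * (1 - Q ^ Suc j) * qfact Q M"
      using 3 j by simp
    also have "\<dots> = qfact Q M * (1 - Q ^ (M - j) * Q ^ Suc j)" by (simp add: algebra_simps)
    also have "\<dots> = qfact Q (Suc M)" unfolding e[symmetric] qfact_Suc ..
    finally show ?thesis .
  qed
qed (auto simp: qfact_def)

text \<open>The \<open>q\<close>-binomial theorem with \<open>Q = q\<^sup>3\<close>, \<open>M = 2N\<close> and \<open>x = q\<^sup>2\<^sup>-\<^sup>3\<^sup>N\<close>, where \<open>q = e\<^sup>-\<^sup>a\<close>.\<close>
lemma finite_pentagonal:
  fixes a :: real
  defines "q \<equiv> exp (- a)"
  shows "(\<Sum>n=-int N..int N. (if even n then 1 else - 1) * exp (- a * (of_int (3 * n\<^sup>2 + n) / 2)) *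
            gauss_binomial (q ^ 3) (2 * N) (nat (int N + n))) =
         (\<Prod>i<N. (1 - q ^ (3 * i + 1)) * (1 - q ^ (3 * i + 2)))"
proof -
  define x where "x = exp (- a * (2 - 3 * real N))"
  \<comment> \<open>The factors with j < N are 1 - q^-(3 i + 1) for i = N - 1 - j; turning them into
    1 - q^(3 i + 1) costs this constant, whose exponent is a times the sum of the 3 i + 1 over i <
    N.\<close>
  define C where "C = (- 1) ^ N * exp (- a * (real N / 2 - 3 * (real N)\<^sup>2 / 2))"
  have C: "C \<noteq> 0" by (simp add: C_def)
  have qpow: "q ^ k = exp (- a * real k)" for k
    by (simp add: q_def exp_of_nat_mult[symmetric] mult_ac)
  have Q3: "(q ^ 3) ^ j = exp (- a * (3 * real j))" for j
    using qpow[of "3 * j"] by (simp add: power_mult)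
  have lhs: "(\<Prod>j<2 * N. 1 - x * (q ^ 3) ^ j) = C * (\<Prod>i<N. (1 - q ^ (3 * i + 1)) * (1 - q ^ (3 * i + 2)))"
  proof -
    have "(\<Prod>j<2 * N. 1 - x * (q ^ 3) ^ j) = (\<Prod>j<N. 1 - x * (q ^ 3) ^ j) * (\<Prod>j=N..<2 * N. 1 - x * (q ^ 3) ^ j)"
      by (subst prod.union_disjoint[symmetric]) (auto intro!: prod.cong)
    also have "(\<Prod>j=N..<2 * N. 1 - x * (q ^ 3) ^ j) = (\<Prod>i<N. 1 - q ^ (3 * i + 2))"
    proof (rule prod.reindex_bij_witness[of _ "\<lambda>i. i + N" "\<lambda>j. j - N"])
      fix j assume "j \<in> {N..<2 * N}"
      thus "1 - q ^ (3 * (j - N) + 2) = 1 - x * (q ^ 3) ^ j"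
        unfolding Q3 unfolding qpow x_def exp_add[symmetric]
        by (simp add: of_nat_diff algebra_simps)
    qed auto
    also have "(\<Prod>j<N. 1 - x * (q ^ 3) ^ j) = (\<Prod>i<N. - exp (a * (3 * real i + 1)) * (1 - q ^ (3 * i + 1)))"
    proof (rule prod.reindex_bij_witness[of _ "\<lambda>i. N - 1 - i" "\<lambda>j. N - 1 - j"])
      fix j assume j: "j \<in> {..<N}"
      define m where "m = N - 1 - j"
      have m: "real m = real N - 1 - real j" using j by (simp add: m_def of_nat_diff)
      have "exp (a * (3 * real m + 1)) * q ^ (3 * m + 1) = 1"
        unfolding qpow exp_add[symmetric] by (simp add: algebra_simps)
      moreover have "exp (a * (3 * real m + 1)) = x * (q ^ 3) ^ j"
        unfolding Q3 unfolding x_def exp_add[symmetric] m by (simp add: algebra_simps)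
      ultimately show "- exp (a * (3 * real (N - 1 - j) + 1)) * (1 - q ^ (3 * (N - 1 - j) + 1)) = 1 - x * (q ^ 3) ^ j"
        unfolding m_def[symmetric] by (simp only: right_diff_distrib mult_minus_left mult_1_right)
    qed auto
    also have "\<dots> = (\<Prod>i<N. - exp (a * (3 * real i + 1))) * (\<Prod>i<N. 1 - q ^ (3 * i + 1))"
      by (rule prod.distrib)
    also have "(\<Prod>i<N. - exp (a * (3 * real i + 1))) = C"
    proof -
      have "(\<Prod>i<n. - exp (a * (3 * real i + 1))) = (- 1) ^ n * exp (- a * (real n / 2 - 3 * (real n)\<^sup>2 / 2))" for n
      proof (induction n)
        case (Suc n)
        have eq: "- a * (real (Suc n) / 2 - 3 * (real (Suc n))\<^sup>2 / 2) =
            - a * (real n / 2 - 3 * (real n)\<^sup>2 / 2) + a * (3 * real n + 1)"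
          by (simp add: power2_eq_square field_simps)
        show ?case unfolding eq exp_add prod.lessThan_Suc Suc.IH by simp
      qed simp
      thus ?thesis by (simp add: C_def)
    qed
    finally show ?thesis by (simp add: prod.distrib)
  qed
  have rhs: "(\<Sum>j\<le>2 * N. (- x) ^ j * (q ^ 3) ^ (j choose 2) * gauss_binomial (q ^ 3) (2 * N) j) =
      C * (\<Sum>n=-int N..int N. (if even n then 1 else - 1) * exp (- a * (of_int (3 * n\<^sup>2 + n) / 2)) *
            gauss_binomial (q ^ 3) (2 * N) (nat (int N + n)))"
    unfolding sum_distrib_left
  proof (rule sum.reindex_bij_witness[of _ "\<lambda>n. nat (int N + n)" "\<lambda>j. int j - int N"])
    fix j assume j: "j \<in> {..2 * N}"
    define n where "n = int j - int N"
    have jn: "real j = real N + of_int n" by (simp add: n_def)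
    have ch: "real (j choose 2) = real j * (real j - 1) / 2"
      by (induction j) (simp_all add: numeral_2_eq_2 field_simps)
    have x: "x ^ j = exp (real j * (- a * (2 - 3 * real N)))"
      by (simp only: x_def exp_of_nat_mult)
    have sgn: "(- 1 :: real) ^ j = (- 1) ^ N * (if even n then 1 else - 1)"
    proof (cases "even n")
      case True
      hence "even j = even N" by (simp add: n_def)
      thus ?thesis using True by (simp add: minus_one_power_iff)
    next
      case False
      hence "even j \<noteq> even N" by (auto simp: n_def)
      thus ?thesis using False by (auto simp: minus_one_power_iff)
    qed
    have "x ^ j * (q ^ 3) ^ (j choose 2) = exp (real j * (- a * (2 - 3 * real N)) + - a * (3 * real (j choose 2)))"
      unfolding Q3 x exp_add by simp
    also have "real j * (- a * (2 - 3 * real N)) + - a * (3 * real (j choose 2)) =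
        - a * (real N / 2 - 3 * (real N)\<^sup>2 / 2) + - a * (of_int (3 * n\<^sup>2 + n) / 2)"
      unfolding ch jn by (simp add: power2_eq_square field_simps)
    finally have "x ^ j * (q ^ 3) ^ (j choose 2) = exp (- a * (real N / 2 - 3 * (real N)\<^sup>2 / 2)) * exp (- a * (of_int (3 * n\<^sup>2 + n) / 2))"
      unfolding exp_add .
    hence "(- x) ^ j * (q ^ 3) ^ (j choose 2) = C * ((if even n then 1 else - 1) * exp (- a * (of_int (3 * n\<^sup>2 + n) / 2)))"
      unfolding C_def power_minus[of x] sgn by (simp add: mult_ac)
    moreover have "nat (int N + n) = j" by (simp add: n_def)
    ultimately show "C * ((if even (int j - int N) then 1 else - 1) * exp (- a * (of_int (3 * (int j - int N)\<^sup>2 + (int j - int N)) / 2)) *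
            gauss_binomial (q ^ 3) (2 * N) (nat (int N + (int j - int N)))) =
         (- x) ^ j * (q ^ 3) ^ (j choose 2) * gauss_binomial (q ^ 3) (2 * N) j"
      unfolding n_def[symmetric] by (simp add: mult_ac)
  qed auto
  show ?thesis using lhs rhs C q_binomial_theorem[where x = x and Q = "q ^ 3" and M = "2 * N"] by simp
qed

text \<open>The positive bound \<open>l\<close> below all partial products later bounds the
  denominators in the closed form uniformly.\<close>

lemma qfact_limit:
  assumes Q: "0 < Q" "Q < 1"
  obtains l where "l > 0" "qfact Q \<longlonglongrightarrow> l" "\<And>n. l \<le> qfact Q n"
proof -
  have lt: "Q ^ Suc n < 1" for n using Q by (intro power_Suc_less_one) auto
  have conv: "convergent_prod (\<lambda>k. 1 + (- (Q ^ Suc k)))"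
  proof (rule summable_imp_convergent_prod_real)
    show "summable (\<lambda>k. \<bar>- (Q ^ Suc k)\<bar>)"
      using Q by (simp add: abs_mult power_abs summable_mult summable_geometric)
    show "- (Q ^ Suc k) \<noteq> - 1" for k using lt[of k] by simp
  qed
  define l where "l = prodinf (\<lambda>k. 1 + (- (Q ^ Suc k)))"
  have "(\<lambda>n. \<Prod>k\<le>n. 1 + (- (Q ^ Suc k))) \<longlonglongrightarrow> l"
    unfolding l_def by (rule convergent_prod_LIMSEQ[OF conv])
  hence "(\<lambda>n. qfact Q (Suc n)) \<longlonglongrightarrow> l"
    by (simp add: qfact_def lessThan_Suc_atMost del: power_Suc)
  hence lim: "qfact Q \<longlonglongrightarrow> l" by (rule LIMSEQ_imp_Suc)
  have pos: "qfact Q n > 0" for n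
    unfolding qfact_def using lt by (intro prod_pos) (auto simp del: power_Suc)
  have "l \<noteq> 0"
    unfolding l_def using lt by (intro prodinf_nonzero[OF conv]) (auto simp del: power_Suc simp: less_imp_neq[symmetric])
  moreover have "decseq (qfact Q)"
  proof (rule decseq_SucI)
    fix n
    have "qfact Q n * (1 - Q ^ Suc n) \<le> qfact Q n * 1"
      using pos[of n] Q by (intro mult_left_mono) auto
    thus "qfact Q (Suc n) \<le> qfact Q n" by (simp add: qfact_Suc)
  qed
  hence le: "l \<le> qfact Q n" for n using lim by (rule decseq_ge)
  moreover have "l \<ge> 0" using pos by (intro LIMSEQ_le_const[OF lim]) (auto intro: less_imp_le)
  ultimately show ?thesis using lim by (intro that) auto
qed

lemma qfact_antimono:
  assumes Q: "0 < Q" "Q < 1" and "m \<le> n"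
  shows "qfact Q n \<le> qfact Q m"
  using assms(3)
proof (induction n rule: dec_induct)
  case (step n)
  have "qfact Q n * (1 - Q ^ Suc n) \<le> qfact Q n * 1"
  proof (intro mult_left_mono)
    show "qfact Q n \<ge> 0"
      unfolding qfact_def using Q by (intro prod_nonneg) (auto intro: power_le_one simp del: power_Suc)
  qed (use Q in auto)
  thus ?case using step by (simp add: qfact_Suc)
qed auto

text \<open>The factors are grouped by the residue of the index modulo 3; those with index divisible
  by 3 form \<open>qfact (q ^ 3) N\<close>.\<close>

lemma qfact_triple: "qfact q (3 * N) = qfact (q ^ 3) N * (\<Prod>i<N. (1 - q ^ (3 * i + 1)) * (1 - q ^ (3 * i + 2)))"
proof (induction N)
  case (Suc N)
  have "3 * Suc N = Suc (Suc (Suc (3 * N)))" by simp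
  hence "qfact q (3 * Suc N) = qfact q (3 * N) * (1 - q ^ (3 * N + 1)) * (1 - q ^ (3 * N + 2)) * (1 - (q ^ 3) ^ Suc N)"
    by (simp only: qfact_Suc power_mult[symmetric]) (simp add: numeral_3_eq_3)
  thus ?case using Suc by (simp add: qfact_Suc del: power_Suc)
qed (simp add: qfact_def)

section \<open>The limit of the finite pentagonal identity\<close>

definition pent_term :: "real \<Rightarrow> int \<Rightarrow> real" where
  "pent_term a n = (if even n then 1 else - 1) * exp (- a * (of_int (3 * n\<^sup>2 + n) / 2))"

lemma summable_pent_term:
  assumes "a > 0"
  shows "(\<lambda>n. norm (pent_term a n)) summable_on UNIV"
proof (rule summable_on_comparison_test)
  show "(\<lambda>n::int. exp (a / 2 * \<bar>real_of_int n\<bar> - 3 * a / 2 * (of_int n)\<^sup>2)) summable_on UNIV"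
    using assms by (intro summable_gaussian_int) auto
  fix n :: int
  have "- (a / 2 * of_int n) \<le> a / 2 * \<bar>real_of_int n\<bar>"
    using assms by (simp only: mult_minus_right[symmetric], intro mult_left_mono) auto
  hence "- a * (of_int (3 * n\<^sup>2 + n) / 2) \<le> a / 2 * \<bar>real_of_int n\<bar> - 3 * a / 2 * (of_int n)\<^sup>2"
    by (simp add: field_simps)
  thus "norm (pent_term a n) \<le> exp (a / 2 * \<bar>real_of_int n\<bar> - 3 * a / 2 * (of_int n)\<^sup>2)"
    by (simp add: pent_term_def abs_mult)
qed auto

text \<open>Multiplying the finite identity by \<open>qfact Q N\<close> completes its right-hand
  side to \<open>qfact q (3 * N)\<close>. The closed form shows that the coefficients
  \<open>c N n\<close> are bounded by 1/l and tend to 1 for fixed n, so the limit may be taken under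
  the sum.\<close>

theorem pentagonal_number_theorem:
  assumes a: "a > 0"
  shows "qfact (exp (- a)) \<longlonglongrightarrow> (\<Sum>\<^sub>\<infinity>n. pent_term a n)"
proof -
  define q where "q = exp (- a)"
  have q: "0 < q" "q < 1" using a by (auto simp: q_def)
  define Q where "Q = q ^ 3"
  have Q: "0 < Q" "Q < 1" using q by (auto simp: Q_def power_less_one_iff)
  obtain l where l: "l > 0" "qfact Q \<longlonglongrightarrow> l" "\<And>n. l \<le> qfact Q n"
    using qfact_limit[OF Q] by blast
  have pos: "qfact Q n > 0" for n using l(1) l(3)[of n] by linarith
  define c where "c = (\<lambda>N n. if \<bar>n\<bar> \<le> int N then gauss_binomial Q (2 * N) (nat (int N + n)) * qfact Q N else 0)"
  have c_eq: "c N n = qfact Q (2 * N) * qfact Q N / (qfact Q (nat (int N + n)) * qfact Q (nat (int N - n)))"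
    if "\<bar>n\<bar> \<le> int N" for N n
  proof -
    have "2 * N - nat (int N + n) = nat (int N - n)" "nat (int N + n) \<le> 2 * N" using that by auto
    with gauss_binomial_closed_form[of "nat (int N + n)" "2 * N" Q]
    have "gauss_binomial Q (2 * N) (nat (int N + n)) * (qfact Q (nat (int N + n)) * qfact Q (nat (int N - n))) = qfact Q (2 * N)"
      by simp
    hence "gauss_binomial Q (2 * N) (nat (int N + n)) = qfact Q (2 * N) / (qfact Q (nat (int N + n)) * qfact Q (nat (int N - n)))"
      using pos[of "nat (int N + n)"] pos[of "nat (int N - n)"] by (simp add: field_simps)
    thus ?thesis using that by (simp add: c_def)
  qed
  have c_bound: "\<bar>c N n\<bar> \<le> 1 / l" for N n
  proof (cases "\<bar>n\<bar> \<le> int N")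
    case True
    have "qfact Q 0 = 1" by (simp add: qfact_def)
    hence "qfact Q N \<le> 1" using qfact_antimono[OF Q, of 0 N] by simp
    moreover have "qfact Q (2 * N) \<le> qfact Q (nat (int N + n))" using True by (intro qfact_antimono Q) auto
    ultimately have "c N n \<le> (qfact Q (nat (int N + n)) * 1) / (qfact Q (nat (int N + n)) * l)"
      unfolding c_eq[OF True] using pos l by (intro frac_le mult_mono) (auto intro: less_imp_le)
    also have "\<dots> = 1 / l" using pos[of "nat (int N + n)"] by simp
    finally have "c N n \<le> 1 / l" .
    moreover have "c N n \<ge> 0" unfolding c_eq[OF True] using pos by (auto intro!: divide_nonneg_nonneg mult_nonneg_nonneg less_imp_le)
    ultimately show ?thesis by simp
  qed (use l in \<open>simp add: c_def\<close>)
  have c_lim: "(\<lambda>N. c N n) \<longlonglongrightarrow> 1" for n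
  proof -
    have "filterlim (\<lambda>N. nat (int N + m)) at_top sequentially" for m
      unfolding filterlim_at_top
    proof
      fix Z :: nat
      show "\<forall>\<^sub>F N in sequentially. Z \<le> nat (int N + m)"
        by (rule eventually_sequentiallyI[of "Z + nat \<bar>m\<bar>"]) auto
    qed
    from filterlim_compose[OF l(2) this] have sh: "(\<lambda>N. qfact Q (nat (int N + m))) \<longlonglongrightarrow> l" for m .
    have "filterlim (\<lambda>N::nat. 2 * N) at_top sequentially"
      by (rule filterlim_subseq) (simp add: strict_mono_def)
    from filterlim_compose[OF l(2) this] have "(\<lambda>N. qfact Q (2 * N)) \<longlonglongrightarrow> l" .
    hence "(\<lambda>N. qfact Q (2 * N) * qfact Q N / (qfact Q (nat (int N + n)) * qfact Q (nat (int N - n)))) \<longlonglongrightarrow> l * l / (l * l)"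
      using l sh[of n] sh[of "- n"] by (intro tendsto_intros) auto
    moreover have "\<forall>\<^sub>F N in sequentially. qfact Q (2 * N) * qfact Q N / (qfact Q (nat (int N + n)) * qfact Q (nat (int N - n))) = c N n"
      by (rule eventually_sequentiallyI[of "nat \<bar>n\<bar>"], subst c_eq) auto
    ultimately show ?thesis using l by (simp add: tendsto_cong)
  qed
  define h where "h = (\<lambda>N. \<Sum>\<^sub>\<infinity>n. pent_term a n * c N n)"
  have "h \<longlonglongrightarrow> (\<Sum>\<^sub>\<infinity>n. pent_term a n)"
  proof (rule swap_uniform_limit')
    show "\<forall>\<^sub>F X in finite_subsets_at_top UNIV. (\<lambda>N. \<Sum>n\<in>X. pent_term a n * c N n) \<longlonglongrightarrow> (\<Sum>n\<in>X. pent_term a n)"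
    proof (rule always_eventually, rule allI)
      fix X
      have "(\<lambda>N. \<Sum>n\<in>X. pent_term a n * c N n) \<longlonglongrightarrow> (\<Sum>n\<in>X. pent_term a n * 1)"
        by (intro tendsto_sum tendsto_mult tendsto_const c_lim)
      thus "(\<lambda>N. \<Sum>n\<in>X. pent_term a n * c N n) \<longlonglongrightarrow> (\<Sum>n\<in>X. pent_term a n)" by simp
    qed
    show "((\<lambda>X. \<Sum>n\<in>X. pent_term a n) \<longlongrightarrow> (\<Sum>\<^sub>\<infinity>n. pent_term a n)) (finite_subsets_at_top UNIV)"
      by (rule infsum_tendsto[OF abs_summable_summable[OF summable_pent_term[OF a]]])
    show "uniform_limit UNIV (\<lambda>X N. \<Sum>n\<in>X. pent_term a n * c N n) h (finite_subsets_at_top UNIV)"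
      unfolding h_def
    proof (rule Weierstrass_m_test_general)
      show "(\<lambda>n. norm (pent_term a n) * (1 / l)) summable_on UNIV"
        by (intro summable_on_cmult_left summable_pent_term a)
      show "norm (pent_term a n * c N n) \<le> norm (pent_term a n) * (1 / l)" for n N
        unfolding norm_mult using c_bound by (intro mult_left_mono) auto
    qed
  qed auto
  moreover have "h = (\<lambda>N. qfact q (3 * N))"
  proof
    fix N
    have "h N = (\<Sum>\<^sub>\<infinity>n\<in>{- int N..int N}. pent_term a n * c N n)"
      unfolding h_def by (rule infsum_cong_neutral) (auto simp: c_def)
    also have "\<dots> = (\<Sum>n=-int N..int N. pent_term a n * c N n)" by simp
    also have "\<dots> = (\<Sum>n=-int N..int N. pent_term a n * gauss_binomial Q (2 * N) (nat (int N + n))) * qfact Q N"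
      unfolding sum_distrib_right by (intro sum.cong refl) (auto simp: c_def abs_le_iff)
    also have "\<dots> = qfact q (3 * N)"
      unfolding qfact_triple pent_term_def Q_def q_def finite_pentagonal by (simp add: mult.commute)
    finally show "h N = qfact q (3 * N)" .
  qed
  ultimately have "(\<lambda>N. qfact q (3 * N)) \<longlonglongrightarrow> (\<Sum>\<^sub>\<infinity>n. pent_term a n)" by simp
  moreover obtain l' where l': "qfact q \<longlonglongrightarrow> l'" using qfact_limit[OF q] by blast
  moreover have "filterlim (\<lambda>N::nat. 3 * N) at_top sequentially"
    by (rule filterlim_subseq) (simp add: strict_mono_def)
  from filterlim_compose[OF l' this] have "(\<lambda>N. qfact q (3 * N)) \<longlonglongrightarrow> l'" .
  ultimately show ?thesis using LIMSEQ_unique unfolding q_def by blast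
qed

section \<open>Eta as a theta series modulo 12 and its inversion formula\<close>

definition eta_axis :: "real \<Rightarrow> real" where
  "eta_axis t = (\<Sum>\<^sub>\<infinity>n::int. (if even n then 1 else - 1) * exp (- pi * t * (6 * of_int n + 1)\<^sup>2 / 12))"

text \<open>Completing the square: 12 (3 n^2 + n) + 1 = (6 n + 1)^2. The extra 1 is the factor
  q^(1/24) of Dedekind's eta function at z = i t.\<close>

lemma eta_term: "(if even n then 1 else - 1) * exp (- pi * t * (6 * of_int n + 1)\<^sup>2 / 12) =
    exp (- pi * t / 12) * pent_term (2 * pi * t) n"
proof -
  have "- pi * t * (6 * of_int n + 1)\<^sup>2 / 12 = - pi * t / 12 + - (2 * pi * t) * (of_int (3 * n\<^sup>2 + n) / 2)"
    by (simp add: power2_eq_square field_simps)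
  thus ?thesis unfolding pent_term_def by (simp only: exp_add) simp
qed

lemma eta_axis_product:
  assumes "t > 0"
  shows "qfact (exp (- 2 * pi * t)) \<longlonglongrightarrow> exp (pi * t / 12) * eta_axis t"
proof -
  have "eta_axis t = exp (- pi * t / 12) * (\<Sum>\<^sub>\<infinity>n. pent_term (2 * pi * t) n)"
    unfolding eta_axis_def eta_term by (rule infsum_cmult_right')
  hence "exp (pi * t / 12) * eta_axis t = (\<Sum>\<^sub>\<infinity>n. pent_term (2 * pi * t) n)"
    by (simp add: mult.assoc[symmetric] exp_add[symmetric])
  thus ?thesis using pentagonal_number_theorem[of "2 * pi * t"] assms by simp
qed

definition theta_shift :: "real \<Rightarrow> int \<Rightarrow> real" where
  "theta_shift t r = (\<Sum>\<^sub>\<infinity>l::int. exp (- pi * t * (12 * of_int l + of_int r)\<^sup>2 / 12))"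

lemma theta_shift_has_sum:
  assumes "t > 0"
  shows "((\<lambda>k::int. exp (- pi * t * (of_int k)\<^sup>2 / 12)) has_sum theta_shift t r) (range (\<lambda>l. 12 * l + r))"
    and "((\<lambda>k::int. exp (- pi * t * (of_int k)\<^sup>2 / 12)) has_sum theta_shift t r) (range (\<lambda>l. - (12 * l + r)))"
proof -
  define w where "w = (\<lambda>k::int. exp (- pi * t * (of_int k)\<^sup>2 / 12))"
  have sum: "w summable_on UNIV"
    using summable_gaussian_int[of "pi * t / 12" 0] assms by (simp add: w_def mult_ac)
  have "w summable_on range (\<lambda>l. 12 * l + r)" using sum summable_on_subset_banach by blast
  hence "(w has_sum infsum w (range (\<lambda>l. 12 * l + r))) (range (\<lambda>l. 12 * l + r))" by (rule has_sum_infsum)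
  moreover have "infsum w (range (\<lambda>l. 12 * l + r)) = theta_shift t r"
    by (subst infsum_reindex) (auto simp: inj_on_def theta_shift_def w_def o_def)
  ultimately show "(w has_sum theta_shift t r) (range (\<lambda>l. 12 * l + r))" by simp
  have "w summable_on range (\<lambda>l. - (12 * l + r))" using sum summable_on_subset_banach by blast
  hence "(w has_sum infsum w (range (\<lambda>l. - (12 * l + r)))) (range (\<lambda>l. - (12 * l + r)))" by (rule has_sum_infsum)
  moreover have "infsum w (range (\<lambda>l. - (12 * l + r))) = theta_shift t r"
  proof -
    have even: "w (- k) = w k" for k by (simp add: w_def)
    have "infsum w (range (\<lambda>l. - (12 * l + r))) = (\<Sum>\<^sub>\<infinity>l. w (- (12 * l + r)))"
      by (subst infsum_reindex) (auto simp: inj_on_def o_def)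
    thus ?thesis unfolding even by (simp add: theta_shift_def w_def)
  qed
  ultimately show "(w has_sum theta_shift t r) (range (\<lambda>l. - (12 * l + r)))" by simp
qed

text \<open>The sign (-1)^n is a function of 6 n + 1 modulo 12: the even n give the class 1, the odd
  n the class -5.\<close>

lemma eta_axis_split:
  assumes "t > 0"
  shows "eta_axis t = theta_shift t 1 - theta_shift t (- 5)"
proof -
  define f where "f = (\<lambda>n::int. (if even n then 1 else - 1) * exp (- pi * t * (6 * of_int n + 1)\<^sup>2 / 12))"
  have "(\<lambda>n. norm (f n)) summable_on UNIV"
    unfolding f_def eta_term norm_mult using assms
    by (intro summable_on_cmult_right summable_pent_term) auto
  from abs_summable_summable[OF this] have sum: "f summable_on A" for A
    by (rule summable_on_subset_banach) simp
  have "(UNIV :: int set) = range (\<lambda>l. 2 * l) \<union> range (\<lambda>l. 2 * l - 1)"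
  proof -
    have "n \<in> range (\<lambda>l. 2 * l) \<union> range (\<lambda>l. 2 * l - 1)" for n :: int
    proof (cases "even n")
      case False
      hence "n = 2 * ((n + 1) div 2) - 1" by presburger
      thus ?thesis by blast
    qed (auto elim!: evenE)
    thus ?thesis by blast
  qed
  hence "eta_axis t = infsum f (range (\<lambda>l. 2 * l) \<union> range (\<lambda>l. 2 * l - 1))"
    by (simp add: eta_axis_def f_def)
  also have "\<dots> = infsum f (range (\<lambda>l. 2 * l)) + infsum f (range (\<lambda>l. 2 * l - 1))"
    by (intro infsum_Un_disjoint sum) (auto, presburger)
  also have "infsum f (range (\<lambda>l. 2 * l)) = theta_shift t 1"
    by (subst infsum_reindex) (auto simp: inj_on_def theta_shift_def f_def o_def)
  also have "infsum f (range (\<lambda>l. 2 * l - 1)) = (\<Sum>\<^sub>\<infinity>l::int. - exp (- pi * t * (12 * of_int l + of_int (- 5))\<^sup>2 / 12))"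
    by (subst infsum_reindex) (auto simp: inj_on_def f_def o_def algebra_simps intro!: infsum_cong)
  also have "\<dots> = - theta_shift t (- 5)" unfolding theta_shift_def by (rule infsum_uminus)
  finally show ?thesis by simp
qed

lemma theta_shift_poisson:
  assumes t: "t > 0"
  shows "theta_shift t r = 1 / sqrt (12 * t) *
    (\<Sum>\<^sub>\<infinity>k::int. exp (- pi * (1 / t) * (of_int k)\<^sup>2 / 12) * cos (pi * of_int k * of_int r / 6))"
proof -
  define w where "w = (\<lambda>k::int. exp (- pi * (1 / t) * (of_int k)\<^sup>2 / 12))"
  have sum: "w summable_on UNIV"
    using summable_gaussian_int[of "pi / (12 * t)" 0] t by (simp add: w_def mult_ac)
  have "(\<Sum>\<^sub>\<infinity>n::int. complex_of_real (exp (- pi * (12 * t) * (of_int n + of_int r / 12)\<^sup>2))) =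
      of_real (1 / sqrt (12 * t)) * (\<Sum>\<^sub>\<infinity>k::int. of_real (exp (- pi * (of_int k)\<^sup>2 / (12 * t))) * cis (2 * pi * of_int k * (of_int r / 12)))"
    using t by (intro poisson_summation_gaussian) simp
  also have "(\<Sum>\<^sub>\<infinity>n::int. complex_of_real (exp (- pi * (12 * t) * (of_int n + of_int r / 12)\<^sup>2))) = of_real (theta_shift t r)"
  proof -
    have eqn: "exp (- pi * (12 * t) * (of_int n + of_int r / 12)\<^sup>2) = exp (- pi * t * (12 * of_int n + of_int r)\<^sup>2 / 12)" for n :: int
      by (rule arg_cong[of _ _ exp]) (simp add: power2_eq_square field_simps)
    have "(\<lambda>l::int. exp (- pi * t * (12 * of_int l + of_int r)\<^sup>2 / 12)) summable_on UNIV"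
    proof -
      have "((\<lambda>k::int. exp (- pi * t * (of_int k)\<^sup>2 / 12)) \<circ> (\<lambda>l. 12 * l + r)) summable_on UNIV"
        using has_sum_imp_summable[OF theta_shift_has_sum(1)[OF t, of r]]
        by (subst summable_on_reindex[symmetric]) (auto simp: inj_on_def)
      thus ?thesis by (simp add: o_def)
    qed
    thus ?thesis
      unfolding theta_shift_def eqn by (intro infsumI has_sum_of_real has_sum_infsum)
  qed
  finally have eq: "complex_of_real (theta_shift t r) = of_real (1 / sqrt (12 * t)) *
      (\<Sum>\<^sub>\<infinity>k::int. of_real (w k) * cis (pi * of_int k * of_int r / 6))"
    by (simp add: w_def mult_ac)
  have "(\<lambda>k. norm (of_real (w k) * cis (pi * of_int k * of_int r / 6))) summable_on UNIV"
    using sum by (simp add: norm_mult w_def)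
  hence "(\<lambda>k. of_real (w k) * cis (pi * of_int k * of_int r / 6)) summable_on UNIV" by (rule abs_summable_summable)
  from infsum_Re[OF this] have "Re (\<Sum>\<^sub>\<infinity>k::int. of_real (w k) * cis (pi * of_int k * of_int r / 6)) =
      (\<Sum>\<^sub>\<infinity>k. w k * cos (pi * of_int k * of_int r / 6))" by simp
  moreover have "theta_shift t r = Re (complex_of_real (theta_shift t r))" by simp
  ultimately show ?thesis unfolding eq by (simp add: w_def)
qed

text \<open>Equals sqrt 3 times the even quadratic character modulo 12. That the finite Fourier
  transform reproduces this character is the reason for the inversion formula of eta.\<close>

definition eta_char :: "int \<Rightarrow> real" where
  "eta_char k = cos (pi * of_int k * of_int 1 / 6) - cos (pi * of_int k * of_int (- 5) / 6)"

lemma eta_char_values: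
  fixes k :: int
  shows "eta_char (12 * l + 1) = sqrt 3" "eta_char (- (12 * l + 1)) = sqrt 3"
    "eta_char (12 * l + - 5) = - sqrt 3" "eta_char (- (12 * l + - 5)) = - sqrt 3"
    "(\<And>l. k \<noteq> 12 * l + 1) \<Longrightarrow> (\<And>l. k \<noteq> - (12 * l + 1)) \<Longrightarrow> (\<And>l. k \<noteq> 12 * l + - 5) \<Longrightarrow>
      (\<And>l. k \<noteq> - (12 * l + - 5)) \<Longrightarrow> eta_char k = 0"
proof -
  have per: "cos (x + 2 * pi * of_int n) = cos x" for x :: real and n :: int
    using cos_add[of x "2 * pi * of_int n"] by (simp add: cos_int_2pin sin_int_2pin)
  have even: "eta_char (- k) = eta_char k" for k
    unfolding eta_char_def by simp
  have c30: "cos (pi / 6) = sqrt 3 / 2" by (rule cos_30)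
  have c150: "cos (5 * pi / 6) = - (sqrt 3 / 2)"
  proof -
    have "5 * pi / 6 = pi - pi / 6" by simp
    thus ?thesis using c30 by (simp only: cos_pi_minus)
  qed
  have shift: "eta_char (12 * l + r) = eta_char r" for l r :: int
  proof -
    have "pi * of_int (12 * l + r) * of_int 1 / 6 = pi * of_int r * of_int 1 / 6 + 2 * pi * of_int l"
      "pi * of_int (12 * l + r) * of_int (- 5) / 6 = pi * of_int r * of_int (- 5) / 6 + 2 * pi * of_int (- 5 * l)"
      by (simp_all add: field_simps)
    thus ?thesis unfolding eta_char_def by (simp only: per)
  qed
  have one: "eta_char 1 = sqrt 3" unfolding eta_char_def using c30 c150 by (simp add: mult.commute)
  have five: "eta_char (- 5) = - sqrt 3"
  proof -
    have "cos (pi * of_int (- 5) * of_int (- 5) / 6) = cos (pi / 6 + 2 * pi * of_int 2)"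
      by (rule arg_cong[of _ _ cos]) simp
    also have "\<dots> = sqrt 3 / 2" unfolding per c30 ..
    finally show ?thesis unfolding eta_char_def using c150 by (simp add: mult.commute)
  qed
  show "eta_char (12 * l + 1) = sqrt 3" by (simp only: shift one)
  show "eta_char (12 * l + - 5) = - sqrt 3" by (simp only: shift five)
  show "eta_char (- (12 * l + 1)) = sqrt 3" by (simp only: even[of "12 * l + 1"] shift one)
  show "eta_char (- (12 * l + - 5)) = - sqrt 3" by (simp only: even[of "12 * l + - 5"] shift five)
  assume k: "\<And>l. k \<noteq> 12 * l + 1" "\<And>l. k \<noteq> - (12 * l + 1)" "\<And>l. k \<noteq> 12 * l + - 5" "\<And>l. k \<noteq> - (12 * l + - 5)"
  have "eta_char k = 2 * sin (pi * of_int k / 2) * sin (pi * of_int k / 3)"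
    unfolding eta_char_def cos_diff_cos by (simp add: field_simps)
  moreover have "2 dvd k \<or> 3 dvd k"
  proof (rule ccontr)
    assume "\<not> (2 dvd k \<or> 3 dvd k)"
    hence "k mod 12 = 1 \<or> k mod 12 = 11 \<or> k mod 12 = 7 \<or> k mod 12 = 5" by presburger
    moreover have "k = 12 * (k div 12) + k mod 12" by simp
    ultimately show False
      using k(1)[of "k div 12"] k(2)[of "- (k div 12) - 1"] k(3)[of "k div 12 + 1"] k(4)[of "- (k div 12)"]
      by presburger
  qed
  moreover have "sin (pi * of_int k / 2) = 0" if "2 dvd k"
    using that by (auto elim!: dvdE simp: sin_zero_iff_int2 mult_ac)
  moreover have "sin (pi * of_int k / 3) = 0" if "3 dvd k"
    using that by (auto elim!: dvdE simp: sin_zero_iff_int2 mult_ac)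
  ultimately show "eta_char k = 0" by auto
qed

text \<open>After Poisson summation only the classes 1, -1, 5 and -5 modulo 12 survive, weighted by
  \<open>eta_char\<close>. Since the Gaussian is even in k they give \<open>eta_axis (1 / t)\<close>
  twice, and the factor 2 sqrt 3 cancels against sqrt 12.\<close>

theorem eta_axis_inversion:
  assumes t: "t > 0"
  shows "eta_axis (1 / t) = sqrt t * eta_axis t"
proof -
  define w where "w = (\<lambda>k::int. exp (- pi * (1 / t) * (of_int k)\<^sup>2 / 12))"
  have t': "1 / t > 0" using t by simp
  have sum: "w summable_on UNIV"
    using summable_gaussian_int[of "pi / (12 * t)" 0] t by (simp add: w_def mult_ac)
  have sumc: "(\<lambda>k. w k * cos (g k)) summable_on UNIV" for g
  proof (rule abs_summable_summable, rule summable_on_comparison_test[OF sum])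
    fix k :: int
    show "norm (w k * cos (g k)) \<le> w k"
      using abs_cos_le_one[of "g k"] by (simp add: abs_mult w_def mult_left_le)
  qed auto
  have "eta_axis t = 1 / sqrt (12 * t) * ((\<Sum>\<^sub>\<infinity>k. w k * cos (pi * of_int k * of_int 1 / 6)) -
      (\<Sum>\<^sub>\<infinity>k. w k * cos (pi * of_int k * of_int (- 5) / 6)))"
    unfolding eta_axis_split[OF t] theta_shift_poisson[OF t] w_def by (simp only: right_diff_distrib)
  also have "(\<Sum>\<^sub>\<infinity>k. w k * cos (pi * of_int k * of_int 1 / 6)) - (\<Sum>\<^sub>\<infinity>k. w k * cos (pi * of_int k * of_int (- 5) / 6)) =
      (\<Sum>\<^sub>\<infinity>k. w k * eta_char k)"
  proof -
    have "((\<lambda>k. w k * cos (pi * of_int k * of_int 1 / 6) + - (w k * cos (pi * of_int k * of_int (- 5) / 6))) has_sum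
      ((\<Sum>\<^sub>\<infinity>k. w k * cos (pi * of_int k * of_int 1 / 6)) + - (\<Sum>\<^sub>\<infinity>k. w k * cos (pi * of_int k * of_int (- 5) / 6)))) UNIV"
      by (intro has_sum_add has_sum_uminusI has_sum_infsum sumc)
    from infsumI[OF this] show ?thesis by (simp add: eta_char_def right_diff_distrib)
  qed
  also have "(\<Sum>\<^sub>\<infinity>k. w k * eta_char k) = 2 * sqrt 3 * eta_axis (1 / t)"
  proof -
    define A where "A = range (\<lambda>l::int. 12 * l + 1)"
    define A' where "A' = range (\<lambda>l::int. - (12 * l + 1))"
    define B where "B = range (\<lambda>l::int. 12 * l + - 5)"
    define B' where "B' = range (\<lambda>l::int. - (12 * l + - 5))"
    have part: "((\<lambda>k. w k * eta_char k) has_sum (theta_shift (1 / t) r * v)) S"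
      if "(w has_sum theta_shift (1 / t) r) S" "\<And>k. k \<in> S \<Longrightarrow> eta_char k = v" for r v S
    proof -
      have "((\<lambda>k. w k * v) has_sum (theta_shift (1 / t) r * v)) S" by (rule has_sum_cmult_left[OF that(1)])
      thus ?thesis using that(2) by (simp cong: has_sum_cong)
    qed
    note ts = theta_shift_has_sum[OF t', folded w_def]
    have "((\<lambda>k. w k * eta_char k) has_sum (theta_shift (1 / t) 1 * sqrt 3)) A"
      unfolding A_def by (rule part[OF ts(1)], elim rangeE) (simp only: eta_char_values)
    moreover have "((\<lambda>k. w k * eta_char k) has_sum (theta_shift (1 / t) 1 * sqrt 3)) A'"
      unfolding A'_def by (rule part[OF ts(2)], elim rangeE) (simp only: eta_char_values)
    moreover have "((\<lambda>k. w k * eta_char k) has_sum (theta_shift (1 / t) (- 5) * (- sqrt 3))) B"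
      unfolding B_def by (rule part[OF ts(1)], elim rangeE) (simp only: eta_char_values)
    moreover have "((\<lambda>k. w k * eta_char k) has_sum (theta_shift (1 / t) (- 5) * (- sqrt 3))) B'"
      unfolding B'_def by (rule part[OF ts(2)], elim rangeE) (simp only: eta_char_values)
    moreover have "A \<inter> A' = {}" "(A \<union> A') \<inter> B = {}" "(A \<union> A' \<union> B) \<inter> B' = {}"
      unfolding A_def A'_def B_def B'_def by (auto, presburger+)
    ultimately have "((\<lambda>k. w k * eta_char k) has_sum (theta_shift (1 / t) 1 * sqrt 3 + theta_shift (1 / t) 1 * sqrt 3 +
        theta_shift (1 / t) (- 5) * (- sqrt 3) + theta_shift (1 / t) (- 5) * (- sqrt 3))) (A \<union> A' \<union> B \<union> B')"
      by (intro has_sum_Un_disjoint)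
    also have "?this \<longleftrightarrow> ((\<lambda>k. w k * eta_char k) has_sum (theta_shift (1 / t) 1 * sqrt 3 + theta_shift (1 / t) 1 * sqrt 3 +
        theta_shift (1 / t) (- 5) * (- sqrt 3) + theta_shift (1 / t) (- 5) * (- sqrt 3))) UNIV"
    proof (rule has_sum_cong_neutral)
      fix k assume k: "k \<in> UNIV - (A \<union> A' \<union> B \<union> B')"
      have "eta_char k = 0" by (rule eta_char_values(5)) (use k in \<open>auto simp: A_def A'_def B_def B'_def\<close>)
      thus "w k * eta_char k = 0" by simp
    qed auto
    finally have "((\<lambda>k. w k * eta_char k) has_sum (2 * sqrt 3 * (theta_shift (1 / t) 1 - theta_shift (1 / t) (- 5)))) UNIV"
      by (simp add: algebra_simps)
    thus ?thesis unfolding eta_axis_split[OF t'] by (rule infsumI)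
  qed
  also have "1 / sqrt (12 * t) * (2 * sqrt 3 * eta_axis (1 / t)) = eta_axis (1 / t) / sqrt t"
  proof -
    have "sqrt 12 = 2 * sqrt 3" using real_sqrt_mult[of 4 3] by simp
    thus ?thesis using t by (simp add: real_sqrt_mult)
  qed
  finally show ?thesis using t by (simp add: field_simps)
qed

subsection \<open>Modular forms on the unit disc\<close>

definition qexp :: "complex \<Rightarrow> complex" where
  "qexp z = exp (2 * of_real pi * \<i> * z)"

lemma qexp_nonzero [simp]: "qexp z \<noteq> 0"
  by (simp add: qexp_def)

lemma norm_qexp: "norm (qexp z) = exp (- 2 * pi * Im z)"
  by (simp add: qexp_def norm_exp_eq_Re)

lemma norm_qexp_less_one_iff [simp]: "norm (qexp z) < 1 \<longleftrightarrow> Im z > 0"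
  using pi_gt_zero by (simp add: norm_qexp zero_less_mult_iff)

lemma qexp_diff_of_int: "qexp (z - of_int n) = qexp z"
proof -
  have "qexp (z - of_int n) = qexp z / exp (2 * of_int n * of_real pi * \<i>)"
    by (simp add: qexp_def ring_distribs exp_diff mult_ac)
  also have "exp (2 * of_int n * of_real pi * \<i>) = 1"
    by (simp add: exp_eq_1)
  finally show ?thesis by simp
qed

lemma qexp_surj:
  assumes "q \<noteq> 0" "norm q < 1"
  obtains z where "Im z > 0" "qexp z = q"
proof -
  define z where "z = Ln q / (2 * of_real pi * \<i>)"
  have "qexp z = q"
    using assms by (simp add: qexp_def z_def)
  moreover from this have "Im z > 0"
    using assms(2) norm_qexp_less_one_iff by metis
  ultimately show ?thesis by (rule that[rotated])
qed

lemma holomorphic_qexp [holomorphic_intros]: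
  "f holomorphic_on A \<Longrightarrow> (\<lambda>z. qexp (f z)) holomorphic_on A"
  unfolding qexp_def by (intro holomorphic_intros)

lemma Im_neg_inverse_pos: "Im z > 0 \<Longrightarrow> Im (- 1 / z) > 0"
  by (simp add: Im_divide sum_power2_gt_zero_iff)

lemma qexp_i_times: "qexp (\<i> * of_real t) = of_real (exp (- 2 * pi * t))"
  by (simp add: qexp_def exp_of_real[symmetric] mult_ac)

text \<open>A function on the unit disc that satisfies \<open>h(-1/z) = z\<^sup>w h(z)\<close> as a function of
  \<open>q = e\<^sup>2\<^sup>\<pi>\<^sup>i\<^sup>z\<close> is a modular form of weight \<open>w\<close>, holomorphic at the cusp \<open>q = 0\<close>;
  invariance under \<open>z \<mapsto> z + 1\<close> is built in.\<close>
definition disc_modular :: "nat \<Rightarrow> (complex \<Rightarrow> complex) \<Rightarrow> bool" where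
  "disc_modular w h \<longleftrightarrow> h holomorphic_on ball 0 1 \<and>
     (\<forall>z. Im z > 0 \<longrightarrow> h (qexp (- 1 / z)) = z ^ w * h (qexp z))"

lemma disc_modularI_imaginary_axis:
  assumes h: "h holomorphic_on ball 0 1"
    and axis: "\<And>t. t > 0 \<Longrightarrow>
      h (of_real (exp (- 2 * pi / t))) = (\<i> * of_real t) ^ w * h (of_real (exp (- 2 * pi * t)))"
  shows "disc_modular w h"
proof -
  define S where "S = {z. Im z > 0}"
  define U where "U = (\<lambda>t. \<i> * of_real t) ` {0<..}"
  define f where "f = (\<lambda>z. h (qexp (- 1 / z)) - z ^ w * h (qexp z))"
  have S: "open S" "connected S"
    unfolding S_def by (auto intro: open_halfspace_Im_gt convex_connected convex_halfspace_Im_gt)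
  have nz: "z \<noteq> 0" if "z \<in> S" for z using that by (auto simp: S_def)
  have "(h \<circ> (\<lambda>z. qexp (- 1 / z))) holomorphic_on S"
    by (rule holomorphic_on_compose_gen[OF _ h])
       (auto intro!: holomorphic_intros simp: nz, auto simp: S_def dest: Im_neg_inverse_pos)
  moreover have "(h \<circ> qexp) holomorphic_on S"
    by (rule holomorphic_on_compose_gen[OF _ h]) (auto intro!: holomorphic_intros, auto simp: S_def)
  ultimately have f: "f holomorphic_on S"
    unfolding f_def o_def by (intro holomorphic_intros)
  have zero: "f z = 0" if "z \<in> U" for z
  proof -
    from that obtain t where t: "t > 0" "z = \<i> * of_real t" by (auto simp: U_def)
    have "- 1 / z = \<i> * of_real (1 / t)"
      using t by (simp add: field_simps)
    hence "qexp (- 1 / z) = of_real (exp (- 2 * pi / t))"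
      using qexp_i_times[of "1 / t"] by simp
    thus ?thesis using axis[OF t(1)] t(2) qexp_i_times[of t] by (simp add: f_def)
  qed
  have "\<i> islimpt U"
    unfolding islimpt_approachable
  proof (intro allI impI)
    fix \<epsilon> :: real assume "\<epsilon> > 0"
    hence "\<i> * of_real (1 + \<epsilon> / 2) \<in> U"
      unfolding U_def by (intro imageI) auto
    moreover from \<open>\<epsilon> > 0\<close> have "\<i> * of_real (1 + \<epsilon> / 2) \<noteq> \<i>"
      "dist (\<i> * of_real (1 + \<epsilon> / 2)) \<i> < \<epsilon>"
      by (auto simp: dist_norm algebra_simps norm_mult)
    ultimately show "\<exists>x'\<in>U. x' \<noteq> \<i> \<and> dist x' \<i> < \<epsilon>" by blast
  qed
  hence "f z = 0" if "z \<in> S" for z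
    by (intro analytic_continuation[of f S U \<i>, OF f S _ _ _ zero that]) (auto simp: U_def S_def)
  thus ?thesis
    using h by (auto simp: disc_modular_def f_def S_def)
qed

text \<open>On the strip \<open>|Re z| \<le> 1/2\<close>, \<open>Im z < 1/2\<close> the inversion at least doubles the imaginary part.\<close>
lemma modular_invariant_reduce:
  assumes inv: "\<And>z. Im z > 0 \<Longrightarrow> K (qexp (- 1 / z)) = K (qexp z)"
    and "Im z > 0"
  shows "\<exists>z'. Im z' \<ge> 1 / 2 \<and> K (qexp z') = K (qexp z)"
proof -
  \<comment> \<open>\<open>n\<close> bounds the number of doublings that bring the imaginary part up
    to 1/2.\<close>
  obtain n where "(1 / Im z) < 2 ^ n"
    using real_arch_pow by (metis one_less_numeral_iff semiring_norm(76))
  hence "Im z \<ge> 1 / 2 / 2 ^ n"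
    using assms(2) by (simp add: field_simps)
  with assms(2) show ?thesis
  proof (induction n arbitrary: z)
    case 0
    thus ?case by auto
  next
    case (Suc n)
    show ?case
    proof (cases "Im z \<ge> 1 / 2")
      case False
      define z1 where "z1 = z - of_int (round (Re z))"
      have im: "Im z1 = Im z" by (simp add: z1_def)
      have "\<bar>Re z1\<bar> \<le> 1 / 2"
        using of_int_round_abs_le[of "Re z"] by (simp add: z1_def abs_minus_commute)
      hence "(Re z1)\<^sup>2 \<le> (1 / 2)\<^sup>2" using abs_le_square_iff by force
      moreover have "(Im z1)\<^sup>2 \<le> (1 / 2)\<^sup>2"
        using False Suc.prems im by (intro power_mono) auto
      ultimately have le: "(Re z1)\<^sup>2 + (Im z1)\<^sup>2 \<le> 1 / 2" by (simp add: power2_eq_square)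
      have pos: "(Re z1)\<^sup>2 + (Im z1)\<^sup>2 > 0"
        using Suc.prems im by (simp add: sum_power2_gt_zero_iff)
      have "Im (- 1 / z1) = Im z / ((Re z1)\<^sup>2 + (Im z1)\<^sup>2)"
        by (simp add: Im_divide im)
      also have "\<dots> \<ge> Im z / (1 / 2)"
        using le pos Suc.prems by (intro divide_left_mono) auto
      finally have "Im (- 1 / z1) \<ge> 2 * Im z" by simp
      moreover have "2 * Im z \<ge> 1 / 2 / 2 ^ n"
        using Suc.prems by (simp add: field_simps)
      ultimately have "Im (- 1 / z1) \<ge> 1 / 2 / 2 ^ n" by linarith
      from Suc.IH[OF _ this] obtain z' where
        "Im z' \<ge> 1 / 2" "K (qexp z') = K (qexp (- 1 / z1))"
        using Im_neg_inverse_pos[of z1] im Suc.prems by auto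
      thus ?thesis
        using inv[of z1] im Suc.prems qexp_diff_of_int[of z "round (Re z)"]
        by (auto simp: z1_def)
    qed auto
  qed
qed

text \<open>Every point other than the cusp can be moved to Im z >= 1/2, that is |q| <= exp(-pi),
  without changing K. Hence |K| attains its supremum over the open unit disc on this smaller compact
  disc, and the maximum principle applies.\<close>

lemma disc_modular_0_constant:
  assumes "disc_modular 0 K" "norm q < 1"
  shows "K q = K 0"
proof -
  define r where "r = exp (- pi)"
  have hol: "K holomorphic_on ball 0 1"
    and inv: "\<And>z. Im z > 0 \<Longrightarrow> K (qexp (- 1 / z)) = K (qexp z)"
    using assms by (auto simp: disc_modular_def)
  have r: "r < 1" "r > 0" by (auto simp: r_def)
  have "continuous_on (cball 0 r) (\<lambda>q. norm (K q))"
    using r by (intro continuous_intros holomorphic_on_imp_continuous_on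
      holomorphic_on_subset[OF hol]) auto
  then obtain \<xi> where \<xi>: "\<xi> \<in> cball 0 r" "\<And>q. q \<in> cball 0 r \<Longrightarrow> norm (K q) \<le> norm (K \<xi>)"
    using continuous_attains_sup[of "cball 0 r" "\<lambda>q. norm (K q)"] r
    by (metis cball_eq_empty compact_cball not_less_iff_gr_or_eq)
  have max: "norm (K q) \<le> norm (K \<xi>)" if q: "q \<in> ball 0 1" for q
  proof (cases "q = 0")
    case False
    then obtain z where z: "Im z > 0" "qexp z = q"
      using qexp_surj[of q] q by auto
    then obtain z' where z': "Im z' \<ge> 1 / 2" "K (qexp z') = K q"
      using modular_invariant_reduce[OF inv] by metis
    have "norm (qexp z') \<le> r"
      using z'(1) unfolding norm_qexp r_def by simp
    thus ?thesis using \<xi>(2)[of "qexp z'"] z'(2) by simp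
  qed (use \<xi> r in auto)
  have "K constant_on ball 0 1"
    by (rule maximum_modulus_principle[OF hol, of "ball 0 1" \<xi>]) (use \<xi> r max in auto)
  thus ?thesis
    using assms(2) unfolding constant_on_def by force
qed

section \<open>Operations on modular forms\<close>

lemma disc_modular_mult:
  assumes "disc_modular v f" "disc_modular w g"
  shows "disc_modular (v + w) (\<lambda>q. f q * g q)"
  using assms by (auto simp: disc_modular_def power_add intro!: holomorphic_intros)

lemma disc_modular_cmult:
  assumes "disc_modular w f"
  shows "disc_modular w (\<lambda>q. c * f q)"
  using assms by (auto simp: disc_modular_def intro!: holomorphic_intros)

lemma disc_modular_diff:
  assumes "disc_modular w f" "disc_modular w g"
  shows "disc_modular w (\<lambda>q. f q - g q)"
  using assms by (auto simp: disc_modular_def algebra_simps intro!: holomorphic_intros)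

text \<open>\<open>f\<close> may vanish at q = 0, as the discriminant does: \<open>qexp\<close>
  never takes the value 0, so division is possible at all points that matter.\<close>

lemma disc_modular_cancel:
  assumes "disc_modular (v + w) (\<lambda>q. f q * g q)" "disc_modular w f"
    and "g holomorphic_on ball 0 1" "\<And>q. 0 < norm q \<Longrightarrow> norm q < 1 \<Longrightarrow> f q \<noteq> 0"
  shows "disc_modular v g"
  unfolding disc_modular_def
proof (intro conjI allI impI assms)
  fix z :: complex assume z: "Im z > 0"
  hence nz: "z \<noteq> 0" by auto
  have z': "Im (- 1 / z) > 0" by (rule Im_neg_inverse_pos[OF z])
  have "f (qexp (- 1 / z)) * g (qexp (- 1 / z)) = z ^ v * z ^ w * (f (qexp z) * g (qexp z))"
    using assms(1) z by (auto simp: disc_modular_def power_add)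
  moreover have "f (qexp (- 1 / z)) = z ^ w * f (qexp z)"
    using assms(2) z by (auto simp: disc_modular_def)
  moreover have "f (qexp z) \<noteq> 0"
    using assms(4)[of "qexp z"] z by simp
  ultimately show "g (qexp (- 1 / z)) = z ^ v * g (qexp z)"
    using nz by simp
qed

lemma disc_modular_power:
  assumes "disc_modular w f"
  shows "disc_modular (w * n) (\<lambda>q. f q ^ n)"
  using assms by (auto simp: disc_modular_def power_mult power_mult_distrib intro!: holomorphic_intros)

section \<open>Cusp forms of small weight\<close>

lemma factor_power_series_zero:
  assumes h: "h holomorphic_on ball 0 1" "h 0 = 0"
  obtains h1 where "h1 holomorphic_on ball 0 1" "\<And>q. norm q < 1 \<Longrightarrow> h q = q * h1 q"
proof -
  define h1 where "h1 = (\<lambda>q. if q = 0 then deriv h 0 else h q / q)"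
  have "h1 holomorphic_on ball 0 1"
    unfolding h1_def using pole_theorem_open_0[of h "ball 0 1" 0 h1] h
    by (auto simp: h1_def field_simps)
  moreover have "h q = q * h1 q" for q
    using h(2) by (auto simp: h1_def)
  ultimately show ?thesis by (rule that)
qed

text \<open>The properties of Delta = q \<phi>(q) that the argument uses: weight 12, a simple zero
  at the cusp and no other zero.\<close>

locale discriminant =
  fixes \<phi> :: "complex \<Rightarrow> complex"
  assumes phi_holomorphic: "\<phi> holomorphic_on ball 0 1"
    and phi_nonzero: "norm q < 1 \<Longrightarrow> \<phi> q \<noteq> 0"
    and modular: "disc_modular 12 (\<lambda>q. q * \<phi> q)"
begin

text \<open>\<open>h\<^sup>1\<^sup>2 / \<Delta>\<^sup>w\<close> has weight 0 and, as \<open>12 r > w\<close>, vanishes at the cusp.\<close>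
lemma disc_modular_high_order_zero:
  assumes h: "disc_modular w h" and h1: "h1 holomorphic_on ball 0 1"
    and fac: "\<And>q. norm q < 1 \<Longrightarrow> h q = q ^ r * h1 q"
    and r: "w < 12 * r" and q: "norm q < 1"
  shows "h q = 0"
proof -
  define K where "K = (\<lambda>q. q ^ (12 * r - w) * h1 q ^ 12 / \<phi> q ^ w)"
  have K: "K holomorphic_on ball 0 1"
    unfolding K_def by (intro holomorphic_intros h1 phi_holomorphic) (auto simp: phi_nonzero)
  have eq: "(q * \<phi> q) ^ w * K q = h q ^ 12" if "norm q < 1" for q
  proof -
    have "(q * \<phi> q) ^ w * K q = q ^ (w + (12 * r - w)) * h1 q ^ 12"
      using phi_nonzero[OF that] by (simp add: K_def power_mult_distrib power_add)
    also have "w + (12 * r - w) = r * 12" using r by simp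
    finally show ?thesis using fac[OF that] by (simp only: power_mult power_mult_distrib)
  qed
  have "disc_modular (0 + 12 * w) (\<lambda>q. (q * \<phi> q) ^ w * K q)"
    unfolding disc_modular_def
  proof (intro conjI allI impI)
    show "(\<lambda>q. (q * \<phi> q) ^ w * K q) holomorphic_on ball 0 1"
      by (intro holomorphic_intros phi_holomorphic K)
    fix z :: complex assume z: "Im z > 0"
    have "h (qexp (- 1 / z)) ^ 12 = z ^ (w * 12) * h (qexp z) ^ 12"
      unfolding power_mult
      using h z by (simp add: disc_modular_def power_mult_distrib)
    thus "(qexp (- 1 / z) * \<phi> (qexp (- 1 / z))) ^ w * K (qexp (- 1 / z)) =
          z ^ (0 + 12 * w) * ((qexp z * \<phi> (qexp z)) ^ w * K (qexp z))"
      using eq[of "qexp z"] eq[of "qexp (- 1 / z)"] z Im_neg_inverse_pos[OF z]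
      by (simp only: norm_qexp_less_one_iff mult.commute[of w] add_0)
  qed
  hence "disc_modular 0 K"
    by (rule disc_modular_cancel) (use disc_modular_power[OF modular, of w] K phi_nonzero in auto)
  hence "K q = K 0" using q by (rule disc_modular_0_constant)
  also have "K 0 = 0" using r by (simp add: K_def)
  finally have "h q ^ 12 = 0" using eq[OF q] by simp
  thus ?thesis by simp
qed

corollary cusp_form_weight_less_12:
  assumes "disc_modular w h" "h 0 = 0" "w < 12" "norm q < 1"
  shows "h q = 0"
proof -
  have "h holomorphic_on ball 0 1" using assms by (auto simp: disc_modular_def)
  then obtain h1 where "h1 holomorphic_on ball 0 1" "\<And>q. norm q < 1 \<Longrightarrow> h q = q * h1 q"
    using assms(2) factor_power_series_zero by blast
  thus ?thesis
    using disc_modular_high_order_zero[of w h h1 1 q] assms by simp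
qed

text \<open>The constant matches the coefficient of q, so that the difference vanishes to order 2 at
  the cusp, and 12 < 12 * 2.\<close>

lemma cusp_form_weight_12:
  assumes h: "disc_modular 12 h" "h 0 = 0"
  obtains c where "\<And>q. norm q < 1 \<Longrightarrow> h q = c * (q * \<phi> q)"
proof -
  have "h holomorphic_on ball 0 1" using h by (auto simp: disc_modular_def)
  then obtain h1 where h1: "h1 holomorphic_on ball 0 1" "\<And>q. norm q < 1 \<Longrightarrow> h q = q * h1 q"
    using h(2) factor_power_series_zero by blast
  define c where "c = h1 0 / \<phi> 0"
  have "(\<lambda>q. h1 q - c * \<phi> q) holomorphic_on ball 0 1"
    by (intro holomorphic_intros h1 phi_holomorphic)
  moreover have "h1 0 - c * \<phi> 0 = 0" using phi_nonzero[of 0] by (simp add: c_def)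
  ultimately obtain h2 where h2: "h2 holomorphic_on ball 0 1"
    "\<And>q. norm q < 1 \<Longrightarrow> h1 q - c * \<phi> q = q * h2 q"
    using factor_power_series_zero[of "\<lambda>q. h1 q - c * \<phi> q"] by blast
  have mod: "disc_modular 12 (\<lambda>q. h q - c * (q * \<phi> q))"
    by (intro disc_modular_diff h disc_modular_cmult modular)
  have "h q - c * (q * \<phi> q) = q ^ 2 * h2 q" if "norm q < 1" for q
    using h1(2)[OF that] h2(2)[OF that] by (simp add: power2_eq_square algebra_simps)
  from disc_modular_high_order_zero[OF mod h2(1) this]
  have "h q = c * (q * \<phi> q)" if "norm q < 1" for q using that by simp
  thus ?thesis by (rule that)
qed

text \<open>A form \<open>g\<close> of weight 2 vanishes at \<open>z = \<i>\<close>, while \<open>g\<^sup>2\<close> is a multiple of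
  the weight 4 form \<open>E\<close>, which does not.\<close>
lemma cusp_form_weight_14:
  assumes E: "disc_modular 4 E" "E 0 = 1" "E (qexp \<i>) \<noteq> 0"
    and h: "disc_modular 14 h" "h 0 = 0" and q: "norm q < 1"
  shows "h q = 0"
proof -
  have "h holomorphic_on ball 0 1" using h by (auto simp: disc_modular_def)
  then obtain h1 where h1: "h1 holomorphic_on ball 0 1" "\<And>q. norm q < 1 \<Longrightarrow> h q = q * h1 q"
    using h(2) factor_power_series_zero by blast
  define g where "g = (\<lambda>q. h1 q / \<phi> q)"
  have g_hol: "g holomorphic_on ball 0 1"
    unfolding g_def by (intro holomorphic_intros h1 phi_holomorphic) (auto simp: phi_nonzero)
  have hg: "h q = q * \<phi> q * g q" if "norm q < 1" for q
    using h1(2)[OF that] phi_nonzero[OF that] by (simp add: g_def)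
  have "disc_modular (2 + 12) (\<lambda>q. q * \<phi> q * g q)"
    unfolding disc_modular_def
  proof (intro conjI allI impI)
    show "(\<lambda>q. q * \<phi> q * g q) holomorphic_on ball 0 1"
      by (intro holomorphic_intros phi_holomorphic g_hol)
    fix z :: complex assume z: "Im z > 0"
    have "h (qexp (- 1 / z)) = z ^ (2 + 12) * h (qexp z)"
      using h z by (auto simp: disc_modular_def)
    thus "qexp (- 1 / z) * \<phi> (qexp (- 1 / z)) * g (qexp (- 1 / z)) =
          z ^ (2 + 12) * (qexp z * \<phi> (qexp z) * g (qexp z))"
      using z Im_neg_inverse_pos[OF z] by (simp only: hg norm_qexp_less_one_iff)
  qed
  hence g: "disc_modular 2 g"
    by (rule disc_modular_cancel) (use modular g_hol phi_nonzero in auto)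
  \<comment> \<open>The inversion fixes \<open>\<i>\<close>, where the factor of automorphy is
    -1.\<close>
  hence "g (qexp (- 1 / \<i>)) = \<i> ^ 2 * g (qexp \<i>)"
    unfolding disc_modular_def by (metis imaginary_unit.sel(2) zero_less_one)
  hence gi: "g (qexp \<i>) = 0" by simp
  define c where "c = g 0 * g 0"
  have "disc_modular (2 + 2) (\<lambda>q. g q * g q)" by (intro disc_modular_mult g)
  hence "disc_modular 4 (\<lambda>q. g q * g q - c * E q)"
    by (intro disc_modular_diff disc_modular_cmult E) simp
  moreover have "g 0 * g 0 - c * E 0 = 0" by (simp add: c_def E)
  ultimately have eq: "g q * g q - c * E q = 0" if "norm q < 1" for q
    using cusp_form_weight_less_12[of 4 "\<lambda>q. g q * g q - c * E q" q] that by auto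
  from eq[of "qexp \<i>"] have "c = 0" using gi E by simp
  hence "g q = 0" using eq[OF q] by simp
  thus ?thesis using hg[OF q] by simp
qed

end

subsection \<open>The discriminant\<close>

definition euler_prod :: "complex \<Rightarrow> complex" where
  "euler_prod q = (\<Prod>k. 1 - q ^ Suc k)"

lemma euler_prod_convergent:
  fixes q :: complex
  assumes "norm q < 1"
  shows "convergent_prod (\<lambda>k. 1 - q ^ Suc k)"
proof -
  have "convergent_prod (\<lambda>k. 1 + (- (q ^ Suc k)))"
  proof (rule summable_imp_convergent_prod_complex[of "\<lambda>k. - (q ^ Suc k)"])
    show "summable (\<lambda>k. norm (- (q ^ Suc k)))"
      using assms by (simp add: norm_mult norm_power summable_mult summable_geometric)
    show "- (q ^ Suc k) \<noteq> - 1" for k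
    proof
      assume "- (q ^ Suc k) = - 1"
      hence "norm (q ^ Suc k) = 1" by simp
      moreover have "norm (q ^ Suc k) < 1"
        unfolding norm_power using assms by (simp add: power_less_one_iff del: power_Suc)
      ultimately show False by simp
    qed
  qed
  thus ?thesis by simp
qed

lemma euler_prod_nonzero:
  assumes "norm q < 1"
  shows "euler_prod q \<noteq> 0"
  unfolding euler_prod_def
proof (rule prodinf_nonzero[OF euler_prod_convergent[OF assms]])
  fix k
  have "norm (q ^ Suc k) < 1"
    unfolding norm_power using assms
    by (simp add: power_less_one_iff del: power_Suc)
  thus "1 - q ^ Suc k \<noteq> 0" by auto
qed

lemma euler_prod_LIMSEQ:
  assumes "norm q < 1"
  shows "(\<lambda>n. \<Prod>k<n. 1 - q ^ Suc k) \<longlonglongrightarrow> euler_prod q"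
proof -
  have "(\<lambda>n. \<Prod>k\<le>n. 1 - q ^ Suc k) \<longlonglongrightarrow> euler_prod q"
    unfolding euler_prod_def by (rule convergent_prod_LIMSEQ[OF euler_prod_convergent[OF assms]])
  hence "(\<lambda>n. \<Prod>k<Suc n. 1 - q ^ Suc k) \<longlonglongrightarrow> euler_prod q"
    by (simp only: lessThan_Suc_atMost)
  thus ?thesis by (rule LIMSEQ_imp_Suc)
qed

lemma euler_prod_uniform_limit:
  assumes "0 \<le> r" "r < 1"
  shows "uniform_limit (cball 0 r) (\<lambda>n q. \<Prod>k<n. 1 - q ^ Suc k) euler_prod sequentially"
proof -
  have "uniformly_convergent_on (cball 0 r) (\<lambda>n q. \<Prod>k<n. 1 - q ^ Suc k :: complex)"
  proof (rule uniformly_convergent_on_prod')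
    show "uniformly_convergent_on (cball 0 r) (\<lambda>N x. \<Sum>n<N. norm (1 - x ^ Suc n - 1 :: complex))"
    proof (rule Weierstrass_m_test'[where M = "\<lambda>n. \<bar>r\<bar> ^ Suc n"])
      show "norm (norm (1 - x ^ Suc n - 1)) \<le> \<bar>r\<bar> ^ Suc n" if "x \<in> cball 0 r" for n and x :: complex
      proof -
        have "norm x ^ Suc n \<le> \<bar>r\<bar> ^ Suc n" using that by (intro power_mono) auto
        thus ?thesis by (simp add: norm_mult norm_power)
      qed
      show "summable (\<lambda>n. \<bar>r\<bar> ^ Suc n)"
        using assms by (simp add: summable_mult summable_geometric)
    qed
  qed (auto intro!: continuous_intros)
  hence "uniform_limit (cball 0 r) (\<lambda>n q. \<Prod>k<n. 1 - q ^ Suc k) (\<lambda>q::complex. lim (\<lambda>n. \<Prod>k<n. 1 - q ^ Suc k)) sequentially"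
    by (rule uniformly_convergent_uniform_limit_iff[THEN iffD1])
  also have "?this \<longleftrightarrow> ?thesis"
  proof (intro uniform_limit_cong always_eventually allI ballI refl)
    fix q :: complex assume "q \<in> cball 0 r"
    hence "norm q < 1" using assms by simp
    thus "lim (\<lambda>n. \<Prod>k<n. 1 - q ^ Suc k) = euler_prod q"
      by (intro limI euler_prod_LIMSEQ)
  qed
  finally show ?thesis .
qed

lemma euler_prod_holomorphic: "euler_prod holomorphic_on ball 0 1"
proof (rule holomorphic_uniform_sequence[where f = "\<lambda>n q. \<Prod>k<n. 1 - q ^ Suc k"])
  fix x :: complex assume x: "x \<in> ball 0 1"
  define d where "d = (1 - norm x) / 2"
  have d: "d > 0" "norm x + d < 1" using x by (auto simp: d_def field_simps)
  have sub: "cball x d \<subseteq> cball 0 (norm x + d)"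
  proof
    fix y assume "y \<in> cball x d"
    thus "y \<in> cball 0 (norm x + d)" using norm_triangle_ineq[of x "y - x"] by (simp add: dist_norm norm_minus_commute)
  qed
  moreover have "cball 0 (norm x + d) \<subseteq> ball (0::complex) 1" using d by auto
  ultimately have "cball x d \<subseteq> ball 0 1" by blast
  moreover have "uniform_limit (cball x d) (\<lambda>n q. \<Prod>k<n. 1 - q ^ Suc k) euler_prod sequentially"
    by (rule uniform_limit_on_subset[OF euler_prod_uniform_limit[OF _ d(2)] sub]) (use d in simp)
  ultimately show "\<exists>d>0. cball x d \<subseteq> ball 0 1 \<and> uniform_limit (cball x d) (\<lambda>n q. \<Prod>k<n. 1 - q ^ Suc k) euler_prod sequentially"
    using d by blast
qed (auto intro!: holomorphic_intros)

definition delta_quot :: "complex \<Rightarrow> complex" where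
  "delta_quot q = euler_prod q ^ 24"

lemma delta_quot_holomorphic: "delta_quot holomorphic_on ball 0 1"
  unfolding delta_quot_def by (intro holomorphic_intros euler_prod_holomorphic)

lemma delta_axis:
  assumes t: "t > 0"
  defines "q \<equiv> complex_of_real (exp (- 2 * pi * t))"
  shows "q * delta_quot q = of_real (eta_axis t ^ 24)"
proof -
  have "norm q < 1" using t by (simp add: q_def)
  have "(\<lambda>n. complex_of_real (qfact (exp (- 2 * pi * t)) n)) \<longlonglongrightarrow> of_real (exp (pi * t / 12) * eta_axis t)"
    by (intro tendsto_of_real eta_axis_product t)
  also have "(\<lambda>n. complex_of_real (qfact (exp (- 2 * pi * t)) n)) = (\<lambda>n. \<Prod>k<n. 1 - q ^ Suc k)"
    unfolding qfact_def q_def by simp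
  finally have "euler_prod q = of_real (exp (pi * t / 12) * eta_axis t)"
    using euler_prod_LIMSEQ[OF \<open>norm q < 1\<close>] LIMSEQ_unique by blast
  hence "q * delta_quot q = of_real (exp (- 2 * pi * t) * (exp (pi * t / 12) ^ 24 * eta_axis t ^ 24))"
    by (simp add: delta_quot_def q_def power_mult_distrib)
  also have "exp (pi * t / 12) ^ 24 = exp (2 * pi * t)"
    by (simp add: exp_of_nat_mult[symmetric])
  also have "exp (- 2 * pi * t) * (exp (2 * pi * t) * eta_axis t ^ 24) = eta_axis t ^ 24"
    by (simp add: mult.assoc[symmetric] exp_add[symmetric])
  finally show ?thesis .
qed

text \<open>The 24th power clears the root q^(1/24) of eta and turns the factor
  \<open>sqrt t\<close> into t^12, which equals (i t)^12.\<close>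

lemma delta_modular: "disc_modular 12 (\<lambda>q. q * delta_quot q)"
proof (rule disc_modularI_imaginary_axis)
  show "(\<lambda>q. q * delta_quot q) holomorphic_on ball 0 1"
    by (intro holomorphic_intros delta_quot_holomorphic)
  fix t :: real assume t: "t > 0"
  have "complex_of_real (exp (- 2 * pi / t)) * delta_quot (of_real (exp (- 2 * pi / t))) = of_real (eta_axis (1 / t) ^ 24)"
    using delta_axis[of "1 / t"] t by simp
  also have "eta_axis (1 / t) ^ 24 = (sqrt t ^ 2) ^ 12 * eta_axis t ^ 24"
    unfolding eta_axis_inversion[OF t] power_mult_distrib power_mult[symmetric] by simp
  also have "complex_of_real ((sqrt t ^ 2) ^ 12 * eta_axis t ^ 24) = (\<i> * of_real t) ^ 12 * of_real (eta_axis t ^ 24)"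
  proof -
    have "\<i> ^ 12 = (\<i> ^ 2) ^ 6" by (simp only: power_mult[symmetric]) simp
    thus ?thesis using t by (simp add: power_mult_distrib)
  qed
  finally show "of_real (exp (- 2 * pi / t)) * delta_quot (of_real (exp (- 2 * pi / t))) =
      (\<i> * of_real t) ^ 12 * (of_real (exp (- 2 * pi * t)) * delta_quot (of_real (exp (- 2 * pi * t))))"
    unfolding delta_axis[OF t] .
qed

interpretation Delta: discriminant delta_quot
  by (unfold_locales; (rule delta_quot_holomorphic delta_modular)?) (simp add: delta_quot_def euler_prod_nonzero)

section \<open>Taylor coefficients of the discriminant\<close>

text \<open>Over an arbitrary ring, because \<open>ramanujan_tau\<close> is defined by an integer
  series while the Taylor expansion is complex.\<close>

definition tau_fps :: "nat \<Rightarrow> 'a::comm_ring_1 fps" where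
  "tau_fps N = (\<Prod>k\<in>{1..N}. (1 - fps_X ^ k) ^ 24)"

lemma fps_nth_mult_one_minus_X_power:
  fixes F :: "'a::comm_ring_1 fps"
  assumes "n < k"
  shows "fps_nth (F * (1 - fps_X ^ k) ^ j) n = fps_nth F n"
proof (induction j)
  case (Suc j)
  have "F * (1 - fps_X ^ k) ^ Suc j = F * (1 - fps_X ^ k) ^ j - (F * (1 - fps_X ^ k) ^ j) * fps_X ^ k"
    by (simp add: algebra_simps)
  thus ?case using Suc assms by (simp add: fps_X_power_mult_right_nth)
qed simp

text \<open>Factors with index above n do not affect the n-th coefficient, so it is already that of
  the product up to n + 1 in the definition of \<open>ramanujan_tau\<close>.\<close>

lemma tau_fps_nth:
  assumes "n < N"
  shows "fps_nth (tau_fps N) n = ramanujan_tau (Suc n)"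
  using assms
proof (induction N)
  case (Suc N)
  show ?case
  proof (cases "n = N")
    case True
    thus ?thesis by (simp add: tau_fps_def ramanujan_tau_def)
  next
    case False
    have "(tau_fps (Suc N) :: int fps) = tau_fps N * (1 - fps_X ^ Suc N) ^ 24"
      by (simp add: tau_fps_def mult.commute)
    moreover have "fps_nth (tau_fps N * (1 - fps_X ^ Suc N) ^ 24) n = fps_nth (tau_fps N :: int fps) n"
      using Suc.prems by (rule fps_nth_mult_one_minus_X_power)
    ultimately show ?thesis using Suc False by simp
  qed
qed simp

lemma fps_nth_of_int_mult:
  fixes F :: "complex fps" and G :: "int fps"
  assumes "\<And>n. fps_nth F n = of_int (fps_nth G n)" "\<And>n. fps_nth F' n = of_int (fps_nth G' n)"
  shows "fps_nth (F * F') n = of_int (fps_nth (G * G') n)"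
  by (simp add: fps_mult_nth assms)

lemma tau_fps_of_int: "fps_nth (tau_fps N) n = (of_int (fps_nth (tau_fps N) n) :: complex)"
proof (induction N arbitrary: n)
  case (Suc N)
  have pw: "fps_nth ((1 - fps_X ^ k) ^ j) n = (of_int (fps_nth ((1 - fps_X ^ k) ^ j) n) :: complex)" for k j n
  proof (induction j arbitrary: n)
    case (Suc j)
    show ?case unfolding power_Suc by (rule fps_nth_of_int_mult) (auto simp: Suc)
  qed simp
  have "(tau_fps (Suc N) :: complex fps) = tau_fps N * (1 - fps_X ^ Suc N) ^ 24"
    "(tau_fps (Suc N) :: int fps) = tau_fps N * (1 - fps_X ^ Suc N) ^ 24"
    by (simp_all add: tau_fps_def mult.commute)
  thus ?case by (simp only:) (rule fps_nth_of_int_mult[OF Suc pw])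
qed (simp add: tau_fps_def)

lemma finite_prod_has_fps_expansion:
  "(\<lambda>q::complex. (\<Prod>k<N. 1 - q ^ Suc k) ^ 24) has_fps_expansion tau_fps N"
proof (induction N)
  case (Suc N)
  have "(\<lambda>q::complex. (\<Prod>k<N. 1 - q ^ Suc k) ^ 24 * (1 - q ^ Suc N) ^ 24) has_fps_expansion tau_fps N * (1 - fps_X ^ Suc N) ^ 24"
    by (intro fps_expansion_intros Suc)
  thus ?case by (simp add: power_mult_distrib tau_fps_def mult.commute del: power_Suc)
qed (simp add: tau_fps_def)

text \<open>The Taylor coefficients of the partial products converge, and they are eventually constant.\<close>
lemma delta_quot_has_fps_expansion:
  "delta_quot has_fps_expansion Abs_fps (\<lambda>n. of_int (ramanujan_tau (Suc n)))"
proof -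
  define F where "F = fps_expansion delta_quot 0"
  define P where "P = (\<lambda>N q. (\<Prod>k<N. 1 - q ^ Suc k :: complex) ^ 24)"
  have F: "delta_quot has_fps_expansion F"
    unfolding F_def by (rule analytic_at_imp_has_fps_expansion_0)
      (auto simp: analytic_at intro!: exI[of _ "ball 0 1"] delta_quot_holomorphic)
  have "uniform_limit (cball 0 (1 / 2)) (\<lambda>N q. (\<Prod>k<N. 1 - q ^ Suc k :: complex) ^ j) (\<lambda>q. euler_prod q ^ j) sequentially" for j
  proof (induction j)
    case (Suc j)
    have bdd: "bounded ((\<lambda>q. euler_prod q ^ i) ` cball 0 (1 / 2))" for i
      by (intro compact_imp_bounded compact_continuous_image compact_cball continuous_intros
          holomorphic_on_imp_continuous_on holomorphic_on_subset[OF euler_prod_holomorphic]) auto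
    have "uniform_limit (cball 0 (1 / 2))
        (\<lambda>N q. (\<Prod>k<N. 1 - q ^ Suc k :: complex) * (\<Prod>k<N. 1 - q ^ Suc k) ^ j)
        (\<lambda>q. euler_prod q * euler_prod q ^ j) sequentially"
      by (rule uniform_lim_mult[OF euler_prod_uniform_limit Suc.IH]) (use bdd[of 1] bdd[of j] in simp_all)
    thus ?case by (simp only: power_Suc)
  qed (simp add: uniform_limit_const)
  hence "uniform_limit (ball 0 (1 / 2)) P delta_quot sequentially"
    unfolding P_def delta_quot_def by (rule uniform_limit_on_subset) auto
  hence lim: "(\<lambda>N. (deriv ^^ n) (P N) 0) \<longlonglongrightarrow> (deriv ^^ n) delta_quot 0" for n
    by (rule higher_deriv_complex_uniform_limit)
       (auto simp: P_def intro!: always_eventually holomorphic_intros)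
  have "fps_nth F n = of_int (ramanujan_tau (Suc n))" for n
  proof -
    have "(deriv ^^ n) (P N) 0 = fact n * of_int (ramanujan_tau (Suc n))" if "N > n" for N
      using fps_nth_fps_expansion[OF finite_prod_has_fps_expansion[of N], of n]
        tau_fps_of_int[of N n] tau_fps_nth[OF that] by (simp add: P_def field_simps)
    hence "(\<lambda>N. (deriv ^^ n) (P N) 0) \<longlonglongrightarrow> fact n * of_int (ramanujan_tau (Suc n))"
      by (intro tendsto_eventually eventually_sequentiallyI[of "Suc n"]) auto
    hence "(deriv ^^ n) delta_quot 0 = fact n * of_int (ramanujan_tau (Suc n))"
      using lim[of n] LIMSEQ_unique by blast
    thus ?thesis using fps_nth_fps_expansion[OF F, of n] by simp
  qed
  hence "F = Abs_fps (\<lambda>n. of_int (ramanujan_tau (Suc n)))" by (simp add: fps_eq_iff)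
  thus ?thesis using F by simp
qed

subsection \<open>The lattices \<open>D\<^sub>n\<^sup>+\<close> and test polynomials\<close>

text \<open>For n divisible by 8 this is \<open>D_n\<close> together with its coset of the
  all-halves vector; n = 8 gives \<open>W8\<close>, and n = 16 the test lattice of rank 16. The
  index \<open>o'\<close> is a reference coordinate with which the others are compared modulo
  1.\<close>

definition Dplus :: "'n \<Rightarrow> (real^'n) set" where
  "Dplus o' = {x. (\<forall>i. 2 * x$i \<in> \<int>) \<and> (\<forall>i. x$i - x$o' \<in> \<int>) \<and>
              (\<exists>k::int. (\<Sum>i\<in>UNIV. x$i) = 2 * of_int k)}"

lemma W8_eq_Dplus: "W8 = Dplus 1"
  unfolding W8_def Dplus_def ..

text \<open>Referring all coordinates to \<open>o'\<close> leaves, on \<open>Dplus\<close>, a sum of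
  products of integers and terms controlled by the even coordinate sums and by the divisibility of
  n.\<close>

lemma inner_shift:
  fixes x y :: "real^'n"
  shows "x \<bullet> y = (\<Sum>i\<in>UNIV. (x$i - x$o') * (y$i - y$o')) + x$o' * (\<Sum>i\<in>UNIV. y$i) +
     y$o' * (\<Sum>i\<in>UNIV. x$i) - real CARD('n) * (x$o' * y$o')"
  by (simp add: inner_vec_def algebra_simps sum.distrib sum_subtractf sum_distrib_left sum_distrib_right)

lemma inner_axis_1: "axis i 1 \<bullet> (x :: real^'n) = x$i"
  by (simp add: inner_axis' )

lemma axis_pair_in_Dplus:
  fixes i j o' :: "'n::finite"
  assumes "i \<noteq> j"
  shows "axis i 1 + axis j 1 \<in> Dplus o'" "axis i 1 - axis j 1 \<in> Dplus o'"
proof -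
  have sum: "(\<Sum>l\<in>UNIV. (axis i (1::real) :: real^'n)$l) = 1" for i :: 'n
    by (simp add: axis_def)
  have int: "(axis i (1::real) :: real^'n)$l \<in> \<int>" for i l :: 'n
    by (simp add: axis_def)
  have "(\<Sum>l\<in>UNIV. (axis i 1 + axis j 1 :: real^'n)$l) = 2 * of_int 1"
    "(\<Sum>l\<in>UNIV. (axis i 1 - axis j 1 :: real^'n)$l) = 2 * of_int 0"
    by (simp_all add: sum.distrib sum_subtractf sum)
  thus "axis i 1 + axis j 1 \<in> Dplus o'" "axis i 1 - axis j 1 \<in> Dplus o'"
    unfolding Dplus_def mem_Collect_eq
    by (intro conjI allI exI; (assumption | auto intro!: Ints_mult Ints_add Ints_diff int))+
qed

lemma half_in_Dplus:
  assumes "8 dvd CARD('n::finite)"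
  shows "(\<chi> i. 1 / 2) \<in> Dplus (o' :: 'n)"
proof -
  obtain p where p: "CARD('n) = 8 * p" using assms by (elim dvdE)
  have "(\<Sum>i\<in>UNIV. ((\<chi> i. 1 / 2) :: real^'n)$i) = 2 * of_int (2 * int p)"
    by (simp add: p)
  thus ?thesis unfolding Dplus_def by (auto intro!: exI[of _ "2 * int p"])
qed

text \<open>Integrality of the inner products follows from \<open>inner_shift\<close>. Conversely
  the vectors e_i + e_j, e_i - e_j and the all-halves vector already force the three defining
  conditions on a dual vector.\<close>

lemma Dplus_selfdual:
  assumes card: "8 dvd CARD('n::finite)"
  shows "Dplus (o' :: 'n) = dual_lattice (Dplus o')"
proof
  obtain p where p: "CARD('n) = 8 * p" using card by (elim dvdE)
  show "Dplus o' \<subseteq> dual_lattice (Dplus o')"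
  proof
    fix y assume y: "y \<in> Dplus o'"
    have "x \<bullet> y \<in> \<int>" if x: "x \<in> Dplus o'" for x
    proof -
      obtain k l :: int where k: "(\<Sum>i\<in>UNIV. x$i) = 2 * of_int k" and l: "(\<Sum>i\<in>UNIV. y$i) = 2 * of_int l"
        using x y by (auto simp: Dplus_def)
      have "x \<bullet> y = (\<Sum>i\<in>UNIV. (x$i - x$o') * (y$i - y$o')) + (2 * x$o') * of_int l +
          (2 * y$o') * of_int k - of_nat (2 * p) * ((2 * x$o') * (2 * y$o'))"
        unfolding inner_shift[of x y o'] k l p by simp
      also have "\<dots> \<in> \<int>"
      proof -
        have x2: "2 * x$o' \<in> \<int>" and y2: "2 * y$o' \<in> \<int>" using x y by (auto simp: Dplus_def)
        have "(\<Sum>i\<in>UNIV. (x$i - x$o') * (y$i - y$o')) \<in> \<int>"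
          using x y by (intro Ints_sum Ints_mult) (auto simp: Dplus_def)
        thus ?thesis
          by (intro Ints_add Ints_diff Ints_mult[OF x2 Ints_of_int] Ints_mult[OF y2 Ints_of_int]
              Ints_mult[OF Ints_of_nat Ints_mult[OF x2 y2]])
      qed
      finally show ?thesis .
    qed
    thus "y \<in> dual_lattice (Dplus o')" by (simp add: dual_lattice_def)
  qed
  show "dual_lattice (Dplus o') \<subseteq> Dplus o'"
  proof
    fix y assume "y \<in> dual_lattice (Dplus o')"
    hence y: "x \<bullet> y \<in> \<int>" if "x \<in> Dplus o'" for x using that by (simp add: dual_lattice_def)
    have plus: "y$i + y$j \<in> \<int>" and minus: "y$i - y$j \<in> \<int>" if "i \<noteq> j" for i j
      using y[OF axis_pair_in_Dplus(1)[OF that]] y[OF axis_pair_in_Dplus(2)[OF that]]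
      by (simp_all add: inner_add_left inner_diff_left inner_axis_1)
    have "2 * y$i \<in> \<int>" for i
    proof -
      have "p > 0" using p by (metis mult_0_right neq0_conv zero_less_card_finite)
      hence "CARD('n) \<noteq> card {i}" using p by simp
      then obtain j where "j \<noteq> i" by (metis UNIV_eq_I singletonI insertI1 singletonD)
      from Ints_add[OF plus[OF this] minus[OF this]] Ints_diff[OF plus[OF this] minus[OF this]]
      show ?thesis by simp
    qed
    moreover have "y$i - y$o' \<in> \<int>" for i
      using minus[of i o'] by (cases "i = o'") auto
    moreover have "(\<Sum>i\<in>UNIV. y$i) / 2 \<in> \<int>"
      using y[OF half_in_Dplus[OF card]] by (simp add: inner_vec_def sum_divide_distrib)
    then obtain k :: int where "(\<Sum>i\<in>UNIV. y$i) / 2 = of_int k" by (auto elim!: Ints_cases)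
    hence "(\<Sum>i\<in>UNIV. y$i) = 2 * of_int k" by simp
    ultimately show "y \<in> Dplus o'" unfolding Dplus_def by blast
  qed
qed

text \<open>For the integers a_i = x_i - x_o' the sum of the squares is congruent modulo 2 to the
  sum of the a_i, and the latter is 2 k - 4 p z.\<close>

lemma Dplus_even:
  assumes card: "8 dvd CARD('n::finite)" and x: "x \<in> Dplus (o' :: 'n)"
  shows "\<exists>k::int. x \<bullet> x = 2 * of_int k"
proof -
  obtain p where p: "CARD('n) = 8 * p" using card by (elim dvdE)
  obtain k :: int where k: "(\<Sum>i\<in>UNIV. x$i) = 2 * of_int k" using x by (auto simp: Dplus_def)
  have "\<exists>a. x$i - x$o' = of_int a" for i using x by (auto simp: Dplus_def elim!: Ints_cases)
  then obtain a :: "'n \<Rightarrow> int" where a: "\<And>i. x$i - x$o' = of_int (a i)" by metis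
  obtain z :: int where z: "2 * x$o' = of_int z" using x by (auto simp: Dplus_def elim!: Ints_cases)
  have "real_of_int (\<Sum>i\<in>UNIV. a i) = (\<Sum>i\<in>UNIV. x$i - x$o')" by (simp add: a)
  also have "\<dots> = 2 * of_int k - of_nat (4 * p) * (2 * x$o')" by (simp add: sum_subtractf k p)
  also have "\<dots> = of_int (2 * k - 4 * int p * z)" unfolding z by simp
  finally have "(\<Sum>i\<in>UNIV. a i) = 2 * k - 4 * int p * z" by (simp only: of_int_eq_iff)
  hence "even (\<Sum>i\<in>UNIV. a i)" by simp
  moreover have "even (\<Sum>i\<in>UNIV. a i * (a i - 1))" by (intro dvd_sum) simp
  ultimately have "even ((\<Sum>i\<in>UNIV. a i * (a i - 1)) + (\<Sum>i\<in>UNIV. a i))" by simp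
  also have "(\<Sum>i\<in>UNIV. a i * (a i - 1)) + (\<Sum>i\<in>UNIV. a i) = (\<Sum>i\<in>UNIV. a i * a i)"
    by (simp add: sum.distrib[symmetric] algebra_simps)
  finally obtain m where m: "(\<Sum>i\<in>UNIV. a i * a i) = 2 * m" by (elim evenE)
  have "x \<bullet> x = of_int (\<Sum>i\<in>UNIV. a i * a i) + 2 * (2 * x$o') * of_int k - 2 * of_nat p * ((2 * x$o') * (2 * x$o'))"
    unfolding inner_shift[of x x o'] k p a by simp
  also have "\<dots> = 2 * of_int (m + z * k - int p * (z * z))" unfolding m z by (simp add: algebra_simps)
  finally show ?thesis by blast
qed

text \<open>An explicit basis: 2 e_o', the all-halves vector in the place of i1, and e_i - e_o' for
  the other indices. The coefficients \<open>cf\<close> solve a triangular system: the coordinate i1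
  fixes the multiple of the all-halves vector, the remaining coordinates those of e_i - e_o', and
  the coordinate sum that of 2 e_o'.\<close>

lemma Dplus_full_lattice:
  fixes o' i1 :: "'n::finite"
  assumes card: "8 dvd CARD('n)" and ne: "i1 \<noteq> o'"
  shows "full_lattice (Dplus o')"
proof -
  interpret selfdual_lattice "Dplus o'"
    by unfold_locales (rule Dplus_selfdual[OF card])
  obtain p where p: "CARD('n) = 8 * p" using card by (elim dvdE)
  define b :: "'n \<Rightarrow> real^'n" where
    "b = (\<lambda>i. if i = o' then 2 *\<^sub>R axis o' 1 else if i = i1 then (\<chi> i. 1 / 2) else axis i 1 - axis o' 1)"
  define cf :: "real^'n \<Rightarrow> 'n \<Rightarrow> real" where
    "cf = (\<lambda>x i. if i = o' then (\<Sum>i\<in>UNIV. x$i) / 2 - of_nat (2 * p) * (2 * x$i1)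
                 else if i = i1 then 2 * x$i1 else x$i - x$i1)"
  have expand: "(\<Sum>i\<in>UNIV. cf x i *\<^sub>R b i) = x" for x
  proof -
    define R where "R = UNIV - {o', i1}"
    have split: "(\<Sum>i\<in>UNIV. f i) = f o' + (f i1 + (\<Sum>i\<in>R. f i))" for f :: "'n \<Rightarrow> 'c::comm_monoid_add"
    proof -
      have "UNIV = insert o' (insert i1 R)" by (auto simp: R_def)
      thus ?thesis using ne by (metis (no_types, lifting) Diff_iff R_def finite insertI1 insert_iff sum.insert singletonD)
    qed
    have card_R: "real (card R) = real CARD('n) - 2"
      using split[of "\<lambda>_. 1 :: real"] by simp
    have "(\<Sum>i\<in>R. cf x i *\<^sub>R b i) = (\<Sum>i\<in>R. (x$i - x$i1) *\<^sub>R (axis i 1 - axis o' 1))"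
      by (intro sum.cong) (auto simp: R_def cf_def b_def)
    hence eq: "(\<Sum>i\<in>UNIV. cf x i *\<^sub>R b i) = cf x o' *\<^sub>R (2 *\<^sub>R axis o' 1) +
        (cf x i1 *\<^sub>R (\<chi> i. 1 / 2) + (\<Sum>i\<in>R. (x$i - x$i1) *\<^sub>R (axis i 1 - axis o' 1)))"
      unfolding split using ne by (simp add: b_def)
    have cf1: "cf x i1 = 2 * x$i1" using ne by (simp add: cf_def)
    show ?thesis
    proof (rule vec_eq_iff[THEN iffD2], rule allI)
      fix j
      have "(\<Sum>i\<in>UNIV. cf x i *\<^sub>R b i)$j = 2 * cf x o' * (if j = o' then 1 else 0) + x$i1 +
          (\<Sum>i\<in>R. (x$i - x$i1) * ((if j = i then 1 else 0) - (if j = o' then 1 else 0)))"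
        unfolding eq cf1 by (simp add: axis_def)
      also have "\<dots> = x$j"
      proof (cases "j = o'")
        case True
        have "(\<Sum>i\<in>R. (x$i - x$i1) * ((if j = i then 1 else 0) - (if j = o' then 1 else 0))) =
            (\<Sum>i\<in>R. x$i1 - x$i)"
          by (intro sum.cong) (auto simp: True R_def)
        also have "\<dots> = real (card R) * x$i1 - ((\<Sum>i\<in>UNIV. x$i) - x$o' - x$i1)"
          unfolding split[of "\<lambda>i. x$i"] by (simp add: sum_subtractf)
        finally show ?thesis using True unfolding card_R by (simp add: cf_def p algebra_simps)
      next
        case False
        show ?thesis
        proof (cases "j = i1")
          case True
          have "(\<Sum>i\<in>R. (x$i - x$i1) * ((if j = i then 1 else 0) - (if j = o' then 1 else 0))) = 0"
            by (intro sum.neutral) (use ne in \<open>auto simp: True R_def\<close>)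
          thus ?thesis using True False by simp
        next
          case j: False
          have "(\<Sum>i\<in>R. (x$i - x$i1) * ((if j = i then 1 else 0) - (if j = o' then 1 else 0))) =
              (\<Sum>i\<in>R. if i = j then x$j - x$i1 else 0)"
            using False by (intro sum.cong) auto
          also have "\<dots> = x$j - x$i1" using False j by (simp add: R_def)
          finally show ?thesis using False by simp
        qed
      qed
      finally show "(\<Sum>i\<in>UNIV. cf x i *\<^sub>R b i)$j = x$j" .
    qed
  qed
  have "x \<in> span (range b)" for x
  proof -
    have "(\<Sum>i\<in>UNIV. cf x i *\<^sub>R b i) \<in> span (range b)" by (intro span_sum span_scale span_base) auto
    thus ?thesis by (simp only: expand)
  qed
  hence sp: "UNIV \<subseteq> span (range b)" by blast
  have dimU: "dim (UNIV :: (real^'n) set) = CARD('n)" by simp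
  have "card (range b) \<le> CARD('n)" by (rule card_image_le) simp
  hence indep: "independent (range b)"
    using sp dimU by (intro card_le_dim_spanning[of _ UNIV]) auto
  have "CARD('n) \<le> card (range b)"
    using dim_le_card[OF sp] dimU by simp
  with \<open>card (range b) \<le> CARD('n)\<close> have inj: "inj b" by (intro eq_card_imp_inj_on) auto
  have b_mem: "b i \<in> Dplus o'" for i
  proof -
    have "axis o' 1 + axis i1 1 + (axis o' 1 - axis i1 1) \<in> Dplus o'"
      using axis_pair_in_Dplus[OF ne[symmetric]] by (rule add_mem)
    hence "2 *\<^sub>R axis o' 1 \<in> Dplus o'" by (simp add: scaleR_2)
    thus ?thesis unfolding b_def using half_in_Dplus[OF card] axis_pair_in_Dplus by auto
  qed
  have "Dplus o' = {(\<Sum>i\<in>UNIV. of_int (a i) *\<^sub>R b i) | a :: 'n \<Rightarrow> int. True}"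
  proof (intro equalityI subsetI)
    fix x assume x: "x \<in> Dplus o'"
    have "cf x i \<in> \<int>" for i
    proof -
      have "(\<Sum>i\<in>UNIV. x$i) / 2 \<in> \<int>" using x by (auto simp: Dplus_def)
      moreover have "x$i - x$i1 = (x$i - x$o') - (x$i1 - x$o')" by simp
      hence "x$i - x$i1 \<in> \<int>" using x by (metis (mono_tags, lifting) Dplus_def Ints_diff mem_Collect_eq)
      moreover have x1: "2 * x$i1 \<in> \<int>" using x by (auto simp: Dplus_def)
      ultimately show ?thesis
        using Ints_diff[OF _ Ints_mult[OF Ints_of_nat x1]] by (simp only: cf_def split: if_split) blast
    qed
    hence "\<exists>a. cf x i = of_int a" for i by (auto elim!: Ints_cases)
    then obtain a :: "'n \<Rightarrow> int" where "\<And>i. cf x i = of_int (a i)" by metis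
    thus "x \<in> {(\<Sum>i\<in>UNIV. of_int (a i) *\<^sub>R b i) | a :: 'n \<Rightarrow> int. True}" using expand[of x] by auto
  next
    fix x assume "x \<in> {(\<Sum>i\<in>UNIV. of_int (a i) *\<^sub>R b i) | a :: 'n \<Rightarrow> int. True}"
    thus "x \<in> Dplus o'" by (auto intro!: sum_mem scale_mem b_mem)
  qed
  thus ?thesis unfolding full_lattice_def using inj indep by blast
qed

lemma Dplus_even_selfdual_lattice:
  fixes o' i1 :: "'n::finite"
  assumes card: "8 dvd CARD('n)" and ne: "i1 \<noteq> o'"
  shows "even_selfdual_lattice (Dplus o')"
  using Dplus_full_lattice[OF assms] Dplus_selfdual[OF card, of o'] Dplus_even[OF card]
  unfolding even_selfdual_lattice_def dual_lattice_def by blast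

section \<open>Harmonic test polynomials in two coordinates\<close>

definition hpoly :: "'n \<Rightarrow> 'n \<Rightarrow> nat \<Rightarrow> real^'n \<Rightarrow> real" where
  "hpoly i j k x = Re ((of_real (x$i) + \<i> * of_real (x$j)) ^ k)"

lemma hpoly_expand:
  "hpoly i j k x = (\<Sum>m\<le>k. real (k choose m) * Re (\<i> ^ m) * ((x$i) ^ (k - m) * (x$j) ^ m))"
proof -
  have "(of_real (x$i) + \<i> * of_real (x$j)) ^ k =
      (\<Sum>m\<le>k. of_real (real (k choose m) * ((x$i) ^ (k - m) * (x$j) ^ m)) * \<i> ^ m)"
    by (subst add.commute, subst binomial_ring) (simp add: power_mult_distrib mult_ac)
  thus ?thesis unfolding hpoly_def by (simp add: mult_ac)
qed

text \<open>The real part of a holomorphic function of x_i + i x_j. On coefficients, the two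
  surviving terms of the Laplacian cancel because i^(m + 2) = - i^m and the binomial coefficients
  times their differentiation factors agree.\<close>

lemma hom_harmonic_hpoly:
  assumes ij: "i \<noteq> (j :: 'n::finite)"
  shows "hom_harmonic_poly k (hpoly i j k)"
proof -
  define supp :: "('n \<Rightarrow> nat) \<Rightarrow> bool" where "supp = (\<lambda>\<alpha>. \<forall>l. l \<noteq> i \<longrightarrow> l \<noteq> j \<longrightarrow> \<alpha> l = 0)"
  define c where "c = (\<lambda>\<alpha>. if supp \<alpha> then real (k choose \<alpha> j) * Re (\<i> ^ \<alpha> j) else 0)"
  define e :: "nat \<Rightarrow> 'n \<Rightarrow> nat" where "e = (\<lambda>m. (\<lambda>_. 0)(i := k - m, j := m))"
  define A where "A = {\<alpha> :: 'n \<Rightarrow> nat. sum \<alpha> UNIV = k}"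
  have sum2: "sum \<alpha> UNIV = \<alpha> i + \<alpha> j" if "supp \<alpha>" for \<alpha>
  proof -
    have "sum \<alpha> UNIV = sum \<alpha> {i, j}" by (rule sum.mono_neutral_right) (use that in \<open>auto simp: supp_def\<close>)
    thus ?thesis using ij by simp
  qed
  have supp_e: "supp (e m)" for m by (auto simp: supp_def e_def)
  have fin: "finite A"
  proof (rule finite_subset)
    have "\<alpha> l \<le> k" if "\<alpha> \<in> A" for \<alpha> l using that member_le_sum[of l UNIV \<alpha>] by (auto simp: A_def)
    thus "A \<subseteq> Pi\<^sub>E UNIV (\<lambda>_. {..k})" by (auto simp: PiE_UNIV_domain)
  qed (auto intro!: finite_PiE)
  have "hpoly i j k x = (\<Sum>\<alpha>\<in>A. c \<alpha> * (\<Prod>l\<in>UNIV. (x$l) ^ \<alpha> l))" for x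
  proof -
    have "(\<Sum>\<alpha>\<in>A. c \<alpha> * (\<Prod>l\<in>UNIV. (x$l) ^ \<alpha> l)) = (\<Sum>\<alpha>\<in>e ` {..k}. c \<alpha> * (\<Prod>l\<in>UNIV. (x$l) ^ \<alpha> l))"
    proof (rule sum.mono_neutral_right[OF fin])
      show "e ` {..k} \<subseteq> A"
        using sum2[OF supp_e] ij by (auto simp: A_def e_def)
      show "\<forall>\<alpha>\<in>A - e ` {..k}. c \<alpha> * (\<Prod>l\<in>UNIV. (x$l) ^ \<alpha> l) = 0"
      proof
        fix \<alpha> assume \<alpha>: "\<alpha> \<in> A - e ` {..k}"
        have "\<not> supp \<alpha>"
        proof
          assume s: "supp \<alpha>"
          hence "\<alpha> i + \<alpha> j = k" using sum2 \<alpha> by (auto simp: A_def)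
          hence "\<alpha> = e (\<alpha> j)" "\<alpha> j \<le> k" using s ij by (auto simp: e_def supp_def fun_eq_iff)
          thus False using \<alpha> by auto
        qed
        thus "c \<alpha> * (\<Prod>l\<in>UNIV. (x$l) ^ \<alpha> l) = 0" by (simp add: c_def)
      qed
    qed
    also have "\<dots> = (\<Sum>m\<le>k. c (e m) * (\<Prod>l\<in>UNIV. (x$l) ^ e m l))"
      by (subst sum.reindex) (auto simp: inj_on_def e_def fun_eq_iff intro: )
    also have "\<dots> = hpoly i j k x"
      unfolding hpoly_expand
    proof (rule sum.cong[OF refl])
      fix m
      have "(\<Prod>l\<in>UNIV. (x$l) ^ e m l) = (\<Prod>l\<in>{i, j}. (x$l) ^ e m l)"
        by (rule prod.mono_neutral_right) (auto simp: e_def)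
      also have "\<dots> = (x$i) ^ (k - m) * (x$j) ^ m" using ij by (simp add: e_def)
      finally show "c (e m) * (\<Prod>l\<in>UNIV. (x$l) ^ e m l) = real (k choose m) * Re (\<i> ^ m) * ((x$i) ^ (k - m) * (x$j) ^ m)"
        using supp_e[of m] by (simp add: c_def e_def)
    qed
    finally show ?thesis ..
  qed
  moreover have "(\<Sum>l\<in>UNIV. real ((\<beta> l + 2) * (\<beta> l + 1)) * c (\<beta>(l := \<beta> l + 2))) = 0"
    if \<beta>: "sum \<beta> UNIV + 2 = k" for \<beta>
  proof (cases "supp \<beta>")
    case False
    then obtain l0 where l0: "l0 \<noteq> i" "l0 \<noteq> j" "\<beta> l0 \<noteq> 0" by (auto simp: supp_def)
    have "\<not> supp (\<beta>(l := \<beta> l + 2))" for l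
      unfolding supp_def using l0 by (intro notI) (drule spec[of _ l0], auto split: if_splits)
    thus ?thesis by (simp add: c_def)
  next
    case True
    have k: "k = \<beta> i + \<beta> j + 2" using sum2[OF True] \<beta> by simp
    have "(\<Sum>l\<in>UNIV. real ((\<beta> l + 2) * (\<beta> l + 1)) * c (\<beta>(l := \<beta> l + 2))) =
        (\<Sum>l\<in>{i, j}. real ((\<beta> l + 2) * (\<beta> l + 1)) * c (\<beta>(l := \<beta> l + 2)))"
      by (rule sum.mono_neutral_right) (auto simp: c_def supp_def)
    also have "\<dots> = real ((\<beta> i + 2) * (\<beta> i + 1)) * (real (k choose \<beta> j) * Re (\<i> ^ \<beta> j)) +
        real ((\<beta> j + 2) * (\<beta> j + 1)) * (real (k choose (\<beta> j + 2)) * Re (\<i> ^ (\<beta> j + 2)))"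
    proof -
      have "supp (\<beta>(i := \<beta> i + 2))" "supp (\<beta>(j := \<beta> j + 2))" using True by (auto simp: supp_def)
      thus ?thesis using ij by (simp add: c_def)
    qed
    also have "Re (\<i> ^ (\<beta> j + 2)) = - Re (\<i> ^ \<beta> j)" by (simp add: power_add)
    also have "real ((\<beta> i + 2) * (\<beta> i + 1)) * real (k choose \<beta> j) = real ((\<beta> j + 2) * (\<beta> j + 1)) * real (k choose (\<beta> j + 2))"
    proof -
      have b1: "real (k choose \<beta> j) = fact k / (fact (\<beta> j) * fact (\<beta> i + 2))"
        by (subst binomial_fact) (auto simp: k)
      have b2: "real (k choose (\<beta> j + 2)) = fact k / (fact (\<beta> j + 2) * fact (\<beta> i))"
        by (subst binomial_fact) (auto simp: k)
      have f: "fact (n + 2) = real ((n + 2) * (n + 1)) * fact n" for n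
        by (simp add: algebra_simps)
      have cancel: "A * (F / (u * (A * v))) = B * (F / (B * u * v))" if "A \<noteq> 0" "B \<noteq> 0" for A B F u v :: real
        using that by simp
      show ?thesis
        unfolding b1 b2 f by (rule cancel; subst of_nat_eq_0_iff; simp)
    qed
    hence "real ((\<beta> i + 2) * (\<beta> i + 1)) * (real (k choose \<beta> j) * Re (\<i> ^ \<beta> j)) +
        real ((\<beta> j + 2) * (\<beta> j + 1)) * (real (k choose (\<beta> j + 2)) * - Re (\<i> ^ \<beta> j)) = 0"
      by (simp only: mult.assoc[symmetric] mult_minus_right)
    finally show ?thesis .
  qed
  ultimately show ?thesis unfolding hom_harmonic_poly_def A_def by (intro exI[of _ c]) auto
qed

subsection \<open>Shells of even self-dual lattices\<close>

text \<open>Makes the theta series of a harmonic polynomial of positive degree a cusp form.\<close>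

lemma hom_poly_zero:
  fixes P :: "real^'n \<Rightarrow> real"
  assumes "hom_harmonic_poly k P" "k \<ge> 1"
  shows "P 0 = 0"
proof -
  obtain c where c: "P = (\<lambda>x. \<Sum>\<alpha>\<in>{\<alpha>. sum \<alpha> UNIV = k}. c \<alpha> * (\<Prod>i\<in>UNIV. (x$i) ^ (\<alpha> i)))"
    using assms(1) unfolding hom_harmonic_poly_def by blast
  have zero: "(\<Prod>i\<in>UNIV. ((0::real^'n)$i) ^ (\<alpha> i)) = 0" if "sum \<alpha> UNIV = k" for \<alpha>
  proof -
    have "sum \<alpha> UNIV \<noteq> 0" using that assms(2) by simp
    then obtain i where "\<alpha> i \<noteq> 0" by (auto simp: sum_eq_0_iff)
    thus ?thesis by (intro prod_zero) auto
  qed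
  show ?thesis
    unfolding c by (intro sum.neutral ballI) (simp only: mem_Collect_eq zero mult_zero_right)
qed

locale even_lattice = selfdual_lattice L for L :: "(real^'n) set" +
  assumes even: "x \<in> L \<Longrightarrow> \<exists>k::int. x \<bullet> x = 2 * of_int k"
    and card_dvd: "8 dvd CARD('n)"
begin

definition shell_sum :: "(real^'n \<Rightarrow> real) \<Rightarrow> nat \<Rightarrow> real" where
  "shell_sum P m = (\<Sum>x\<in>shell L (real (2 * m)). P x)"

lemma bij_betw_shells: "bij_betw snd (Sigma UNIV (\<lambda>m. shell L (real (2 * m)))) L"
proof (rule bij_betw_imageI)
  show "inj_on snd (Sigma UNIV (\<lambda>m. shell L (real (2 * m))))"
    by (auto simp: inj_on_def shell_def)
  show "snd ` (Sigma UNIV (\<lambda>m. shell L (real (2 * m)))) = L"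
  proof (intro equalityI subsetI)
    fix x assume x: "x \<in> L"
    then obtain k :: int where k: "x \<bullet> x = 2 * of_int k" using even by blast
    moreover have "x \<bullet> x \<ge> 0" by simp
    ultimately have "x \<bullet> x = real (2 * nat k)" by simp
    hence "(nat k, x) \<in> Sigma UNIV (\<lambda>m. shell L (real (2 * m)))" using x by (simp add: shell_def)
    thus "x \<in> snd ` (Sigma UNIV (\<lambda>m. shell L (real (2 * m))))" by force
  qed (auto simp: shell_def)
qed

lemma shell_sums:
  assumes P: "hom_harmonic_poly k P" and t: "t > 0"
  shows "(\<lambda>m. shell_sum P m * exp (- 2 * pi * t) ^ m) sums theta P t"
proof -
  from P obtain c where c: "P = (\<lambda>x. \<Sum>\<alpha>\<in>expo k. c \<alpha> * monomial \<alpha> x)"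
    unfolding hom_harmonic_poly_def expo_def monomial_def by blast
  define f where "f = (\<lambda>x. exp (- pi * t * (x \<bullet> x)) * P x)"
  have "(f has_sum theta P t) L" unfolding f_def by (rule hom_poly_theta(1)[OF t c])
  hence "((\<lambda>p. f (snd p)) has_sum theta P t) (Sigma UNIV (\<lambda>m. shell L (real (2 * m))))"
    using has_sum_reindex_bij_betw[OF bij_betw_shells, of f] by simp
  hence "((\<lambda>m. shell_sum P m * exp (- 2 * pi * t) ^ m) has_sum theta P t) UNIV"
  proof (rule has_sum_SigmaD)
    fix m :: nat
    have "(\<Sum>x\<in>shell L (real (2 * m)). f x) = shell_sum P m * exp (- 2 * pi * t) ^ m"
      unfolding shell_sum_def sum_distrib_right
    proof (rule sum.cong[OF refl])
      fix x assume "x \<in> shell L (real (2 * m))"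
      hence "x \<bullet> x = 2 * real m" by (simp add: shell_def)
      hence "exp (- pi * t * (x \<bullet> x)) = exp (- 2 * pi * t) ^ m"
        by (simp add: exp_of_nat_mult[symmetric] mult_ac)
      thus "f x = P x * exp (- 2 * pi * t) ^ m" by (simp add: f_def)
    qed
    thus "((\<lambda>x. f (snd (m, x))) has_sum shell_sum P m * exp (- 2 * pi * t) ^ m) (shell L (real (2 * m)))"
      using finite_shell by (intro has_sum_finiteI) auto
  qed
  thus ?thesis by (rule has_sum_imp_sums)
qed

definition theta_fps :: "(real^'n \<Rightarrow> real) \<Rightarrow> complex fps" where
  "theta_fps P = Abs_fps (\<lambda>m. of_real (shell_sum P m))"

text \<open>Every r in (0, 1) has the form exp(-2 pi t) with t > 0, where the series over the shells
  converges.\<close>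

lemma theta_fps_conv_radius:
  assumes P: "hom_harmonic_poly k P"
  shows "fps_conv_radius (theta_fps P) \<ge> 1"
  unfolding fps_conv_radius_def
proof (rule conv_radius_geI_ex)
  fix r :: real assume r: "0 < r" "ereal r < 1"
  define t where "t = - ln r / (2 * pi)"
  have "ln r < 0" using r by (simp add: one_ereal_def)
  hence t: "t > 0" by (simp add: t_def divide_neg_pos)
  have "exp (- 2 * pi * t) = r" using r by (simp add: t_def)
  hence "summable (\<lambda>m. shell_sum P m * r ^ m)" using shell_sums[OF P t] by (simp add: sums_iff)
  hence "summable (\<lambda>m. complex_of_real (shell_sum P m * r ^ m))" by (rule summable_of_real)
  thus "\<exists>z. norm z = r \<and> summable (\<lambda>n. fps_nth (theta_fps P) n * z ^ n)"
    using r by (intro exI[of _ "complex_of_real r"]) (simp add: theta_fps_def)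
qed

lemma theta_fps_axis:
  assumes P: "hom_harmonic_poly k P" and t: "t > 0"
  shows "eval_fps (theta_fps P) (of_real (exp (- 2 * pi * t))) = of_real (theta P t)"
proof -
  have "(\<lambda>m. complex_of_real (shell_sum P m * exp (- 2 * pi * t) ^ m)) sums of_real (theta P t)"
    by (intro sums_of_real shell_sums[OF P t])
  thus ?thesis by (simp add: eval_fps_def theta_fps_def sums_iff)
qed

text \<open>Divisibility of n by 8 makes i^(n/2) = 1, so that i^k t^k sqrt(t)^n is the full factor
  (i t)^(k + n/2).\<close>

lemma theta_modular:
  assumes P: "hom_harmonic_poly k P"
  shows "disc_modular (k + CARD('n) div 2) (eval_fps (theta_fps P))"
proof (rule disc_modularI_imaginary_axis)
  show "eval_fps (theta_fps P) holomorphic_on ball 0 1"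
  proof (rule holomorphic_on_eval_fps, rule subsetI)
    fix q :: complex assume "q \<in> ball 0 1"
    hence "ereal (norm q) < 1" by (simp add: one_ereal_def)
    also note theta_fps_conv_radius[OF P]
    finally show "q \<in> eball 0 (fps_conv_radius (theta_fps P))" by (simp add: in_eball_iff)
  qed
  fix t :: real assume t: "t > 0"
  obtain p where p: "CARD('n) = 8 * p" using card_dvd by (elim dvdE)
  have "eval_fps (theta_fps P) (of_real (exp (- 2 * pi / t))) = of_real (theta P (1 / t))"
    using theta_fps_axis[OF P, of "1 / t"] t by simp
  also have "\<dots> = \<i> ^ k * of_real (t ^ k * sqrt t ^ CARD('n) * theta P t)"
    by (rule theta_transformation[OF t P])
  also have "sqrt t ^ CARD('n) = t ^ (4 * p)"
  proof -
    have "sqrt t ^ CARD('n) = (sqrt t ^ 2) ^ (4 * p)" unfolding p power_mult[symmetric] by simp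
    thus ?thesis using t by simp
  qed
  also have "\<i> ^ k * of_real (t ^ k * t ^ (4 * p) * theta P t) =
      (\<i> * of_real t) ^ (k + CARD('n) div 2) * of_real (theta P t)"
  proof -
    have "\<i> ^ (4 * p) = 1" by (simp add: power_mult)
    thus ?thesis by (simp add: p power_add power_mult_distrib)
  qed
  finally show "eval_fps (theta_fps P) (of_real (exp (- 2 * pi / t))) =
      (\<i> * of_real t) ^ (k + CARD('n) div 2) * eval_fps (theta_fps P) (of_real (exp (- 2 * pi * t)))"
    using theta_fps_axis[OF P t] by simp
qed

lemma shell_zero: "shell L 0 = {0}"
  using zero_mem by (auto simp: shell_def)

lemma eval_theta_fps_0: "eval_fps (theta_fps P) 0 = of_real (P 0)"
  by (simp add: eval_fps_at_0 theta_fps_def shell_sum_def shell_zero)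

lemma shell_sum_odd:
  assumes P: "hom_harmonic_poly k P" and k: "odd k"
  shows "shell_sum P m = 0"
proof -
  obtain c where c: "P = (\<lambda>x. \<Sum>\<alpha>\<in>{\<alpha>. sum \<alpha> UNIV = k}. c \<alpha> * (\<Prod>i\<in>UNIV. (x$i) ^ (\<alpha> i)))"
    using P unfolding hom_harmonic_poly_def by blast
  have neg: "P (- x) = - P x" for x
  proof -
    have "(\<Prod>i\<in>UNIV. ((- x)$i) ^ (\<alpha> i)) = - (\<Prod>i\<in>UNIV. (x$i) ^ (\<alpha> i))" if "sum \<alpha> UNIV = k" for \<alpha>
    proof -
      have "(\<Prod>i\<in>UNIV. ((- x)$i) ^ (\<alpha> i)) = (\<Prod>i\<in>UNIV. (- 1) ^ \<alpha> i * (x$i) ^ \<alpha> i)"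
        by (intro prod.cong refl) (simp add: power_minus[of "x$_"])
      also have "\<dots> = (- 1) ^ k * (\<Prod>i\<in>UNIV. (x$i) ^ (\<alpha> i))"
        using that by (simp add: prod.distrib power_sum[symmetric])
      finally show ?thesis using k by simp
    qed
    hence "P (- x) = (\<Sum>\<alpha>\<in>{\<alpha>. sum \<alpha> UNIV = k}. - (c \<alpha> * (\<Prod>i\<in>UNIV. (x$i) ^ (\<alpha> i))))"
      unfolding c by (intro sum.cong refl) simp
    thus ?thesis by (simp add: c sum_negf)
  qed
  have "shell_sum P m = (\<Sum>x\<in>shell L (real (2 * m)). P (- x))"
    unfolding shell_sum_def
    by (rule sum.reindex_bij_witness[of _ uminus uminus]) (auto simp: shell_def uminus_mem)
  also have "\<dots> = - shell_sum P m" by (simp add: neg sum_negf shell_sum_def)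
  finally show ?thesis by simp
qed

lemma shell_sum_eq_0I:
  assumes P: "hom_harmonic_poly k P" and zero: "\<And>q. norm q < 1 \<Longrightarrow> eval_fps (theta_fps P) q = 0"
  shows "shell_sum P m = 0"
proof -
  have "eval_fps (theta_fps P) has_fps_expansion theta_fps P"
    using theta_fps_conv_radius[OF P] by (intro eval_fps_has_fps_expansion) (auto intro: less_le_trans[of _ 1])
  moreover have "eval_fps (theta_fps P) has_fps_expansion 0"
  proof -
    have "eventually (\<lambda>q. q \<in> ball 0 1) (nhds (0::complex))" by (intro eventually_nhds_in_open) auto
    hence "eventually (\<lambda>q. eval_fps (theta_fps P) q = 0) (nhds 0)"
      by eventually_elim (simp add: zero)
    thus ?thesis by (simp add: has_fps_expansion_0_iff)
  qed
  ultimately have "theta_fps P = 0" by (rule fps_expansion_unique_complex)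
  thus ?thesis by (simp add: theta_fps_def fps_eq_iff)
qed

text \<open>Since tau(1) = 1, the multiple of Delta is the sum of P over the vectors of norm
  2.\<close>

lemma shell_sum_weight_12:
  assumes P: "hom_harmonic_poly k P" and k: "k \<ge> 1" "k + CARD('n) div 2 = 12"
  shows "shell_sum P (Suc m) = shell_sum P 1 * of_int (ramanujan_tau (Suc m))"
proof -
  have "disc_modular 12 (eval_fps (theta_fps P))" "eval_fps (theta_fps P) 0 = 0"
    using theta_modular[OF P] k hom_poly_zero[OF P k(1)] by (simp_all add: eval_theta_fps_0)
  then obtain c where c: "\<And>q. norm q < 1 \<Longrightarrow> eval_fps (theta_fps P) q = c * (q * delta_quot q)"
    using Delta.cusp_form_weight_12 by blast
  have "eval_fps (theta_fps P) has_fps_expansion theta_fps P"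
    using theta_fps_conv_radius[OF P] by (intro eval_fps_has_fps_expansion) (auto intro: less_le_trans[of _ 1])
  moreover have "eval_fps (theta_fps P) has_fps_expansion
      fps_const c * (fps_X * Abs_fps (\<lambda>n. of_int (ramanujan_tau (Suc n))))"
  proof -
    have "(\<lambda>q. c * (q * delta_quot q)) has_fps_expansion
        fps_const c * (fps_X * Abs_fps (\<lambda>n. of_int (ramanujan_tau (Suc n))))"
      by (intro fps_expansion_intros delta_quot_has_fps_expansion)
    moreover have "eventually (\<lambda>q. q \<in> ball 0 1) (nhds (0::complex))" by (intro eventually_nhds_in_open) auto
    hence "eventually (\<lambda>q. c * (q * delta_quot q) = eval_fps (theta_fps P) q) (nhds 0)"
      by eventually_elim (simp add: c)
    ultimately show ?thesis using has_fps_expansion_cong[OF _ refl] by metis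
  qed
  ultimately have eq: "theta_fps P = fps_const c * (fps_X * Abs_fps (\<lambda>n. of_int (ramanujan_tau (Suc n))))"
    by (rule fps_expansion_unique_complex)
  have "complex_of_real (shell_sum P (Suc m)) = c * of_int (ramanujan_tau (Suc m))" for m
    using arg_cong[OF eq, of "\<lambda>F. fps_nth F (Suc m)"] by (simp add: theta_fps_def)
  note coeff = this
  have "ramanujan_tau (Suc 0) = 1"
    using fps_nth_mult_one_minus_X_power[of 0 1 1 24] by (simp add: ramanujan_tau_def)
  hence "complex_of_real (shell_sum P 1) = c" using coeff[of 0] by simp
  hence "complex_of_real (shell_sum P (Suc m)) = of_real (shell_sum P 1 * of_int (ramanujan_tau (Suc m)))"
    using coeff[of m] by simp
  thus ?thesis by (simp only: of_real_eq_iff)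
qed

end

text \<open>With this polynomial the theta series of \<open>W8\<close> itself becomes available as a
  form of weight 4.\<close>

lemma hom_harmonic_one: "hom_harmonic_poly 0 (\<lambda>x::real^'n. 1)"
proof -
  have "{\<alpha> :: 'n \<Rightarrow> nat. sum \<alpha> UNIV = 0} = {\<lambda>_. 0}" by (auto simp: fun_eq_iff)
  thus ?thesis unfolding hom_harmonic_poly_def by (intro exI[of _ "\<lambda>_. 1"]) simp
qed

lemma even_lattice_Dplus:
  assumes "8 dvd CARD('n::finite)"
  shows "even_lattice (Dplus (o' :: 'n))"
  by unfold_locales (use Dplus_selfdual[OF assms] Dplus_even[OF assms] assms in auto)

lemma even_lattice_even_selfdual:
  assumes "even_selfdual_lattice (L :: (real^'n) set)" "8 dvd CARD('n)"
  shows "even_lattice L"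
  by unfold_locales (use assms in \<open>auto simp: even_selfdual_lattice_def\<close>)

context even_lattice
begin

text \<open>Below weight 12 there are no nonzero cusp forms. For weight 14 the auxiliary form of
  weight 4 is the theta series of \<open>W8\<close>, which does not vanish at z = i since all its
  terms are positive on the imaginary axis.\<close>

lemma shell_sum_eq_0:
  assumes P: "hom_harmonic_poly k P" and k: "k \<ge> 1"
    and w: "k + CARD('n) div 2 < 12 \<or> k + CARD('n) div 2 = 14"
  shows "shell_sum P m = 0"
proof (rule shell_sum_eq_0I[OF P])
  fix q :: complex assume q: "norm q < 1"
  have h0: "eval_fps (theta_fps P) 0 = 0" using hom_poly_zero[OF P k] by (simp add: eval_theta_fps_0)
  show "eval_fps (theta_fps P) q = 0"
  proof (cases "k + CARD('n) div 2 < 12")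
    case True
    from Delta.cusp_form_weight_less_12[OF theta_modular[OF P] h0 True q] show ?thesis .
  next
    case False
    hence mod: "disc_modular 14 (eval_fps (theta_fps P))" using w theta_modular[OF P] by simp
    interpret W: even_lattice "Dplus (1 :: 8)" by (rule even_lattice_Dplus) simp
    define E where "E = eval_fps (W.theta_fps (\<lambda>_. 1))"
    have "disc_modular 4 E" unfolding E_def using W.theta_modular[OF hom_harmonic_one] by simp
    moreover have "E 0 = 1" by (simp add: E_def W.eval_theta_fps_0)
    moreover have "E (qexp \<i>) \<noteq> 0"
    proof -
      have "E (qexp \<i>) = of_real (W.theta (\<lambda>_. 1) 1)"
        using W.theta_fps_axis[OF hom_harmonic_one, of 1] qexp_i_times[of 1] by (simp add: E_def)
      moreover have "W.theta (\<lambda>_. 1) 1 > 0"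
      proof -
        have "(\<lambda>x. exp (- pi * (x \<bullet> x))) summable_on Dplus (1 :: 8)"
          by (rule W.summable_gaussian) simp
        from finite_sum_le_infsum[OF this, of "{0}"] W.zero_mem
        have "1 \<le> W.theta (\<lambda>_. 1) 1" by (simp add: W.theta_def)
        thus ?thesis by simp
      qed
      ultimately show ?thesis by simp
    qed
    ultimately show ?thesis using mod h0 q by (rule Delta.cusp_form_weight_14)
  qed
qed

lemma spherical_designI:
  assumes "\<And>k P. 1 \<le> k \<Longrightarrow> k \<le> t \<Longrightarrow> even k \<Longrightarrow> hom_harmonic_poly k P \<Longrightarrow> shell_sum P m = 0"
  shows "spherical_design t (shell L (real (2 * m)))"
  unfolding spherical_design_def
proof (intro conjI allI impI)
  show "finite (shell L (real (2 * m)))" by (rule finite_shell)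
  show "\<exists>r. \<forall>x\<in>shell L (real (2 * m)). x \<bullet> x = r" by (auto simp: shell_def)
  fix k P assume "1 \<le> k \<and> k \<le> t \<and> hom_harmonic_poly k (P :: real^'n \<Rightarrow> real)"
  hence "shell_sum P m = 0" using assms shell_sum_odd by (cases "even k") auto
  thus "(\<Sum>x\<in>shell L (real (2 * m)). P x) = 0" by (simp add: shell_sum_def)
qed

lemma spherical_designD:
  assumes "spherical_design t (shell L (real (2 * m)))" "1 \<le> k" "k \<le> t" "hom_harmonic_poly k P"
  shows "shell_sum P m = 0"
  using assms unfolding spherical_design_def shell_sum_def by blast

end

lemma spherical_design_mono: "spherical_design t X \<Longrightarrow> s \<le> t \<Longrightarrow> spherical_design s X"
  unfolding spherical_design_def by (meson order_trans)

section \<open>Test polynomials on the vectors of norm 2\<close>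

lemma Dplus_coords:
  fixes x :: "real^'n"
  assumes x: "x \<in> Dplus o'"
  shows "(\<forall>i. x$i \<in> \<int>) \<or> (\<forall>i. (x$i)\<^sup>2 \<ge> 1 / 4)"
proof (cases "x$o' \<in> \<int>")
  case True
  have "x$i \<in> \<int>" for i
  proof -
    have "x$i - x$o' \<in> \<int>" using x by (simp add: Dplus_def)
    from Ints_add[OF this True] show ?thesis by simp
  qed
  thus ?thesis by blast
next
  case False
  have "(x$i)\<^sup>2 \<ge> 1 / 4" for i
  proof -
    have "x$i - x$o' \<in> \<int>" using x by (simp add: Dplus_def)
    hence "x$i \<noteq> 0" using False Ints_minus[of "- x$o'"] by auto
    moreover obtain z :: int where z: "2 * x$i = of_int z" using x by (auto simp: Dplus_def elim!: Ints_cases)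
    ultimately have "z \<noteq> 0" by auto
    hence "z\<^sup>2 \<ge> 1" by (simp add: int_one_le_iff_zero_less)
    hence "(real_of_int z)\<^sup>2 \<ge> 1" by (metis of_int_1_le_iff of_int_power)
    thus ?thesis unfolding z[symmetric] by (simp add: power_mult_distrib)
  qed
  thus ?thesis by blast
qed

lemma int_coord_sq:
  fixes x :: "real^'n"
  assumes "x \<bullet> x = 2" "\<And>i. x$i \<in> \<int>"
  shows "(x$i)\<^sup>2 = 0 \<or> (x$i)\<^sup>2 = 1"
proof -
  obtain z :: int where z: "x$i = of_int z" using assms(2) by (auto elim!: Ints_cases)
  have "(x$i)\<^sup>2 \<le> (\<Sum>i\<in>UNIV. (x$i)\<^sup>2)" by (intro member_le_sum) auto
  also have "\<dots> = 2" using assms(1) by (simp add: inner_vec_def power2_eq_square)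
  finally have "z\<^sup>2 \<le> 2" unfolding z by (metis of_int_le_iff of_int_numeral of_int_power)
  have "\<bar>z\<bar> < 2"
  proof (rule ccontr)
    assume "\<not> \<bar>z\<bar> < 2"
    hence "2\<^sup>2 \<le> \<bar>z\<bar>\<^sup>2" by (intro power_mono) auto
    thus False using \<open>z\<^sup>2 \<le> 2\<close> by simp
  qed
  hence "z = 0 \<or> z = 1 \<or> z = - 1" by auto
  thus ?thesis using z by auto
qed

lemma norm_sq_sum: "x \<bullet> x = (\<Sum>i\<in>UNIV. (x$i)\<^sup>2)" for x :: "real^'n"
  by (simp add: inner_vec_def power2_eq_square)

text \<open>Three successive squarings of u + i v. The result is written in the squares of the two
  coordinates, since these are what is known about vectors of norm 2.\<close>

lemma hpoly_8: "hpoly i j 8 x = (((x$i)\<^sup>2 - (x$j)\<^sup>2)\<^sup>2 - 4 * ((x$i)\<^sup>2 * (x$j)\<^sup>2))\<^sup>2 -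
    16 * ((x$i)\<^sup>2 * (x$j)\<^sup>2) * ((x$i)\<^sup>2 - (x$j)\<^sup>2)\<^sup>2"
proof -
  define u v where "u = x$i" and "v = x$j"
  have sq: "(Complex a b)\<^sup>2 = Complex (a\<^sup>2 - b\<^sup>2) (2 * a * b)" for a b
    by (simp add: complex_eq_iff power2_eq_square)
  have "(complex_of_real u + \<i> * of_real v) ^ 8 = (((Complex u v)\<^sup>2)\<^sup>2)\<^sup>2"
    by (simp only: power_mult[symmetric]) (simp add: Complex_eq)
  hence "hpoly i j 8 x = ((u\<^sup>2 - v\<^sup>2)\<^sup>2 - (2 * u * v)\<^sup>2)\<^sup>2 - (2 * (u\<^sup>2 - v\<^sup>2) * (2 * u * v))\<^sup>2"
    unfolding hpoly_def u_def[symmetric] v_def[symmetric] by (simp only: sq complex.sel)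
  also have "\<dots> = ((u\<^sup>2 - v\<^sup>2)\<^sup>2 - 4 * (u\<^sup>2 * v\<^sup>2))\<^sup>2 - 16 * (u\<^sup>2 * v\<^sup>2) * (u\<^sup>2 - v\<^sup>2)\<^sup>2"
  proof -
    have "(2 * A * (2 * u * v))\<^sup>2 = 16 * (u\<^sup>2 * v\<^sup>2) * A\<^sup>2" "(2 * u * v)\<^sup>2 = 4 * (u\<^sup>2 * v\<^sup>2)" for A
      by (simp_all add: power2_eq_square)
    thus ?thesis by (simp only:)
  qed
  finally show ?thesis by (simp only: u_def v_def)
qed

lemma hpoly_4: "hpoly i j 4 x = (x$i)^4 - 6 * ((x$i)\<^sup>2 * (x$j)\<^sup>2) + (x$j)^4"
proof -
  define u v where "u = x$i" and "v = x$j"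
  have sq: "(Complex a b)\<^sup>2 = Complex (a\<^sup>2 - b\<^sup>2) (2 * a * b)" for a b
    by (simp add: complex_eq_iff power2_eq_square)
  have "(complex_of_real u + \<i> * of_real v) ^ 4 = ((Complex u v)\<^sup>2)\<^sup>2"
    by (simp only: power_mult[symmetric]) (simp add: Complex_eq)
  hence "hpoly i j 4 x = (u\<^sup>2 - v\<^sup>2)\<^sup>2 - (2 * u * v)\<^sup>2"
    unfolding hpoly_def u_def[symmetric] v_def[symmetric] by (simp only: sq complex.sel)
  also have "\<dots> = u^4 - 6 * (u\<^sup>2 * v\<^sup>2) + v^4"
    by (simp add: power2_eq_square power4_eq_xxxx algebra_simps)
  finally show ?thesis by (simp add: u_def v_def)
qed

lemma axis_sum_in_shell:
  fixes i j o' :: "'n::finite"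
  assumes "i \<noteq> j"
  shows "axis i 1 + axis j 1 \<in> shell (Dplus o') 2"
  using axis_pair_in_Dplus(1)[OF assms, of o'] assms
  by (simp add: shell_def inner_add_left inner_add_right inner_axis_axis)

text \<open>Every summand is nonnegative: when the squares of the two coordinates are 1 and 1, 1 and
  0, 0 and 0, or 1/4 and 1/4, the polynomial has the value 16, 1, 0 or 1/16.\<close>

lemma W8_root_sum_pos: "(\<Sum>x\<in>shell (Dplus (1 :: 8)) 2. hpoly 0 1 8 x) > 0"
proof -
  interpret W: even_lattice "Dplus (1 :: 8)" by (rule even_lattice_Dplus) simp
  define r :: "real^8" where "r = axis 0 1 + axis 1 1"
  have r: "r \<in> shell (Dplus 1) 2" unfolding r_def by (rule axis_sum_in_shell) simp
  have "r$0 = 1" "r$1 = 1" by (simp_all add: r_def axis_def)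
  hence "hpoly 0 1 8 r > 0" by (simp add: hpoly_8)
  moreover have "hpoly 0 1 8 x \<ge> 0" if "x \<in> shell (Dplus (1 :: 8)) 2" for x
  proof -
    have x: "x \<in> Dplus 1" "x \<bullet> x = 2" using that by (auto simp: shell_def)
    from Dplus_coords[OF x(1)] show ?thesis
    proof
      assume "\<forall>i. x$i \<in> \<int>"
      hence "(x$i)\<^sup>2 = 0 \<or> (x$i)\<^sup>2 = 1" for i by (intro int_coord_sq x) auto
      from this[of 0] this[of 1] show ?thesis unfolding hpoly_8 by (elim disjE) (simp_all only:, simp_all)
    next
      assume ge: "\<forall>i. (x$i)\<^sup>2 \<ge> 1 / 4"
      have eq: "(x$i)\<^sup>2 = 1 / 4" for i
      proof -
        \<comment> \<open>The terms are nonnegative and add up to 2 - 8/4 = 0.\<close>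
        have "(\<Sum>i\<in>UNIV. (x$i)\<^sup>2 - 1 / 4) = 0" using x(2) by (simp add: norm_sq_sum sum_subtractf)
        hence "(x$i)\<^sup>2 - 1 / 4 = 0" using ge by (subst (asm) sum_nonneg_eq_0_iff) auto
        thus ?thesis by simp
      qed
      show ?thesis unfolding hpoly_8 eq by simp
    qed
  qed
  ultimately show ?thesis using r W.finite_shell by (intro sum_pos2[of _ r]) auto
qed

text \<open>Vectors with half-odd coordinates have norm at least 16/4 = 4, so a vector of norm 2 has
  exactly two nonzero coordinates, each 1 or -1. A single \<open>hpoly i j 4\<close> is -4 if both i
  and j are among these two, 1 if one of them is, and 0 otherwise. Of the ordered pairs, 2 are of
  the first kind and 56 of the second, and 56 - 8 = 48.\<close>

lemma D16_root_sum:
  assumes x: "x \<in> shell (Dplus (o' :: 16)) 2"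
  shows "(\<Sum>i\<in>UNIV. \<Sum>j\<in>UNIV-{i}. hpoly i j 4 x) = 48"
proof -
  have xD: "x \<in> Dplus o'" and n2: "x \<bullet> x = 2" using x by (auto simp: shell_def)
  have "\<forall>i. x$i \<in> \<int>"
  proof (rule ccontr)
    assume "\<not> ?thesis"
    hence "\<forall>i. (x$i)\<^sup>2 \<ge> 1 / 4" using Dplus_coords[OF xD] by blast
    hence "(\<Sum>i\<in>(UNIV :: 16 set). 1 / 4) \<le> (\<Sum>i\<in>UNIV. (x$i)\<^sup>2)" by (intro sum_mono) auto
    thus False using n2 by (simp add: norm_sq_sum)
  qed
  hence sq: "(x$i)\<^sup>2 = 0 \<or> (x$i)\<^sup>2 = 1" for i by (intro int_coord_sq n2) auto
  have four: "(x$i)^4 = (x$i)\<^sup>2" for i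
  proof -
    have "(x$i)^4 = ((x$i)\<^sup>2)\<^sup>2" by (simp only: power_mult[symmetric]) simp
    thus ?thesis using sq[of i] by (elim disjE) (simp_all only:, simp_all)
  qed
  have s: "(\<Sum>i\<in>UNIV. (x$i)\<^sup>2) = 2" using n2 by (simp add: norm_sq_sum)
  have "(\<Sum>j\<in>UNIV-{i}. hpoly i j 4 x) = 8 * (x$i)\<^sup>2 + 2" for i
  proof -
    have "(\<Sum>j\<in>UNIV-{i}. hpoly i j 4 x) = (\<Sum>j\<in>UNIV. hpoly i j 4 x) - hpoly i i 4 x"
      by (simp add: sum_diff1)
    also have "(\<Sum>j\<in>UNIV. hpoly i j 4 x) = 4 * (x$i)\<^sup>2 + 2"
      unfolding hpoly_4 four
      by (simp add: sum.distrib sum_subtractf sum_distrib_left[symmetric] s)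
    also have "hpoly i i 4 x = - 4 * (x$i)\<^sup>2"
      unfolding hpoly_4 using four[of i] by (simp add: power2_eq_square power4_eq_xxxx)
    finally show ?thesis by simp
  qed
  thus ?thesis by (simp add: sum.distrib sum_distrib_left[symmetric] s)
qed

theorem proposition11p4:
  fixes m :: nat
  assumes "m \<ge> 1"
  shows "(ramanujan_tau m = 0 \<longleftrightarrow> spherical_design 8 (shell W8 (real (2 * m))))
       \<and> (ramanujan_tau m = 0 \<longleftrightarrow>
            (\<forall>L :: (real^16) set. even_selfdual_lattice L \<longrightarrow>
               spherical_design 4 (shell L (real (2 * m)))))
       \<and> (ramanujan_tau m = 0 \<longrightarrow>
            spherical_design 11 (shell W8 (real (2 * m))) \<and>
            (\<forall>L :: (real^16) set. even_selfdual_lattice L \<longrightarrow>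
               spherical_design 7 (shell L (real (2 * m)))))"
proof -
  obtain n where m: "m = Suc n" using assms by (cases m) auto
  interpret W: even_lattice "Dplus (1 :: 8)" by (rule even_lattice_Dplus) simp
  interpret D: even_lattice "Dplus (0 :: 16)" by (rule even_lattice_Dplus) simp
  have W11: "spherical_design 11 (shell W8 (real (2 * m)))" if tau: "ramanujan_tau m = 0"
    unfolding W8_eq_Dplus
  proof (rule W.spherical_designI)
    fix k and P :: "real^8 \<Rightarrow> real"
    assume k: "1 \<le> k" "k \<le> 11" "even k" and P: "hom_harmonic_poly k P"
    show "W.shell_sum P m = 0"
    proof (cases "k = 8")
      case True
      thus ?thesis using W.shell_sum_weight_12[OF P, of n] tau by (simp add: m)
    next
      case False
      \<comment> \<open>The other even degrees 2, 4, 6 and 10 have the weights 6, 8, 10 and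
        14.\<close>
      hence "k + CARD(8) div 2 < 12 \<or> k + CARD(8) div 2 = 14" using k by (simp, presburger)
      thus ?thesis by (rule W.shell_sum_eq_0[OF P k(1)])
    qed
  qed
  have L7: "spherical_design 7 (shell L (real (2 * m)))"
    if tau: "ramanujan_tau m = 0" and L: "even_selfdual_lattice L" for L :: "(real^16) set"
  proof -
    interpret L: even_lattice L by (rule even_lattice_even_selfdual[OF L]) simp
    show ?thesis
    proof (rule L.spherical_designI)
      fix k and P :: "real^16 \<Rightarrow> real"
      assume k: "1 \<le> k" "k \<le> 7" "even k" and P: "hom_harmonic_poly k P"
      show "L.shell_sum P m = 0"
      proof (cases "k = 4")
        case True
        thus ?thesis using L.shell_sum_weight_12[OF P, of n] tau by (simp add: m)
      next
        case False
        \<comment> \<open>The other even degrees 2 and 6 have the weights 10 and 14.\<close>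
        hence "k + CARD(16) div 2 < 12 \<or> k + CARD(16) div 2 = 14" using k by (simp, presburger)
        thus ?thesis by (rule L.shell_sum_eq_0[OF P k(1)])
      qed
    qed
  qed
  have W_conv: "ramanujan_tau m = 0" if "spherical_design 8 (shell W8 (real (2 * m)))"
  proof -
    have P: "hom_harmonic_poly 8 (hpoly (0::8) 1 8)" by (rule hom_harmonic_hpoly) simp
    have "W.shell_sum (hpoly 0 1 8) m = 0"
      using that unfolding W8_eq_Dplus by (rule W.spherical_designD[where k = 8]) (auto simp: P)
    moreover have "W.shell_sum (hpoly 0 1 8) 1 > 0"
      using W8_root_sum_pos by (simp add: W.shell_sum_def)
    ultimately show ?thesis using W.shell_sum_weight_12[OF P, of n] by (simp add: m)
  qed
  have D_conv: "ramanujan_tau m = 0"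
    if "\<forall>L :: (real^16) set. even_selfdual_lattice L \<longrightarrow> spherical_design 4 (shell L (real (2 * m)))"
  proof (rule ccontr)
    assume tau: "ramanujan_tau m \<noteq> 0"
    have "even_selfdual_lattice (Dplus (0 :: 16))"
      by (rule Dplus_even_selfdual_lattice[of 1]) simp_all
    hence design: "spherical_design 4 (shell (Dplus (0 :: 16)) (real (2 * m)))" using that by blast
    \<comment> \<open>As tau(m) is nonzero, the weight 12 formula carries the vanishing of the sums
      from the shell of norm 2 m back to the shell of norm 2, where the sum over all ordered pairs
      is 48 for each vector.\<close>
    have zero: "D.shell_sum (hpoly i j 4) 1 = 0" if "i \<noteq> j" for i j :: 16
    proof -
      have P: "hom_harmonic_poly 4 (hpoly i j 4)" by (rule hom_harmonic_hpoly[OF that])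
      have "D.shell_sum (hpoly i j 4) m = 0"
        using design by (rule D.spherical_designD[where k = 4]) (auto simp: P)
      thus ?thesis using D.shell_sum_weight_12[OF P, of n] tau by (simp add: m)
    qed
    have "(\<Sum>j\<in>UNIV-{i}. D.shell_sum (hpoly i j 4) 1) = 0" for i
    proof (rule sum.neutral, rule ballI)
      fix j assume "j \<in> UNIV - {i}"
      hence "i \<noteq> j" by blast
      thus "D.shell_sum (hpoly i j 4) 1 = 0" by (rule zero)
    qed
    hence "0 = (\<Sum>i\<in>UNIV. \<Sum>j\<in>UNIV-{i}. D.shell_sum (hpoly i j 4) 1)"
      by (simp only: sum.neutral_const)
    also have "\<dots> = (\<Sum>i\<in>UNIV. \<Sum>x\<in>shell (Dplus (0 :: 16)) 2. \<Sum>j\<in>UNIV-{i}. hpoly i j 4 x)"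
    proof (rule sum.cong[OF refl])
      fix i :: 16
      show "(\<Sum>j\<in>UNIV-{i}. D.shell_sum (hpoly i j 4) 1) =
          (\<Sum>x\<in>shell (Dplus (0 :: 16)) 2. \<Sum>j\<in>UNIV-{i}. hpoly i j 4 x)"
        unfolding D.shell_sum_def by (subst sum.swap) simp
    qed
    also have "\<dots> = (\<Sum>x\<in>shell (Dplus (0 :: 16)) 2. \<Sum>i\<in>UNIV. \<Sum>j\<in>UNIV-{i}. hpoly i j 4 x)"
      by (rule sum.swap)
    also have "\<dots> = 48 * real (card (shell (Dplus (0 :: 16)) 2))"
      by (simp add: D16_root_sum)
    finally have "card (shell (Dplus (0 :: 16)) 2) = 0" by simp
    moreover have "axis 0 1 + axis 1 1 \<in> shell (Dplus (0 :: 16)) 2"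
      by (rule axis_sum_in_shell) simp
    ultimately show False using D.finite_shell[of 2] by auto
  qed
  show ?thesis
    using W11 L7 W_conv D_conv spherical_design_mono[of 11 _ 8] spherical_design_mono[of 7 _ 4] by auto
qed

end
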